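(* Let $\mathcal{H}$ be a separable infinite dimensional Hilbert space. (a) Let $\Omega\in HS(\mathcal{H})$ be a cyclic and separating vector for $\mathfrak{A}_l$, let $T$ be the associated Hilbert-Schmidt operator on $\mathcal{H}$, and let $h=-2\log|T|$. Then $h$ has a discrete spectrum: there is an orthonormal basis of $\mathcal{H}$ consisting of eigenvectors of $h$, with eigenvalues $(h_i)_{i\in\mathbb{N}}$ (counted with multiplicity) diverging to $+\infty$, and $$\sum_{i=1}^\infty e^{-h_i}=\|T\|_2^2<\infty .$$ (b) Conversely, if $h$ is a self-adjoint operator on $\mathcal{H}$ such that $e^{-\frac12 h}$ is a Hilbert-Schmidt operator, then $h$ admits a KMS state, i.e. there exists an $(\alpha,1)$-KMS state on the von Neumann algebra $\{A\vee\mathbb{1} : A\in B(\mathcal{H})\}$ for the dynamics $\alpha_t(A\vee\mathbb{1})=(e^{ith}Ae^{-ith})\vee\mathbb{1}$, $t\in\mathbb{R}$.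
   Context: $\mathcal{H}$ is a complex Hilbert space with inner product antilinear in the first variable, with a fixed orthonormal basis $\{e_n\}_{n\in\mathbb{N}}$. $HS(\mathcal{H})$ is the Hilbert space of Hilbert-Schmidt operators on $\mathcal{H}$, with inner product $\langle A,B\rangle_{HS}=\operatorname{Tr}(AB^\ast)$ and norm $\|\cdot\|_2$. For $e,f\in\mathcal{H}$, $(e\otimes f)x=\langle e,x\rangle f$. For bounded operators $A,B$ on $\mathcal{H}$, $A\vee B$ is the bounded operator on $HS(\mathcal{H})$ given by $(A\vee B)X=AXB^\ast$, and $\mathfrak{A}_l=\{A\vee\mathbb{1} : A\in HS(\mathcal{H})\}$. A vector $\Omega\in HS(\mathcal{H})$ is cyclic for $\mathfrak{A}_l$ if $\mathfrak{A}_l\Omega$ is dense in $HS(\mathcal{H})$, and separating if $X\in\mathfrak{A}_l$, $X\Omega=0$ imply $X=0$. Writing $\Omega=\sum_{m,n=1}^\infty a_{mn}\,e_m\otimes e_n$ and $y_m=\sum_{n=1}^\infty a_{mn}e_n$, the operator $T$ associated with $\Omega$ is the Hilbert-Schmidt operator on $\mathcal{H}$ with $Te_m=y_m$ for all $m$; when $\Omega$ is cyclic and separating $T$ is injective, so $\log|T|$ is defined by functional calculus, where $|T|=(T^\ast T)^{1/2}$. KMS states: for a von Neumann algebra $\mathfrak{M}$ with one-parameter automorphism group $\tau$ and $\beta\in\mathbb{R}$, a normal state $\omega$ on $\mathfrak{M}$ is a $(\tau,\beta)$-KMS state if for all $A,B\in\mathfrak{M}$ there is a complex function $F_{A,B}$,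 analytic on $\mathcal{D}_\beta=\{z\in\mathbb{C} : 0<\operatorname{sgn}(\beta)\operatorname{Im} z<|\beta|\}$ and continuous on $\overline{\mathcal{D}_\beta}$, with $F_{A,B}(t)=\omega(A\tau_t(B))$ and $F_{A,B}(t+i\beta)=\omega(\tau_t(B)A)$ for all $t\in\mathbb{R}$. *)

theory Defs
  imports "HOL-Analysis.Analysis"
begin

section \<open>Complex Hilbert spaces\<close>

text \<open>The complex inner product is antilinear in the first variable; its real part is the
  inner product of the underlying real Hilbert space, which supplies norm and topology.\<close>

class complex_hilbert = real_inner + complete_space +
  fixes scaleC :: "complex \<Rightarrow> 'a \<Rightarrow> 'a" (infixr \<open>*\<^sub>C\<close> 75)
    and cinner :: "'a \<Rightarrow> 'a \<Rightarrow> complex"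
  assumes scaleC_add_right: "c *\<^sub>C (x + y) = c *\<^sub>C x + c *\<^sub>C y"
    and scaleC_add_left: "(c + d) *\<^sub>C x = c *\<^sub>C x + d *\<^sub>C x"
    and scaleC_scaleC: "c *\<^sub>C (d *\<^sub>C x) = (c * d) *\<^sub>C x"
    and scaleR_scaleC: "r *\<^sub>R x = complex_of_real r *\<^sub>C x"
    and cinner_commute: "cinner x y = cnj (cinner y x)"
    and cinner_add_right: "cinner x (y + z) = cinner x y + cinner x z"
    and cinner_scaleC_right: "cinner x (c *\<^sub>C y) = c * cinner x y"
    and inner_eq_Re_cinner: "inner x y = Re (cinner x y)"

definition (in complex_hilbert) is_onb :: "(nat \<Rightarrow> 'a) \<Rightarrow> bool" where
  "is_onb e \<longleftrightarrow> (\<forall>m n. cinner (e m) (e n) = (if m = n then 1 else 0)) \<and>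
     (\<forall>x. (\<forall>n. cinner (e n) x = 0) \<longrightarrow> x = 0)"

text \<open>Separable infinite dimensional spaces, presented with a fixed orthonormal basis
  (existence of an orthonormal basis indexed by \<^typ>\<open>nat\<close> is equivalent to being
  separable and infinite dimensional).\<close>

class separable_hilbert = complex_hilbert +
  fixes ebasis :: "nat \<Rightarrow> 'a"
  assumes is_onb_ebasis: "is_onb ebasis"

definition clinear :: "('a::complex_hilbert \<Rightarrow> 'b::complex_hilbert) \<Rightarrow> bool" where
  "clinear A \<longleftrightarrow> (\<forall>x y. A (x + y) = A x + A y) \<and> (\<forall>c x. A (c *\<^sub>C x) = c *\<^sub>C A x)"

definition bounded_ops :: "('a::complex_hilbert \<Rightarrow> 'a) set" where
  "bounded_ops = {A. clinear A \<and> (\<exists>K. \<forall>x. norm (A x) \<le> K * norm x)}"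

definition cadj :: "('a::complex_hilbert \<Rightarrow> 'a) \<Rightarrow> 'a \<Rightarrow> 'a" where
  "cadj A = (THE B. \<forall>x y. cinner (B y) x = cinner y (A x))"

definition op_trace :: "('a::separable_hilbert \<Rightarrow> 'a) \<Rightarrow> complex" where
  "op_trace A = (\<Sum>n. cinner (ebasis n) (A (ebasis n)))"

definition hilbert_schmidt :: "('a::separable_hilbert \<Rightarrow> 'a) \<Rightarrow> bool" where
  "hilbert_schmidt A \<longleftrightarrow> A \<in> bounded_ops \<and> summable (\<lambda>n. (norm (A (ebasis n)))\<^sup>2)"

subsection \<open>Basic facts\<close>

lemma cinner_add_left: "cinner (x + y) z = cinner x z + cinner y (z::'a::complex_hilbert)"
  by (metis cinner_commute cinner_add_right complex_cnj_add)

lemma cinner_scaleC_left: "cinner (c *\<^sub>C x) y = cnj c * cinner x (y::'a::complex_hilbert)"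
  by (metis cinner_commute cinner_scaleC_right complex_cnj_mult)

lemma scaleC_one [simp]: "1 *\<^sub>C (x::'a::complex_hilbert) = x"
  using scaleR_scaleC[of 1 x] by simp

lemma scaleC_zero_left [simp]: "0 *\<^sub>C (x::'a::complex_hilbert) = 0"
  using scaleR_scaleC[of 0 x] by simp

lemma scaleC_zero_right [simp]: "c *\<^sub>C (0::'a::complex_hilbert) = 0"
  using scaleC_scaleC[of c 0 "0::'a"] by simp

lemma scaleC_minus_one: "(-1) *\<^sub>C (x::'a::complex_hilbert) = - x"
  using scaleR_scaleC[of "-1" x] by simp

lemma cinner_zero_right [simp]: "cinner x (0::'a::complex_hilbert) = 0"
  using cinner_scaleC_right[of x 0 0] by simp

lemma cinner_zero_left [simp]: "cinner (0::'a::complex_hilbert) x = 0"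
  by (subst cinner_commute) simp

lemma cinner_minus_right [simp]: "cinner x (- y) = - cinner x (y::'a::complex_hilbert)"
  using cinner_scaleC_right[of x "-1" y] by (simp add: scaleC_minus_one)

lemma cinner_diff_right: "cinner x (y - z) = cinner x y - cinner x (z::'a::complex_hilbert)"
  using cinner_add_right[of x y "-z"] by simp

lemma cinner_diff_left: "cinner (x - y) z = cinner x z - cinner y (z::'a::complex_hilbert)"
  by (metis cinner_commute cinner_diff_right complex_cnj_diff)

lemma cinner_sum_right:
  "cinner x (\<Sum>n\<in>S. f n) = (\<Sum>n\<in>S. cinner x (f n :: 'a::complex_hilbert))"
  by (induction S rule: infinite_finite_induct) (auto simp: cinner_add_right)

lemma cinner_self: "cinner x x = complex_of_real ((norm (x::'a::complex_hilbert))\<^sup>2)"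
proof -
  have "Im (cinner x x) = 0"
    using cinner_commute[of x x] by (metis complex_cnj_cancel_iff Im_complex_of_real Reals_cnj_iff complex_is_Real_iff)
  moreover have "Re (cinner x x) = (norm x)\<^sup>2"
    by (simp add: inner_eq_Re_cinner[symmetric] power2_norm_eq_inner)
  ultimately show ?thesis by (simp add: complex_eq_iff)
qed

lemma norm_scaleC: "norm (c *\<^sub>C x) = cmod c * norm (x::'a::complex_hilbert)"
proof -
  have "complex_of_real ((norm (c *\<^sub>C x))\<^sup>2) = complex_of_real ((cmod c * norm x)\<^sup>2)"
    unfolding cinner_self[symmetric] cinner_scaleC_left cinner_scaleC_right
    by (simp add: cinner_self power_mult_distrib complex_norm_square[of c, simplified] mult_ac)
  hence "(norm (c *\<^sub>C x))\<^sup>2 = (cmod c * norm x)\<^sup>2"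
    using of_real_eq_iff by blast
  thus ?thesis by (simp add: power2_eq_iff_nonneg)
qed

lemma cmod_cinner_le: "cmod (cinner x y) \<le> norm x * norm (y::'a::complex_hilbert)"
proof (cases "cinner x y = 0")
  case False
  define c where "c = cnj (cinner x y) / complex_of_real (cmod (cinner x y))"
  have c1: "cmod c = 1" using False by (simp add: c_def norm_divide)
  have "c * cinner x y = complex_of_real (cmod (cinner x y))"
    using False complex_norm_square[of "cinner x y"]
    by (simp add: c_def power2_eq_square mult.commute nonzero_divide_eq_eq)
  hence "cmod (cinner x y) = inner x (c *\<^sub>C y)"
    by (simp add: inner_eq_Re_cinner cinner_scaleC_right)
  also have "\<dots> \<le> norm x * norm (c *\<^sub>C y)" by (rule norm_cauchy_schwarz)
  finally show ?thesis by (simp add: norm_scaleC c1)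
qed simp

lemma bounded_linear_cinner_right: "bounded_linear (cinner (x::'a::complex_hilbert))"
  by (rule bounded_linear_intro[where K = "norm x"])
     (auto simp: cinner_add_right cinner_scaleC_right scaleR_scaleC scaleR_conv_of_real
        intro: order_trans[OF cmod_cinner_le])

lemma cinner_ext: "(\<And>x. cinner a x = cinner b x) \<Longrightarrow> a = (b::'a::complex_hilbert)"
proof -
  assume "\<And>x. cinner a x = cinner b x"
  hence "cinner (a - b) (a - b) = 0" by (simp add: cinner_diff_left)
  thus "a = b" by (simp add: cinner_self)
qed

lemma cadj_eqI:
  assumes "\<And>x y. cinner (B y) x = cinner y (A x)"
  shows "cadj A = B"
  unfolding cadj_def
proof (rule the_equality)
  fix C assume "\<forall>x y. cinner (C y) x = cinner y (A x)"
  thus "C = B" using assms by (intro ext cinner_ext) simp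
qed (use assms in simp)

lemma bounded_opsD:
  assumes "A \<in> bounded_ops"
  shows "A (x + y) = A x + A y" "A (c *\<^sub>C x) = c *\<^sub>C A x" "A 0 = 0"
    "\<exists>K\<ge>0. \<forall>x. norm (A x) \<le> K * norm x"
proof -
  show 1: "A (x + y) = A x + A y" "A (c *\<^sub>C x) = c *\<^sub>C A x" for x y c
    using assms by (auto simp: bounded_ops_def clinear_def)
  show "A 0 = 0" using 1(2)[of 0 0] by simp
  obtain K where K: "\<forall>x. norm (A x) \<le> K * norm x" using assms by (auto simp: bounded_ops_def)
  have "norm (A x) \<le> \<bar>K\<bar> * norm x" for x
    using K[rule_format, of x] mult_right_mono[of K "\<bar>K\<bar>" "norm x"] by (auto intro: order_trans)
  thus "\<exists>K\<ge>0. \<forall>x. norm (A x) \<le> K * norm x" by (intro exI[of _ "\<bar>K\<bar>"]) auto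
qed

lemma bounded_opsI:
  assumes "\<And>x y. A (x + y) = A x + A y" "\<And>c x. A (c *\<^sub>C x) = c *\<^sub>C A x"
    "\<And>x. norm (A x) \<le> K * norm x"
  shows "A \<in> bounded_ops"
  using assms by (auto simp: bounded_ops_def clinear_def)

lemma bounded_ops_bounded_linear: "A \<in> bounded_ops \<Longrightarrow> bounded_linear A"
  using bounded_opsD[of A]
  by (metis bounded_linear_intro mult.commute scaleR_scaleC)

lemma ebasis_orthonormal:
  "cinner (ebasis m) (ebasis n :: 'a::separable_hilbert) = (if m = n then 1 else 0)"
  using is_onb_ebasis[where 'a = 'a] by (simp add: is_onb_def)

lemma ebasis_total:
  "(\<And>n. cinner (ebasis n) x = 0) \<Longrightarrow> x = (0 :: 'a::separable_hilbert)"
  using is_onb_ebasis[where 'a = 'a] by (simp add: is_onb_def)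

lemma cinner_ebasis_sum:
  assumes "finite S"
  shows "cinner (ebasis m) (\<Sum>n\<in>S. c n *\<^sub>C ebasis n :: 'a::separable_hilbert)
    = (if m \<in> S then c m else 0)"
proof -
  have "cinner (ebasis m) (\<Sum>n\<in>S. c n *\<^sub>C ebasis n :: 'a) = (\<Sum>n\<in>S. if m = n then c n else 0)"
    unfolding cinner_sum_right by (rule sum.cong) (auto simp: cinner_scaleC_right ebasis_orthonormal)
  thus ?thesis using assms by simp
qed

lemma norm_ebasis_sum:
  assumes "finite S"
  shows "(norm (\<Sum>n\<in>S. c n *\<^sub>C ebasis n :: 'a::separable_hilbert))\<^sup>2 = (\<Sum>n\<in>S. (cmod (c n))\<^sup>2)"
proof -
  let ?s = "\<Sum>n\<in>S. c n *\<^sub>C ebasis n :: 'a"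
  have "cinner ?s ?s = (\<Sum>n\<in>S. c n * cnj (c n))"
    unfolding cinner_sum_right[of ?s]
  proof (rule sum.cong)
    fix n assume n: "n \<in> S"
    have "cinner ?s (ebasis n) = cnj (c n)"
      using cinner_ebasis_sum[OF assms, of n c] n cinner_commute[of ?s "ebasis n"] by simp
    thus "cinner ?s (c n *\<^sub>C ebasis n) = c n * cnj (c n)" by (simp add: cinner_scaleC_right)
  qed simp
  also have "\<dots> = complex_of_real (\<Sum>n\<in>S. (cmod (c n))\<^sup>2)"
    by (simp only: of_real_sum complex_norm_square)
  finally show ?thesis unfolding cinner_self using of_real_eq_iff by blast
qed

lemma norm_ebasis [simp]: "norm (ebasis n :: 'a::separable_hilbert) = 1"
proof -
  have "(norm (ebasis n :: 'a))\<^sup>2 = 1\<^sup>2"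
    using norm_ebasis_sum[of "{n}" "\<lambda>_. 1", where 'a = 'a] by simp
  thus ?thesis by (simp only: power2_eq_iff_nonneg norm_ge_zero zero_le_one)
qed

lemma summable_ebasis:
  assumes "summable (\<lambda>n. (cmod (c n))\<^sup>2)"
  shows "summable (\<lambda>n. c n *\<^sub>C ebasis n :: 'a::separable_hilbert)"
proof -
  let ?s = "\<lambda>k. \<Sum>n<k. c n *\<^sub>C ebasis n :: 'a"
  have "Cauchy ?s"
  proof (rule metric_CauchyI)
    fix \<epsilon> :: real assume "\<epsilon> > 0"
    then obtain N where N: "\<And>m n. m \<ge> N \<Longrightarrow> norm (\<Sum>k\<in>{m..<n}. (cmod (c k))\<^sup>2) < \<epsilon>\<^sup>2"
      using assms unfolding summable_Cauchy by (metis zero_less_power)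
    have *: "dist (?s m) (?s n) < \<epsilon>" if "N \<le> m" "m \<le> n" for m n
    proof -
      have "?s n - ?s m = (\<Sum>k\<in>{m..<n}. c k *\<^sub>C ebasis k)"
        using sum_diff_nat_ivl[of 0 m n "\<lambda>k. c k *\<^sub>C ebasis k :: 'a"] that
        by (simp add: lessThan_atLeast0)
      hence "(dist (?s m) (?s n))\<^sup>2 = (\<Sum>k\<in>{m..<n}. (cmod (c k))\<^sup>2)"
        using norm_ebasis_sum[of "{m..<n}" c, where 'a = 'a]
        by (simp add: dist_norm norm_minus_commute[of "?s m" "?s n"])
      also have "\<dots> < \<epsilon>\<^sup>2" using N[of m n] that by (simp add: sum_nonneg)
      finally show ?thesis using \<open>\<epsilon> > 0\<close> by (simp add: power_less_imp_less_base)
    qed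
    show "\<exists>M. \<forall>m\<ge>M. \<forall>n\<ge>M. dist (?s m) (?s n) < \<epsilon>"
      using * by (metis dist_commute linorder_linear)
  qed
  thus ?thesis by (simp add: summable_iff_convergent Cauchy_convergent_iff)
qed

lemma bessel:
  fixes x :: "'a::separable_hilbert"
  shows "(\<Sum>n<k. (cmod (cinner (ebasis n) x))\<^sup>2) \<le> (norm x)\<^sup>2"
proof -
  let ?c = "\<lambda>n. cinner (ebasis n) x" let ?s = "\<Sum>n<k. ?c n *\<^sub>C ebasis n :: 'a"
  have "cinner x ?s = (\<Sum>n<k. ?c n * cnj (?c n))"
    unfolding cinner_sum_right cinner_scaleC_right
    by (rule sum.cong) (auto simp: cinner_commute[of x])
  also have "\<dots> = complex_of_real (\<Sum>n<k. (cmod (?c n))\<^sup>2)"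
    by (simp only: of_real_sum complex_norm_square)
  finally have "inner x ?s = (\<Sum>n<k. (cmod (?c n))\<^sup>2)"
    by (simp only: inner_eq_Re_cinner Re_complex_of_real)
  moreover have "inner ?s ?s = (\<Sum>n<k. (cmod (?c n))\<^sup>2)"
    using norm_ebasis_sum[of "{..<k}" ?c, where 'a = 'a] by (simp add: power2_norm_eq_inner)
  moreover have "0 \<le> inner (x - ?s) (x - ?s)" by simp
  ultimately show ?thesis
    by (simp add: power2_norm_eq_inner inner_diff_left inner_diff_right inner_commute)
qed

lemma ebasis_expansion:
  fixes x :: "'a::separable_hilbert"
  shows "(\<lambda>n. cinner (ebasis n) x *\<^sub>C ebasis n) sums x"
    and "(\<lambda>n. (cmod (cinner (ebasis n) x))\<^sup>2) sums (norm x)\<^sup>2"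
proof -
  let ?c = "\<lambda>n. cinner (ebasis n) x" let ?s = "\<lambda>k. \<Sum>n<k. ?c n *\<^sub>C ebasis n :: 'a"
  have sm: "summable (\<lambda>n. (cmod (?c n))\<^sup>2)"
    by (rule summableI_nonneg_bounded[OF _ bessel]) simp
  then obtain z :: 'a where z: "(\<lambda>n. ?c n *\<^sub>C ebasis n) sums z"
    using summable_sums[OF summable_ebasis[of ?c]] by blast
  have "cinner (ebasis m) (x - z) = 0" for m
  proof -
    have "(\<lambda>k. cinner (ebasis m) (?s k)) \<longlonglongrightarrow> cinner (ebasis m) z"
      using z unfolding sums_def by (rule bounded_linear.tendsto[OF bounded_linear_cinner_right])
    moreover have "eventually (\<lambda>k. cinner (ebasis m) (?s k) = ?c m) sequentially"
      using eventually_gt_at_top[of m]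
      by eventually_elim (simp add: cinner_ebasis_sum)
    ultimately have "(\<lambda>k. ?c m) \<longlonglongrightarrow> cinner (ebasis m) z"
      by (rule Lim_transform_eventually)
    hence "cinner (ebasis m) z = ?c m" by (simp add: LIMSEQ_const_iff)
    thus ?thesis by (simp add: cinner_diff_right)
  qed
  hence "x = z" using ebasis_total[of "x - z"] by simp
  with z show 1: "(\<lambda>n. ?c n *\<^sub>C ebasis n) sums x" by simp
  have "(\<lambda>k. (norm (?s k))\<^sup>2) \<longlonglongrightarrow> (norm x)\<^sup>2"
    using 1 unfolding sums_def by (intro tendsto_intros)
  thus "(\<lambda>n. (cmod (?c n))\<^sup>2) sums (norm x)\<^sup>2"
    by (simp add: sums_def norm_ebasis_sum)
qed

lemma norm_sq_ebasis:
  "summable (\<lambda>n. (cmod (cinner (ebasis n) x))\<^sup>2)"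
  "(\<Sum>n. (cmod (cinner (ebasis n) x))\<^sup>2) = (norm (x::'a::separable_hilbert))\<^sup>2"
  using ebasis_expansion(2)[of x] by (auto simp: sums_iff)

lemma cadj_exists:
  fixes A :: "'a::separable_hilbert \<Rightarrow> 'a"
  assumes A: "A \<in> bounded_ops"
  shows "\<exists>z. \<forall>x. cinner z x = cinner y (A x)"
proof -
  obtain K where K: "K \<ge> 0" "\<And>x. norm (A x) \<le> K * norm x" using bounded_opsD(4)[OF A] by blast
  let ?f = "\<lambda>x. cinner y (A x)"
  let ?c = "\<lambda>n. cnj (?f (ebasis n))"
  let ?L = "norm y * K"
  have bl: "bounded_linear ?f"
    by (rule bounded_linear_compose[OF bounded_linear_cinner_right bounded_ops_bounded_linear[OF A]])
  have fle: "cmod (?f x) \<le> ?L * norm x" for x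
    using cmod_cinner_le[of y "A x"] mult_left_mono[OF K(2)[of x], of "norm y"]
    by (simp add: mult.assoc)
  have "(\<Sum>n<k. (cmod (?c n))\<^sup>2) \<le> ?L\<^sup>2" for k
  proof -
    let ?s = "\<Sum>n<k. ?c n *\<^sub>C ebasis n :: 'a"
    let ?q = "\<Sum>n<k. (cmod (?c n))\<^sup>2"
    have q0: "?q \<ge> 0" by (simp add: sum_nonneg)
    have "?f ?s = (\<Sum>n<k. ?c n * ?f (ebasis n))"
      by (simp add: bounded_linear.linear[OF bl, THEN linear_sum] bounded_opsD(2)[OF A]
          cinner_scaleC_right)
    also have "\<dots> = complex_of_real ?q"
      unfolding of_real_sum by (rule sum.cong) (simp_all add: complex_norm_square del: of_real_power)
    finally have "?q = cmod (?f ?s)" using q0 by (simp del: of_real_sum)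
    also have "\<dots> \<le> ?L * norm ?s" by (rule fle)
    finally have 1: "?q \<le> ?L * norm ?s" .
    have 2: "(norm ?s)\<^sup>2 = ?q" by (rule norm_ebasis_sum) simp
    have "norm ?s \<le> ?L"
    proof (cases "norm ?s = 0")
      case False
      hence "norm ?s > 0" by simp
      moreover have "norm ?s * norm ?s \<le> ?L * norm ?s"
        unfolding power2_eq_square[symmetric] 2 by (rule 1)
      ultimately show ?thesis by (rule mult_right_le_imp_le[rotated])
    qed (use K in simp)
    thus ?thesis unfolding 2[symmetric] by (rule power_mono) simp
  qed
  hence "summable (\<lambda>n. (cmod (?c n))\<^sup>2)" by (intro summableI_nonneg_bounded) auto
  then obtain z :: 'a where z: "(\<lambda>n. ?c n *\<^sub>C ebasis n) sums z"
    using summable_sums[OF summable_ebasis[of ?c]] by blast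
  have cz: "cinner z (ebasis m) = ?f (ebasis m)" for m
  proof -
    have "(\<lambda>k. cinner (ebasis m) (\<Sum>n<k. ?c n *\<^sub>C ebasis n :: 'a)) \<longlonglongrightarrow> cinner (ebasis m) z"
      using z unfolding sums_def by (rule bounded_linear.tendsto[OF bounded_linear_cinner_right])
    moreover have "eventually (\<lambda>k. cinner (ebasis m) (\<Sum>n<k. ?c n *\<^sub>C ebasis n :: 'a) = ?c m) sequentially"
      using eventually_gt_at_top[of m] by eventually_elim (simp add: cinner_ebasis_sum)
    ultimately have "(\<lambda>k. ?c m) \<longlonglongrightarrow> cinner (ebasis m) z"
      by (rule Lim_transform_eventually)
    hence "cinner (ebasis m) z = ?c m" by (simp add: LIMSEQ_const_iff)
    thus ?thesis by (metis cinner_commute complex_cnj_cnj)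
  qed
  have "cinner z x = ?f x" for x
  proof (rule sums_unique2)
    let ?t = "\<lambda>n. cinner (ebasis n) x *\<^sub>C ebasis n"
    show "(\<lambda>n. cinner z (?t n)) sums cinner z x"
      by (rule bounded_linear.sums[OF bounded_linear_cinner_right ebasis_expansion(1)])
    have "(\<lambda>n. ?f (?t n)) sums ?f x"
      by (rule bounded_linear.sums[OF bl ebasis_expansion(1)])
    thus "(\<lambda>n. cinner z (?t n)) sums ?f x"
      by (simp add: bounded_opsD(2)[OF A] cinner_scaleC_right cz)
  qed
  thus ?thesis by blast
qed

lemma cinner_cadj:
  fixes A :: "'a::separable_hilbert \<Rightarrow> 'a"
  assumes A: "A \<in> bounded_ops"
  shows "cinner (cadj A y) x = cinner y (A x)"
proof -
  obtain B where B: "\<And>x y. cinner (B y) x = cinner y (A x)"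
    using cadj_exists[OF A] by metis
  thus ?thesis using cadj_eqI[of B A] by simp
qed

lemma cinner_cadj':
  fixes A :: "'a::separable_hilbert \<Rightarrow> 'a"
  assumes A: "A \<in> bounded_ops"
  shows "cinner x (cadj A y) = cinner (A x) y"
  using cinner_cadj[OF A, of y x] by (metis cinner_commute)

lemma cadj_bounded:
  fixes A :: "'a::separable_hilbert \<Rightarrow> 'a"
  assumes A: "A \<in> bounded_ops"
  shows "cadj A \<in> bounded_ops"
proof -
  obtain K where K: "K \<ge> 0" "\<And>x. norm (A x) \<le> K * norm x" using bounded_opsD(4)[OF A] by blast
  show ?thesis
  proof (rule bounded_opsI[where K = K])
    fix x y :: 'a and c
    show "cadj A (x + y) = cadj A x + cadj A y"
      by (rule cinner_ext) (simp add: cinner_cadj[OF A] cinner_add_left)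
    show "cadj A (c *\<^sub>C x) = c *\<^sub>C cadj A x"
      by (rule cinner_ext) (simp add: cinner_cadj[OF A] cinner_scaleC_left)
    let ?z = "cadj A x"
    have "complex_of_real ((norm ?z)\<^sup>2) = cinner x (A ?z)"
      by (simp add: cinner_self[symmetric] cinner_cadj[OF A] del: of_real_power)
    hence "(norm ?z)\<^sup>2 = cmod (cinner x (A ?z))"
      by (metis norm_of_real abs_of_nonneg zero_le_power2)
    also have "\<dots> \<le> norm x * (K * norm ?z)"
      by (rule order_trans[OF cmod_cinner_le]) (simp add: K mult_left_mono)
    finally have "norm ?z * norm ?z \<le> (K * norm x) * norm ?z"
      by (simp add: power2_eq_square mult_ac)
    thus "norm ?z \<le> K * norm x"
      using K by (cases "norm ?z = 0") (auto simp: mult_le_cancel_right)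
  qed
qed

lemma cadj_cadj:
  fixes A :: "'a::separable_hilbert \<Rightarrow> 'a"
  shows "A \<in> bounded_ops \<Longrightarrow> cadj (cadj A) = A"
  by (rule cadj_eqI) (simp add: cinner_cadj')

lemma hilbert_schmidt_cadj_aux:
  fixes A :: "'a::separable_hilbert \<Rightarrow> 'a"
  assumes A: "hilbert_schmidt A"
  shows "summable (\<lambda>n. (norm (cadj A (ebasis n)))\<^sup>2)"
    and "(\<Sum>n. (norm (cadj A (ebasis n)))\<^sup>2) \<le> (\<Sum>n. (norm (A (ebasis n)))\<^sup>2)"
proof -
  have b: "A \<in> bounded_ops" and s: "summable (\<lambda>n. (norm (A (ebasis n)))\<^sup>2)"
    using A by (auto simp: hilbert_schmidt_def)
  have eq: "cmod (cinner (ebasis n) (cadj A (ebasis m))) = cmod (cinner (ebasis m) (A (ebasis n)))"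
    for m n
    by (metis b cinner_cadj' cinner_commute complex_mod_cnj)
  have sm: "summable (\<lambda>n. (cmod (cinner (ebasis m) (A (ebasis n))))\<^sup>2)" for m
    using norm_sq_ebasis(1)[of "cadj A (ebasis m)"] by (simp add: eq)
  have le: "(\<Sum>m<k. (norm (cadj A (ebasis m)))\<^sup>2) \<le> (\<Sum>n. (norm (A (ebasis n)))\<^sup>2)" for k
  proof -
    have "(\<Sum>m<k. (norm (cadj A (ebasis m)))\<^sup>2)
        = (\<Sum>m<k. \<Sum>n. (cmod (cinner (ebasis n) (cadj A (ebasis m))))\<^sup>2)"
      by (simp add: norm_sq_ebasis(2))
    also have "\<dots> = (\<Sum>n. \<Sum>m<k. (cmod (cinner (ebasis n) (cadj A (ebasis m))))\<^sup>2)"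
      by (rule suminf_sum[symmetric]) (rule norm_sq_ebasis(1))
    also have "\<dots> \<le> (\<Sum>n. (norm (A (ebasis n)))\<^sup>2)"
      by (rule suminf_le) (auto simp: eq s bessel intro!: summable_sum sm)
    finally show ?thesis .
  qed
  show "summable (\<lambda>n. (norm (cadj A (ebasis n)))\<^sup>2)"
    by (rule summableI_nonneg_bounded[OF _ le]) simp
  thus "(\<Sum>n. (norm (cadj A (ebasis n)))\<^sup>2) \<le> (\<Sum>n. (norm (A (ebasis n)))\<^sup>2)"
    by (rule suminf_le_const) (rule le)
qed

lemma hilbert_schmidt_cadj:
  fixes A :: "'a::separable_hilbert \<Rightarrow> 'a"
  assumes A: "hilbert_schmidt A"
  shows "hilbert_schmidt (cadj A)"
    and "(\<Sum>n. (norm (cadj A (ebasis n)))\<^sup>2) = (\<Sum>n. (norm (A (ebasis n)))\<^sup>2)"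
proof -
  have b: "A \<in> bounded_ops" using A by (simp add: hilbert_schmidt_def)
  show 1: "hilbert_schmidt (cadj A)"
    using hilbert_schmidt_cadj_aux(1)[OF A] cadj_bounded[OF b] by (simp add: hilbert_schmidt_def)
  show "(\<Sum>n. (norm (cadj A (ebasis n)))\<^sup>2) = (\<Sum>n. (norm (A (ebasis n)))\<^sup>2)"
    using hilbert_schmidt_cadj_aux(2)[OF A] hilbert_schmidt_cadj_aux(2)[OF 1]
    by (simp add: cadj_cadj[OF b])
qed

lemma bounded_ops_comp: "A \<in> bounded_ops \<Longrightarrow> B \<in> bounded_ops \<Longrightarrow> A \<circ> B \<in> bounded_ops"
proof -
  assume A: "A \<in> bounded_ops" and B: "B \<in> bounded_ops"
  obtain K L where K: "K \<ge> 0" "\<And>x. norm (A x) \<le> K * norm x"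
    and L: "L \<ge> 0" "\<And>x. norm (B x) \<le> L * norm x"
    using bounded_opsD(4)[OF A] bounded_opsD(4)[OF B] by metis
  show ?thesis
  proof (rule bounded_opsI[where K = "K * L"])
    show "norm ((A \<circ> B) x) \<le> K * L * norm x" for x
      using K(2)[of "B x"] mult_left_mono[OF L(2)[of x] K(1)] by (simp add: mult.assoc)
  qed (auto simp: bounded_opsD[OF A] bounded_opsD[OF B])
qed

lemma cadj_comp:
  fixes A :: "'a::separable_hilbert \<Rightarrow> 'a"
  assumes "A \<in> bounded_ops" "B \<in> bounded_ops"
  shows "cadj (A \<circ> B) = cadj B \<circ> cadj A"
  by (rule cadj_eqI) (simp add: cinner_cadj assms)

lemma hilbert_schmidt_comp_left:
  assumes A: "A \<in> bounded_ops" and X: "hilbert_schmidt X"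
  shows "hilbert_schmidt (A \<circ> X)"
proof -
  obtain K where K: "K \<ge> 0" "\<And>x. norm (A x) \<le> K * norm x" using bounded_opsD(4)[OF A] by blast
  have "summable (\<lambda>n. (norm ((A \<circ> X) (ebasis n)))\<^sup>2)"
  proof (rule summable_comparison_test')
    show "summable (\<lambda>n. K\<^sup>2 * (norm (X (ebasis n)))\<^sup>2)"
      using X by (auto simp: hilbert_schmidt_def intro: summable_mult)
    show "norm ((norm ((A \<circ> X) (ebasis n)))\<^sup>2) \<le> K\<^sup>2 * (norm (X (ebasis n)))\<^sup>2" for n
      using power_mono[OF K(2)[of "X (ebasis n)"], of 2] by (simp add: power_mult_distrib)
  qed
  thus ?thesis using X bounded_ops_comp[OF A] by (simp add: hilbert_schmidt_def)
qed

lemma hilbert_schmidt_comp_right: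
  assumes A: "A \<in> bounded_ops" and X: "hilbert_schmidt X"
  shows "hilbert_schmidt (X \<circ> A)"
proof -
  have b: "X \<in> bounded_ops" using X by (simp add: hilbert_schmidt_def)
  have "hilbert_schmidt (cadj (cadj A \<circ> cadj X))"
    by (intro hilbert_schmidt_cadj(1) hilbert_schmidt_comp_left cadj_bounded A X)
  thus ?thesis by (simp add: cadj_comp cadj_bounded cadj_cadj A b)
qed

section \<open>The Hilbert space of Hilbert-Schmidt operators\<close>

lemma hilbert_schmidt_zero: "hilbert_schmidt (\<lambda>_. 0)"
proof -
  have "(\<lambda>_. 0) \<in> bounded_ops" by (rule bounded_opsI[where K = 0]) simp_all
  thus ?thesis by (simp add: hilbert_schmidt_def)
qed

typedef (overloaded) 'a hs = "{A :: 'a::separable_hilbert \<Rightarrow> 'a. hilbert_schmidt A}"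
  morphisms hs_op Abs_hs
  using hilbert_schmidt_zero by blast

lemma hs_hs_op [simp]: "hilbert_schmidt (hs_op A)"
  using hs_op[of A] by simp

lemma hs_op_bounded [simp]: "hs_op A \<in> bounded_ops"
  using hs_hs_op[of A] unfolding hilbert_schmidt_def by blast

lemma hs_op_summable [simp]: "summable (\<lambda>n. (norm (hs_op A (ebasis n)))\<^sup>2)"
  using hs_hs_op[of A] unfolding hilbert_schmidt_def by blast

lemma Abs_hs_op: "hilbert_schmidt A \<Longrightarrow> hs_op (Abs_hs A) = A"
  by (simp add: Abs_hs_inverse)

lemma hs_eqI: "(\<And>x. hs_op A x = hs_op B x) \<Longrightarrow> A = B"
  by (metis hs_op_inject ext)

lemma hilbert_schmidt_add:
  assumes A: "hilbert_schmidt A" and B: "hilbert_schmidt B"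
  shows "hilbert_schmidt (\<lambda>x. A x + B x)"
proof -
  have bA: "A \<in> bounded_ops" and bB: "B \<in> bounded_ops"
    using A B by (auto simp: hilbert_schmidt_def)
  obtain K L where K: "K \<ge> 0" "\<And>x. norm (A x) \<le> K * norm x"
    and L: "L \<ge> 0" "\<And>x. norm (B x) \<le> L * norm x"
    using bounded_opsD(4)[OF bA] bounded_opsD(4)[OF bB] by metis
  have "(\<lambda>x. A x + B x) \<in> bounded_ops"
  proof (rule bounded_opsI[where K = "K + L"])
    show "norm (A x + B x) \<le> (K + L) * norm x" for x
      using norm_triangle_ineq[of "A x" "B x"] K(2)[of x] L(2)[of x] by (simp add: distrib_right)
  qed (auto simp: bounded_opsD[OF bA] bounded_opsD[OF bB] scaleC_add_right)
  moreover have "summable (\<lambda>n. (norm (A (ebasis n) + B (ebasis n)))\<^sup>2)"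
  proof (rule summable_comparison_test')
    show "summable (\<lambda>n. 2 * (norm (A (ebasis n)))\<^sup>2 + 2 * (norm (B (ebasis n)))\<^sup>2)"
      using A B by (intro summable_add summable_mult) (auto simp: hilbert_schmidt_def)
    fix n
    let ?a = "norm (A (ebasis n))" and ?b = "norm (B (ebasis n))"
    have "(norm (A (ebasis n) + B (ebasis n)))\<^sup>2 \<le> (?a + ?b)\<^sup>2"
      by (rule power_mono[OF norm_triangle_ineq]) simp
    also have "\<dots> \<le> 2 * ?a\<^sup>2 + 2 * ?b\<^sup>2"
      using sum_squares_bound[of ?a ?b] by (simp add: power2_sum)
    finally show "norm ((norm (A (ebasis n) + B (ebasis n)))\<^sup>2) \<le> 2 * ?a\<^sup>2 + 2 * ?b\<^sup>2" by simp
  qed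
  ultimately show ?thesis by (simp add: hilbert_schmidt_def)
qed

lemma scaleC_in_bounded_ops: "(\<lambda>x. c *\<^sub>C x) \<in> bounded_ops"
  by (rule bounded_opsI[where K = "cmod c"])
     (auto simp: scaleC_add_right scaleC_scaleC mult.commute norm_scaleC)

lemma hilbert_schmidt_scaleC: "hilbert_schmidt A \<Longrightarrow> hilbert_schmidt (\<lambda>x. c *\<^sub>C A x)"
  using hilbert_schmidt_comp_left[OF scaleC_in_bounded_ops, of A c] by (simp add: comp_def)

lemma cadj_add:
  fixes A :: "'a::separable_hilbert \<Rightarrow> 'a"
  assumes "A \<in> bounded_ops" "B \<in> bounded_ops"
  shows "cadj (\<lambda>x. A x + B x) = (\<lambda>x. cadj A x + cadj B x)"
  by (rule cadj_eqI) (simp add: cinner_add_left cinner_add_right cinner_cadj assms)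

lemma cadj_scaleC:
  fixes A :: "'a::separable_hilbert \<Rightarrow> 'a"
  assumes "A \<in> bounded_ops"
  shows "cadj (\<lambda>x. c *\<^sub>C A x) = (\<lambda>x. cnj c *\<^sub>C cadj A x)"
  by (rule cadj_eqI) (simp add: cinner_scaleC_left cinner_scaleC_right cinner_cadj assms)

instantiation hs :: (separable_hilbert) "{zero, plus, minus, uminus, scaleR}"
begin

definition "(0 :: 'a hs) = Abs_hs (\<lambda>_. 0)"
definition "(A :: 'a hs) + B = Abs_hs (\<lambda>x. hs_op A x + hs_op B x)"
definition "r *\<^sub>R (A :: 'a hs) = Abs_hs (\<lambda>x. r *\<^sub>R hs_op A x)"
definition "- (A :: 'a hs) = Abs_hs (\<lambda>x. - hs_op A x)"
definition "(A :: 'a hs) - B = Abs_hs (\<lambda>x. hs_op A x - hs_op B x)"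

instance ..

end

lemma hilbert_schmidt_uminus: "hilbert_schmidt A \<Longrightarrow> hilbert_schmidt (\<lambda>x. - A x)"
  using hilbert_schmidt_scaleC[of A "-1"] by (simp add: scaleC_minus_one)

lemma hs_op_zero [simp]: "hs_op 0 x = 0"
  by (simp add: zero_hs_def Abs_hs_op hilbert_schmidt_zero)

lemma hs_op_plus [simp]: "hs_op (A + B) x = hs_op A x + hs_op B x"
  by (simp add: plus_hs_def Abs_hs_op hilbert_schmidt_add)

lemma hs_op_scaleR [simp]: "hs_op (r *\<^sub>R A) x = r *\<^sub>R hs_op A x"
  by (simp add: scaleR_hs_def Abs_hs_op hilbert_schmidt_scaleC scaleR_scaleC)

lemma hs_op_uminus [simp]: "hs_op (- A) x = - hs_op A x"
  by (simp add: uminus_hs_def Abs_hs_op hilbert_schmidt_uminus)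

lemma hs_op_minus [simp]: "hs_op (A - B) x = hs_op A x - hs_op B x"
  using hilbert_schmidt_add[OF hs_hs_op[of A] hilbert_schmidt_uminus[OF hs_hs_op[of B]]]
  by (simp add: minus_hs_def Abs_hs_op)

instance hs :: (separable_hilbert) real_vector
  by standard (rule hs_eqI; simp add: algebra_simps)+

text \<open>\<^term>\<open>cinner A B\<close> on Hilbert-Schmidt operators is \<^term>\<open>op_trace (hs_op B \<circ> cadj (hs_op A))\<close>,
  that is \<open>\<langle>B, A\<rangle>\<^sub>H\<^sub>S\<close> for \<open>\<langle>A, B\<rangle>\<^sub>H\<^sub>S = Tr (A B*)\<close>: the arguments are swapped because
  \<open>Tr (A B*)\<close> is antilinear in its second argument.\<close>

instantiation hs :: (separable_hilbert) "{real_inner}"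
begin

definition "inner (A :: 'a hs) B = Re (op_trace (hs_op B \<circ> cadj (hs_op A)))"
definition "norm (A :: 'a hs) = sqrt (inner A A)"
definition "dist (A :: 'a hs) B = norm (A - B)"
definition "sgn (A :: 'a hs) = A /\<^sub>R norm A"
definition [code del]:
  "(uniformity :: ('a hs \<times> 'a hs) filter) = (INF e\<in>{0<..}. principal {(x, y). dist x y < e})"
definition [code del]: "open (U :: 'a hs set) \<longleftrightarrow>
  (\<forall>x\<in>U. \<forall>\<^sub>F (x', y) in uniformity. x' = x \<longrightarrow> y \<in> U)"

lemma hs_trace_sums:
  fixes A B :: "'a hs"
  shows "(\<lambda>n. cinner (cadj (hs_op B) (ebasis n)) (cadj (hs_op A) (ebasis n))) sums
    op_trace (hs_op B \<circ> cadj (hs_op A))"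
proof -
  let ?f = "\<lambda>n. cinner (cadj (hs_op B) (ebasis n)) (cadj (hs_op A) (ebasis n))"
  let ?a = "\<lambda>n. norm (cadj (hs_op A) (ebasis n))" and ?b = "\<lambda>n. norm (cadj (hs_op B) (ebasis n))"
  have "summable ?f"
  proof (rule summable_comparison_test')
    show "summable (\<lambda>n. (?b n)\<^sup>2 + (?a n)\<^sup>2)"
      using hilbert_schmidt_cadj(1)[of "hs_op A"] hilbert_schmidt_cadj(1)[of "hs_op B"]
      by (intro summable_add) (auto simp: hilbert_schmidt_def)
    fix n
    have "0 \<le> ?b n * ?a n" by simp
    thus "norm (?f n) \<le> (?b n)\<^sup>2 + (?a n)\<^sup>2"
      using cmod_cinner_le[of "cadj (hs_op B) (ebasis n)" "cadj (hs_op A) (ebasis n)"]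
        sum_squares_bound[of "?b n" "?a n"] by linarith
  qed
  thus ?thesis by (simp add: op_trace_def cinner_cadj sums_iff)
qed

lemma hs_trace_commute:
  fixes A B :: "'a hs"
  shows "op_trace (hs_op A \<circ> cadj (hs_op B)) = cnj (op_trace (hs_op B \<circ> cadj (hs_op A)))"
  using sums_unique2[OF hs_trace_sums[where A = B and B = A]
      sums_cnj[THEN iffD2, OF hs_trace_sums[where A = A and B = B], unfolded cinner_commute[symmetric]]] .

lemma hs_trace_add:
  fixes A B C :: "'a hs"
  shows "op_trace (hs_op (B + C) \<circ> cadj (hs_op A)) =
    op_trace (hs_op B \<circ> cadj (hs_op A)) + op_trace (hs_op C \<circ> cadj (hs_op A))"
proof (rule sums_unique2[OF hs_trace_sums])
  have "hs_op (B + C) = (\<lambda>x. hs_op B x + hs_op C x)" by auto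
  thus "(\<lambda>n. cinner (cadj (hs_op (B + C)) (ebasis n)) (cadj (hs_op A) (ebasis n))) sums
    (op_trace (hs_op B \<circ> cadj (hs_op A)) + op_trace (hs_op C \<circ> cadj (hs_op A)))"
    using sums_add[OF hs_trace_sums[where A = A and B = B] hs_trace_sums[where A = A and B = C]]
    by (simp add: cadj_add cinner_add_left)
qed

lemma hs_inner_self: "(\<lambda>n. (norm (cadj (hs_op A) (ebasis n)))\<^sup>2) sums inner (A :: 'a hs) A"
  using sums_Re[OF hs_trace_sums[where A = A and B = A]]
  unfolding inner_hs_def by (simp add: cinner_self del: of_real_power)

lemma hs_inner_self': "(\<lambda>n. (norm (hs_op A (ebasis n)))\<^sup>2) sums inner (A :: 'a hs) A"
  using hs_inner_self[of A] hilbert_schmidt_cadj(2)[of "hs_op A"]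
  by (simp add: sums_iff)

instance
proof
  fix A B C :: "'a hs" and r :: real
  show "inner A B = inner B A"
    unfolding inner_hs_def by (subst hs_trace_commute) simp
  have comm: "inner A B = inner B A" for A B :: "'a hs"
    unfolding inner_hs_def by (subst hs_trace_commute) simp
  show "inner (A + B) C = inner A C + inner B C"
    unfolding comm[of _ C] unfolding inner_hs_def hs_trace_add by simp
  have "op_trace (hs_op (r *\<^sub>R A) \<circ> cadj (hs_op C)) = of_real r * op_trace (hs_op A \<circ> cadj (hs_op C))"
  proof (rule sums_unique2[OF hs_trace_sums])
    have "hs_op (r *\<^sub>R A) = (\<lambda>x. complex_of_real r *\<^sub>C hs_op A x)" by (auto simp: scaleR_scaleC)
    thus "(\<lambda>n. cinner (cadj (hs_op (r *\<^sub>R A)) (ebasis n)) (cadj (hs_op C) (ebasis n))) sums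
      (of_real r * op_trace (hs_op A \<circ> cadj (hs_op C)))"
      using sums_mult[OF hs_trace_sums[where A = C and B = A], of "of_real r"]
      by (simp add: cadj_scaleC cinner_scaleC_left)
  qed
  thus "inner (r *\<^sub>R A) C = r * inner A C"
    unfolding comm[of _ C] by (simp add: inner_hs_def)
  show nn: "0 \<le> inner A A"
    by (rule sums_le[OF _ sums_zero hs_inner_self]) simp
  show "(inner A A = 0) = (A = 0)"
  proof
    assume "inner A A = 0"
    hence "(\<lambda>n. (norm (hs_op A (ebasis n)))\<^sup>2) sums 0" using hs_inner_self'[of A] by simp
    hence "hs_op A (ebasis n) = 0" for n
      using suminf_eq_zero_iff[of "\<lambda>n. (norm (hs_op A (ebasis n)))\<^sup>2"]
      by (simp add: sums_iff)
    hence "cinner (hs_op A (ebasis n)) y = 0" for n y by simp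
    hence "cadj (hs_op A) y = 0" for y
      by (intro ebasis_total) (simp add: cinner_cadj')
    hence "cadj (hs_op A) = (\<lambda>_. 0)" by auto
    hence "hs_op A = cadj (\<lambda>_. 0)" using cadj_cadj[of "hs_op A"] by simp
    also have "\<dots> = (\<lambda>_. 0)" by (rule cadj_eqI) simp
    finally show "A = 0" by (intro hs_eqI) simp
  next
    assume "A = 0"
    thus "inner A A = 0" using hs_inner_self'[of A] by (simp add: sums_iff)
  qed
qed (simp_all add: norm_hs_def dist_hs_def sgn_hs_def uniformity_hs_def open_hs_def)

end

lemma hs_norm_sums: "(\<lambda>n. (norm (hs_op A (ebasis n)))\<^sup>2) sums (norm A)\<^sup>2"
  using hs_inner_self'[of A] by (simp add: power2_norm_eq_inner)

lemma hs_op_norm_le: "norm (hs_op A x) \<le> norm A * norm x"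
proof -
  have 1: "(\<lambda>n. (cmod (cinner (ebasis n) (hs_op A x)))\<^sup>2) sums (norm (hs_op A x))\<^sup>2"
    by (rule ebasis_expansion)
  have 2: "(\<lambda>n. (norm (cadj (hs_op A) (ebasis n)))\<^sup>2 * (norm x)\<^sup>2) sums ((norm A)\<^sup>2 * (norm x)\<^sup>2)"
    using sums_mult2[OF hs_inner_self[of A]] by (simp add: power2_norm_eq_inner)
  have "(norm (hs_op A x))\<^sup>2 \<le> (norm A)\<^sup>2 * (norm x)\<^sup>2"
  proof (rule sums_le[OF _ 1 2])
    fix n
    show "(cmod (cinner (ebasis n) (hs_op A x)))\<^sup>2
        \<le> (norm (cadj (hs_op A) (ebasis n)))\<^sup>2 * (norm x)\<^sup>2"
      using power_mono[OF cmod_cinner_le[of "cadj (hs_op A) (ebasis n)" x], of 2]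
      by (simp add: cinner_cadj power_mult_distrib)
  qed
  thus ?thesis by (metis power_mult_distrib power2_le_imp_le mult_nonneg_nonneg norm_ge_zero)
qed

instance hs :: (separable_hilbert) complete_space
proof
  fix X :: "nat \<Rightarrow> 'a hs" assume X: "Cauchy X"
  have "Cauchy (\<lambda>k. hs_op (X k) x)" for x
  proof (rule metric_CauchyI)
    fix \<epsilon> :: real assume e: "\<epsilon> > 0"
    have "\<epsilon> / (norm x + 1) > 0" using e by (simp add: add_nonneg_pos)
    then obtain M where M: "\<And>m n. m \<ge> M \<Longrightarrow> n \<ge> M \<Longrightarrow> dist (X m) (X n) < \<epsilon> / (norm x + 1)"
      using X by (meson metric_CauchyD)
    have "dist (hs_op (X m) x) (hs_op (X n) x) < \<epsilon>" if "m \<ge> M" "n \<ge> M" for m n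
    proof -
      have "dist (hs_op (X m) x) (hs_op (X n) x) \<le> dist (X m) (X n) * norm x"
        using hs_op_norm_le[of "X m - X n" x] by (simp add: dist_norm)
      also have "\<dots> \<le> dist (X m) (X n) * (norm x + 1)" by (simp add: mult_left_mono)
      also have "\<dots> < \<epsilon>" using M[OF that] by (simp add: pos_less_divide_eq add_nonneg_pos)
      finally show ?thesis .
    qed
    thus "\<exists>M. \<forall>m\<ge>M. \<forall>n\<ge>M. dist (hs_op (X m) x) (hs_op (X n) x) < \<epsilon>" by blast
  qed
  hence "\<forall>x. \<exists>l. (\<lambda>k. hs_op (X k) x) \<longlonglongrightarrow> l"
    using Cauchy_convergent_iff convergent_def by blast
  then obtain L where L: "\<And>x. (\<lambda>k. hs_op (X k) x) \<longlonglongrightarrow> L x" by metis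
  obtain K where K: "\<And>k. norm (X k) \<le> K"
    using cauchy_imp_bounded[OF X] by (auto simp: bounded_iff)
  have Lb: "L \<in> bounded_ops"
  proof (rule bounded_opsI[where K = K])
    fix x y :: 'a and c
    have "(\<lambda>k. hs_op (X k) (x + y)) \<longlonglongrightarrow> L x + L y"
      using tendsto_add[OF L[of x] L[of y]] by (simp add: bounded_opsD(1))
    thus "L (x + y) = L x + L y" using L LIMSEQ_unique by blast
    have "bounded_linear (\<lambda>x::'a. c *\<^sub>C x)"
      by (rule bounded_ops_bounded_linear[OF scaleC_in_bounded_ops])
    hence "(\<lambda>k. c *\<^sub>C hs_op (X k) x) \<longlonglongrightarrow> c *\<^sub>C L x"
      by (rule bounded_linear.tendsto[OF _ L])
    hence "(\<lambda>k. hs_op (X k) (c *\<^sub>C x)) \<longlonglongrightarrow> c *\<^sub>C L x" by (simp add: bounded_opsD(2))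
    thus "L (c *\<^sub>C x) = c *\<^sub>C L x" using L LIMSEQ_unique by blast
    show "norm (L x) \<le> K * norm x"
    proof (rule LIMSEQ_le_const2[OF tendsto_norm[OF L]])
      show "\<exists>N. \<forall>n\<ge>N. norm (hs_op (X n) x) \<le> K * norm x"
        using hs_op_norm_le[of _ x] mult_right_mono[OF K norm_ge_zero[of x]] order_trans by blast
    qed
  qed
  have part: "\<exists>N. \<forall>j\<ge>N. \<forall>M. (\<Sum>n<M. (norm (hs_op (X j) (ebasis n) - L (ebasis n)))\<^sup>2) \<le> \<epsilon>\<^sup>2"
    if e: "\<epsilon> > 0" for \<epsilon> :: real
  proof -
    obtain N where N: "\<And>m n. m \<ge> N \<Longrightarrow> n \<ge> N \<Longrightarrow> dist (X m) (X n) < \<epsilon>"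
      using X e by (meson metric_CauchyD)
    have "(\<Sum>n<M. (norm (hs_op (X j) (ebasis n) - L (ebasis n)))\<^sup>2) \<le> \<epsilon>\<^sup>2" if j: "j \<ge> N" for j M
    proof (rule LIMSEQ_le_const2)
      show "(\<lambda>k. \<Sum>n<M. (norm (hs_op (X j) (ebasis n) - hs_op (X k) (ebasis n)))\<^sup>2) \<longlonglongrightarrow>
        (\<Sum>n<M. (norm (hs_op (X j) (ebasis n) - L (ebasis n)))\<^sup>2)"
        by (intro tendsto_intros L)
      have "(\<Sum>n<M. (norm (hs_op (X j) (ebasis n) - hs_op (X k) (ebasis n)))\<^sup>2) \<le> \<epsilon>\<^sup>2"
        if k: "k \<ge> N" for k
      proof -
        have "(\<Sum>n<M. (norm (hs_op (X j - X k) (ebasis n)))\<^sup>2) \<le> (norm (X j - X k))\<^sup>2"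
          using hs_norm_sums[of "X j - X k"] sum_le_suminf[OF hs_op_summable[of "X j - X k"]]
          by (metis finite_lessThan sums_unique zero_le_power2)
        also have "\<dots> \<le> \<epsilon>\<^sup>2"
          using N[OF j k] by (intro power_mono) (auto simp: dist_norm)
        finally show ?thesis by simp
      qed
      thus "\<exists>N. \<forall>k\<ge>N. (\<Sum>n<M. (norm (hs_op (X j) (ebasis n) - hs_op (X k) (ebasis n)))\<^sup>2) \<le> \<epsilon>\<^sup>2"
        by blast
    qed
    thus ?thesis by blast
  qed
  have "hilbert_schmidt (\<lambda>x. hs_op (X j) x - L x)"
    if "\<forall>M. (\<Sum>n<M. (norm (hs_op (X j) (ebasis n) - L (ebasis n)))\<^sup>2) \<le> \<epsilon>\<^sup>2" for j \<epsilon>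
  proof -
    have "(\<lambda>x. hs_op (X j) x - L x) \<in> bounded_ops"
    proof -
      obtain K1 K2 where K1: "\<And>x. norm (hs_op (X j) x) \<le> K1 * norm x"
        and K2: "\<And>x. norm (L x) \<le> K2 * norm x"
        using bounded_opsD(4)[OF hs_op_bounded[of "X j"]] bounded_opsD(4)[OF Lb] by metis
      show ?thesis
      proof (rule bounded_opsI[where K = "K1 + K2"])
        show "norm (hs_op (X j) x - L x) \<le> (K1 + K2) * norm x" for x
          using norm_triangle_ineq4[of "hs_op (X j) x" "L x"] K1[of x] K2[of x]
          by (simp add: distrib_right)
        show "hs_op (X j) (c *\<^sub>C x) - L (c *\<^sub>C x) = c *\<^sub>C (hs_op (X j) x - L x)" for c x
          using scaleC_add_right[of c "hs_op (X j) x - L x" "L x"]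
          by (simp add: bounded_opsD(2) bounded_opsD(2)[OF Lb])
      qed (simp add: bounded_opsD(1) bounded_opsD(1)[OF Lb])
    qed
    moreover have "summable (\<lambda>n. (norm (hs_op (X j) (ebasis n) - L (ebasis n)))\<^sup>2)"
      using that by (intro summableI_nonneg_bounded) auto
    ultimately show ?thesis by (simp add: hilbert_schmidt_def)
  qed note diff = this
  have "hilbert_schmidt L"
  proof -
    obtain j where "hilbert_schmidt (\<lambda>x. hs_op (X j) x - L x)"
      using part[of 1] diff[of _ 1] by fastforce
    from hilbert_schmidt_add[OF hs_hs_op[of "X j"] hilbert_schmidt_uminus[OF this]]
    show ?thesis by simp
  qed
  hence hL: "hs_op (Abs_hs L) = L" by (rule Abs_hs_op)
  have "X \<longlonglongrightarrow> Abs_hs L"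
  proof (rule metric_LIMSEQ_I)
    fix \<epsilon> :: real assume e: "\<epsilon> > 0"
    then obtain N where N: "\<And>j M. j \<ge> N \<Longrightarrow>
        (\<Sum>n<M. (norm (hs_op (X j) (ebasis n) - L (ebasis n)))\<^sup>2) \<le> (\<epsilon>/2)\<^sup>2"
      using part[of "\<epsilon>/2"] by auto
    have "dist (X j) (Abs_hs L) < \<epsilon>" if j: "j \<ge> N" for j
    proof -
      have "(norm (X j - Abs_hs L))\<^sup>2 \<le> (\<epsilon>/2)\<^sup>2"
        using hs_norm_sums[of "X j - Abs_hs L"] N[OF j] unfolding sums_def
        by (intro LIMSEQ_le_const2) (auto simp: hL)
      hence "norm (X j - Abs_hs L) \<le> \<epsilon>/2" using e by (simp add: power2_le_iff_abs_le)
      thus ?thesis using e by (simp add: dist_norm)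
    qed
    thus "\<exists>N. \<forall>n\<ge>N. dist (X n) (Abs_hs L) < \<epsilon>" by blast
  qed
  thus "convergent X" by (rule convergentI)
qed

instantiation hs :: (separable_hilbert) complex_hilbert
begin

definition "c *\<^sub>C (A :: 'a hs) = Abs_hs (\<lambda>x. c *\<^sub>C hs_op A x)"
definition "cinner (A :: 'a hs) B = op_trace (hs_op B \<circ> cadj (hs_op A))"

lemma hs_op_scaleC [simp]: "hs_op (c *\<^sub>C A) x = c *\<^sub>C hs_op (A :: 'a hs) x"
  by (simp add: scaleC_hs_def Abs_hs_op hilbert_schmidt_scaleC)

instance
proof
  fix A B C :: "'a hs" and r :: real and c d :: complex
  show "c *\<^sub>C (A + B) = c *\<^sub>C A + c *\<^sub>C B" by (rule hs_eqI) (simp add: scaleC_add_right)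
  show "(c + d) *\<^sub>C A = c *\<^sub>C A + d *\<^sub>C A" by (rule hs_eqI) (simp add: scaleC_add_left)
  show "c *\<^sub>C d *\<^sub>C A = (c * d) *\<^sub>C A" by (rule hs_eqI) (simp add: scaleC_scaleC)
  show "r *\<^sub>R A = complex_of_real r *\<^sub>C A" by (rule hs_eqI) (simp add: scaleR_scaleC)
  show "cinner A B = cnj (cinner B A)"
    unfolding cinner_hs_def by (rule hs_trace_commute)
  show "cinner A (B + C) = cinner A B + cinner A C"
    unfolding cinner_hs_def by (rule hs_trace_add)
  show "cinner A (c *\<^sub>C B) = c * cinner A B"
    unfolding cinner_hs_def
  proof (rule sums_unique2[OF hs_trace_sums])
    have "hs_op (c *\<^sub>C B) = (\<lambda>x. c *\<^sub>C hs_op B x)" by auto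
    thus "(\<lambda>n. cinner (cadj (hs_op (c *\<^sub>C B)) (ebasis n)) (cadj (hs_op A) (ebasis n))) sums
      (c * op_trace (hs_op B \<circ> cadj (hs_op A)))"
      using sums_mult[OF hs_trace_sums[where A = A and B = B], of c]
      by (simp add: cadj_scaleC cinner_scaleC_left)
  qed
  show "inner A B = Re (cinner A B)" by (simp add: inner_hs_def cinner_hs_def)
qed

end

definition tensor :: "'a::separable_hilbert \<Rightarrow> 'a \<Rightarrow> 'a hs" (infixr \<open>\<otimes>\<^sub>H\<close> 70) where
  "e \<otimes>\<^sub>H f = Abs_hs (\<lambda>x. cinner e x *\<^sub>C f)"

definition vee :: "('a::separable_hilbert \<Rightarrow> 'a) \<Rightarrow> ('a \<Rightarrow> 'a) \<Rightarrow> 'a hs \<Rightarrow> 'a hs" (infix \<open>\<or>\<^sub>H\<close> 72) where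
  "(A \<or>\<^sub>H B) X = Abs_hs (A \<circ> hs_op X \<circ> cadj B)"

lemma hs_op_tensor: "hs_op (e \<otimes>\<^sub>H f) x = cinner e x *\<^sub>C f"
proof -
  let ?A = "\<lambda>x. cinner e x *\<^sub>C f"
  have "?A \<in> bounded_ops"
  proof (rule bounded_opsI[where K = "norm e * norm f"])
    show "norm (?A x) \<le> norm e * norm f * norm x" for x
      using mult_right_mono[OF cmod_cinner_le[of e x], of "norm f"] by (simp add: norm_scaleC mult_ac)
  qed (auto simp: cinner_add_right cinner_scaleC_right scaleC_add_left scaleC_scaleC)
  moreover have "summable (\<lambda>n. (norm (?A (ebasis n)))\<^sup>2)"
  proof -
    have "cmod (cinner e (ebasis n)) = cmod (cinner (ebasis n) e)" for n
      by (metis cinner_commute complex_mod_cnj)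
    thus ?thesis
      using summable_mult2[OF norm_sq_ebasis(1)[of e], of "(norm f)\<^sup>2"]
      by (simp add: norm_scaleC power_mult_distrib)
  qed
  ultimately have "hilbert_schmidt ?A" by (simp only: hilbert_schmidt_def)
  thus ?thesis unfolding tensor_def by (subst Abs_hs_op) simp_all
qed

lemma hs_op_vee:
  assumes "A \<in> bounded_ops" "B \<in> bounded_ops"
  shows "hs_op ((A \<or>\<^sub>H B) X) = A \<circ> hs_op X \<circ> cadj B"
  unfolding vee_def
  by (rule Abs_hs_op, rule hilbert_schmidt_comp_right[OF cadj_bounded[OF assms(2)]],
      rule hilbert_schmidt_comp_left[OF assms(1) hs_hs_op])

definition A_left :: "('a::separable_hilbert hs \<Rightarrow> 'a hs) set" where
  "A_left = {A \<or>\<^sub>H id | A. hilbert_schmidt A}"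

definition left_vN_algebra :: "('a::separable_hilbert hs \<Rightarrow> 'a hs) set" where
  "left_vN_algebra = {A \<or>\<^sub>H id | A. A \<in> bounded_ops}"

definition cyclic_vector :: "('k::complex_hilbert \<Rightarrow> 'k) set \<Rightarrow> 'k \<Rightarrow> bool" where
  "cyclic_vector \<AA> \<Omega> \<longleftrightarrow> closure ((\<lambda>X. X \<Omega>) ` \<AA>) = UNIV"

definition separating_vector :: "('k::complex_hilbert \<Rightarrow> 'k) set \<Rightarrow> 'k \<Rightarrow> bool" where
  "separating_vector \<AA> \<Omega> \<longleftrightarrow> (\<forall>X\<in>\<AA>. X \<Omega> = 0 \<longrightarrow> X = (\<lambda>_. 0))"

definition associated_operator :: "'a::separable_hilbert hs \<Rightarrow> 'a hs \<Rightarrow> bool" where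
  "associated_operator \<Omega> T \<longleftrightarrow> (\<exists>a :: nat \<Rightarrow> nat \<Rightarrow> complex.
     ((\<lambda>(m, n). a m n *\<^sub>C (ebasis m \<otimes>\<^sub>H ebasis n)) has_sum \<Omega>) UNIV \<and>
     (\<forall>m. (\<lambda>n. a m n *\<^sub>C ebasis n) sums hs_op T (ebasis m)))"

section \<open>Unbounded operators and functional calculus\<close>

text \<open>Unbounded operators are represented by their graphs.\<close>

type_synonym 'a operator = "('a \<times> 'a) set"

definition graph_of :: "('a \<Rightarrow> 'a) \<Rightarrow> 'a operator" where
  "graph_of A = {(x, A x) | x. True}"

definition op_apply :: "'a operator \<Rightarrow> 'a \<Rightarrow> 'a" where
  "op_apply G x = (THE y. (x, y) \<in> G)"

definition op_scale :: "complex \<Rightarrow> 'a::complex_hilbert operator \<Rightarrow> 'a operator" where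
  "op_scale c G = {(x, c *\<^sub>C y) | x y. (x, y) \<in> G}"

definition op_adjoint :: "'a::complex_hilbert operator \<Rightarrow> 'a operator" where
  "op_adjoint G = {(y, z). \<forall>(x, w)\<in>G. cinner y w = cinner z x}"

text \<open>For densely defined \<open>G\<close>, the relation \<^term>\<open>op_adjoint G\<close> is the graph of a linear
  operator, so the equation below forces \<open>G\<close> to be one as well.\<close>

definition self_adjoint :: "'a::complex_hilbert operator \<Rightarrow> bool" where
  "self_adjoint G \<longleftrightarrow> closure (Domain G) = UNIV \<and> op_adjoint G = G"

text \<open>Projection-valued measures on the Borel sets of the real line (the values of \<open>P\<close> on
  other sets are irrelevant).\<close>

definition orth_projection :: "('a::complex_hilbert \<Rightarrow> 'a) \<Rightarrow> bool" where
  "orth_projection Q \<longleftrightarrow> Q \<in> bounded_ops \<and> Q \<circ> Q = Q \<and> cadj Q = Q"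

definition proj_valued_measure :: "(real set \<Rightarrow> 'a::complex_hilbert \<Rightarrow> 'a) \<Rightarrow> bool" where
  "proj_valued_measure P \<longleftrightarrow>
     (\<forall>E\<in>sets borel. orth_projection (P E)) \<and>
     P UNIV = id \<and>
     (\<forall>E :: nat \<Rightarrow> real set. range E \<subseteq> sets borel \<longrightarrow> disjoint_family E \<longrightarrow>
        (\<forall>x. (\<lambda>i. P (E i) x) sums P (\<Union>i. E i) x))"

definition pvm_measure :: "(real set \<Rightarrow> 'a::complex_hilbert \<Rightarrow> 'a) \<Rightarrow> 'a \<Rightarrow> real measure" where
  "pvm_measure P x = measure_of UNIV (sets borel) (\<lambda>E. ennreal (Re (cinner x (P E x))))"

definition pvm_domain :: "(real set \<Rightarrow> 'a::complex_hilbert \<Rightarrow> 'a) \<Rightarrow> (real \<Rightarrow> complex) \<Rightarrow> 'a set" where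
  "pvm_domain P f = {x. integrable (pvm_measure P x) (\<lambda>s. (cmod (f s))\<^sup>2)}"

text \<open>The integral of \<open>f\<close> against the complex measure \<open>E \<mapsto> \<langle>z, P(E) x\<rangle>\<close>, by polarization.\<close>

definition pvm_integral2 ::
  "(real set \<Rightarrow> 'a::complex_hilbert \<Rightarrow> 'a) \<Rightarrow> (real \<Rightarrow> complex) \<Rightarrow> 'a \<Rightarrow> 'a \<Rightarrow> complex" where
  "pvm_integral2 P f z x =
     (\<Sum>k<4. \<i> ^ k * integral\<^sup>L (pvm_measure P (x + \<i> ^ k *\<^sub>C z)) f) / 4"

text \<open>The operator \<open>\<integral> f dP\<close> for Borel \<open>f\<close>: its domain \<open>D\<close> is \<^term>\<open>pvm_domain P f\<close> (which is
  dense) and \<open>\<langle>z, (\<integral> f dP) x\<rangle> = \<integral> f(s) d\<langle>z, P(s) x\<rangle>\<close> for \<open>x, z \<in> D\<close>.\<close>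

definition spectral_integral ::
  "(real set \<Rightarrow> 'a::complex_hilbert \<Rightarrow> 'a) \<Rightarrow> (real \<Rightarrow> complex) \<Rightarrow> 'a operator" where
  "spectral_integral P f = {(x, y). x \<in> pvm_domain P f \<and>
     (\<forall>z\<in>pvm_domain P f. cinner z y = pvm_integral2 P f z x)}"

definition spectral_measure_of ::
  "'a::complex_hilbert operator \<Rightarrow> (real set \<Rightarrow> 'a \<Rightarrow> 'a) \<Rightarrow> bool" where
  "spectral_measure_of h P \<longleftrightarrow> proj_valued_measure P \<and> spectral_integral P complex_of_real = h"

text \<open>\<open>f(h)\<close> for self-adjoint \<open>h\<close>. By the spectral theorem a spectral measure of \<open>h\<close> exists and
  is unique on Borel sets, so the union is over a single graph.\<close>

definition functional_calculus ::
  "(real \<Rightarrow> complex) \<Rightarrow> 'a::complex_hilbert operator \<Rightarrow> 'a operator" where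
  "functional_calculus f h = (\<Union>P \<in> {P. spectral_measure_of h P}. spectral_integral P f)"

definition op_abs :: "('a::complex_hilbert \<Rightarrow> 'a) \<Rightarrow> 'a operator" where
  "op_abs T = functional_calculus (\<lambda>s. complex_of_real (sqrt s)) (graph_of (cadj T \<circ> T))"

definition op_log :: "'a::complex_hilbert operator \<Rightarrow> 'a operator" where
  "op_log G = functional_calculus (\<lambda>s. complex_of_real (ln s)) G"

section \<open>Von Neumann algebras and KMS states\<close>

definition commutant :: "('k::complex_hilbert \<Rightarrow> 'k) set \<Rightarrow> ('k \<Rightarrow> 'k) set" where
  "commutant M = {B \<in> bounded_ops. \<forall>A\<in>M. A \<circ> B = B \<circ> A}"

definition von_neumann_algebra :: "('k::complex_hilbert \<Rightarrow> 'k) set \<Rightarrow> bool" where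
  "von_neumann_algebra M \<longleftrightarrow> M \<subseteq> bounded_ops \<and>
     (\<forall>A\<in>M. \<forall>B\<in>M. (\<lambda>x. A x + B x) \<in> M \<and> A \<circ> B \<in> M) \<and>
     (\<forall>A\<in>M. \<forall>c. (\<lambda>x. c *\<^sub>C A x) \<in> M) \<and>
     (\<forall>A\<in>M. cadj A \<in> M) \<and>
     commutant (commutant M) = M"

text \<open>The sigma-weak topology on the bounded operators: the initial topology of the functionals
  \<open>A \<mapsto> \<Sum>n. \<langle>\<xi> n, A (\<eta> n)\<rangle>\<close> with \<open>\<xi>\<close>, \<open>\<eta>\<close> square summable.\<close>

definition sigma_weak_topology :: "('k::complex_hilbert \<Rightarrow> 'k) topology" where
  "sigma_weak_topology = topology_generated_by
     {{A \<in> bounded_ops. (\<Sum>n. cinner (\<xi> n) (A (\<eta> n))) \<in> U} | \<xi> \<eta> U.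
        summable (\<lambda>n. (norm (\<xi> n))\<^sup>2) \<and> summable (\<lambda>n. (norm (\<eta> n))\<^sup>2) \<and> open U}"

definition state :: "('k::complex_hilbert \<Rightarrow> 'k) set \<Rightarrow> (('k \<Rightarrow> 'k) \<Rightarrow> complex) \<Rightarrow> bool" where
  "state M \<omega> \<longleftrightarrow>
     (\<forall>A\<in>M. \<forall>B\<in>M. \<omega> (\<lambda>x. A x + B x) = \<omega> A + \<omega> B) \<and>
     (\<forall>A\<in>M. \<forall>c. \<omega> (\<lambda>x. c *\<^sub>C A x) = c * \<omega> A) \<and>
     (\<forall>A\<in>M. \<omega> (cadj A \<circ> A) \<in> \<real> \<and> 0 \<le> Re (\<omega> (cadj A \<circ> A))) \<and>
     \<omega> id = 1"

definition normal_state :: "('k::complex_hilbert \<Rightarrow> 'k) set \<Rightarrow> (('k \<Rightarrow> 'k) \<Rightarrow> complex) \<Rightarrow> bool" where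
  "normal_state M \<omega> \<longleftrightarrow> state M \<omega> \<and>
     continuous_map (subtopology sigma_weak_topology M) euclidean \<omega>"

definition star_automorphism :: "('k::complex_hilbert \<Rightarrow> 'k) set \<Rightarrow> (('k \<Rightarrow> 'k) \<Rightarrow> ('k \<Rightarrow> 'k)) \<Rightarrow> bool" where
  "star_automorphism M \<phi> \<longleftrightarrow> bij_betw \<phi> M M \<and>
     (\<forall>A\<in>M. \<forall>B\<in>M. \<phi> (\<lambda>x. A x + B x) = (\<lambda>x. \<phi> A x + \<phi> B x) \<and> \<phi> (A \<circ> B) = \<phi> A \<circ> \<phi> B) \<and>
     (\<forall>A\<in>M. \<forall>c. \<phi> (\<lambda>x. c *\<^sub>C A x) = (\<lambda>x. c *\<^sub>C \<phi> A x)) \<and>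
     (\<forall>A\<in>M. \<phi> (cadj A) = cadj (\<phi> A))"

text \<open>As usual for von Neumann algebras, one-parameter automorphism groups are taken to be
  pointwise sigma-weakly continuous.\<close>

definition automorphism_group ::
  "('k::complex_hilbert \<Rightarrow> 'k) set \<Rightarrow> (real \<Rightarrow> ('k \<Rightarrow> 'k) \<Rightarrow> ('k \<Rightarrow> 'k)) \<Rightarrow> bool" where
  "automorphism_group M \<tau> \<longleftrightarrow>
     (\<forall>t. star_automorphism M (\<tau> t)) \<and>
     (\<forall>A\<in>M. \<tau> 0 A = A) \<and>
     (\<forall>A\<in>M. \<forall>s t. \<tau> (s + t) A = \<tau> s (\<tau> t A)) \<and>
     (\<forall>A\<in>M. continuous_map euclidean sigma_weak_topology (\<lambda>t. \<tau> t A))"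

definition kms_strip :: "real \<Rightarrow> complex set" where
  "kms_strip \<beta> = {z. 0 < sgn \<beta> * Im z \<and> sgn \<beta> * Im z < \<bar>\<beta>\<bar>}"

definition kms_state ::
  "('k::complex_hilbert \<Rightarrow> 'k) set \<Rightarrow> (real \<Rightarrow> ('k \<Rightarrow> 'k) \<Rightarrow> ('k \<Rightarrow> 'k)) \<Rightarrow> real
    \<Rightarrow> (('k \<Rightarrow> 'k) \<Rightarrow> complex) \<Rightarrow> bool" where
  "kms_state M \<tau> \<beta> \<omega> \<longleftrightarrow>
     von_neumann_algebra M \<and> automorphism_group M \<tau> \<and> normal_state M \<omega> \<and>
     (\<forall>A\<in>M. \<forall>B\<in>M. \<exists>F :: complex \<Rightarrow> complex.
        F analytic_on kms_strip \<beta> \<and> continuous_on (closure (kms_strip \<beta>)) F \<and>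
        (\<forall>t::real. F (of_real t) = \<omega> (A \<circ> \<tau> t B) \<and>
                   F (of_real t + \<i> * of_real \<beta>) = \<omega> (\<tau> t B \<circ> A)))"

end

(* Both parts are reduced to operators that are diagonal in an orthonormal basis f with real
   eigenvalues l. Any spectral measure of such an operator is forced to satisfy P(E) f_i = 1_E(l_i) f_i,
   because the mean of s over every bounded Borel set E with respect to <f_i, P(ds) f_i> is l_i; this
   gives the functional calculus of diagonal operators without the general spectral theorem.

   (a) Cyclicity makes T injective, so T*T is a positive injective trace class operator and is
   diagonal; h = -2 log |T| then has the eigenvalues -log of those of T*T.

   (b) The hypothesis on exp(-h/2) provides a spectral measure of h. Evaluating exp(-s/2) on bounded
   spectral subspaces shows that S = exp(-h/2) is positive and injective, hence has an eigenbasis, and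
   each eigenvector sits on one point of the spectral measure: h is diagonal. The KMS state is the
   Gibbs state, the vector state of S / ||S||, with
   F(z) = 1/Z sum_{i,j} exp(-l_i) A_ij B_ji exp(i z (l_j - l_i)),
   which converges uniformly on 0 <= Im z <= 1 by convexity of exp. *)

theory Submission
  imports Defs "HOL-Complex_Analysis.Cauchy_Integral_Formula"
begin

section \<open>Orthonormal bases and diagonal operators\<close>

text \<open>\<open>functional_calculus\<close> is a union over all spectral measures of an operator,
  so its value is determined only once some measure exists and all of them yield one graph;
  eigenvectors are the place where both can be checked by hand. A further obstacle is that
  \<open>spectral_integral\<close> constrains <z, y> only for z in the domain, through integrals
  over the measures of x + i^k z. The test vectors are therefore spectral pieces P(E) x with E
  bounded: they lie in the domain of every locally bounded function, and the measure of a
  combination of two of them has an explicit density with respect to the measure of x. In (b) no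
  lower bound on h is known in advance, so exp(-s/2) may a priori be unbounded on the support of the
  measure; statements about S are obtained on [-n, n] and then passed to the limit. Diagonalisation
  rests on a variational principle: a maximising sequence for ||T x|| is asymptotically an
  eigenvector of T*T, and compactness of T makes a subsequence converge. Injectivity keeps the
  eigenvalues positive, so a decreasing enumeration by natural numbers exhausts the space.\<close>

lemma scaleC_diff_right: "c *\<^sub>C (x - y) = c *\<^sub>C x - c *\<^sub>C (y::'a::complex_hilbert)"
  by (metis add_diff_cancel diff_add_cancel scaleC_add_right)

lemma norm_add_sq:
  "(norm (x + y))\<^sup>2 = (norm x)\<^sup>2 + 2 * Re (cinner x y) + (norm (y::'a::complex_hilbert))\<^sup>2"
  by (simp add: power2_norm_eq_inner inner_add_left inner_add_right inner_commute
      flip: inner_eq_Re_cinner)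

lemma norm_diff_sq:
  "(norm (x - y))\<^sup>2 = (norm x)\<^sup>2 - 2 * Re (cinner x y) + (norm (y::'a::complex_hilbert))\<^sup>2"
  by (simp add: power2_norm_eq_inner inner_diff_left inner_diff_right inner_commute
      flip: inner_eq_Re_cinner)

lemma cmod_cinner_commute: "cmod (cinner x y) = cmod (cinner y (x::'a::complex_hilbert))"
  by (metis cinner_commute complex_mod_cnj)

lemma cinner_sum_left:
  "cinner (\<Sum>n\<in>S. f n) x = (\<Sum>n\<in>S. cinner (f n :: 'a::complex_hilbert) x)"
  by (induction S rule: infinite_finite_induct) (auto simp: cinner_add_left)

lemma orthonormal_cinner_sum:
  assumes "finite S" "\<And>m n. m \<in> S \<Longrightarrow> n \<in> S \<Longrightarrow> cinner (f m) (f n) = (if m = n then 1 else 0)" "m \<in> S"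
  shows "cinner (f m) (\<Sum>n\<in>S. c n *\<^sub>C f n :: 'a::complex_hilbert) = c m"
proof -
  have "cinner (f m) (\<Sum>n\<in>S. c n *\<^sub>C f n) = (\<Sum>n\<in>S. if m = n then c n else 0)"
    unfolding cinner_sum_right by (rule sum.cong) (auto simp: cinner_scaleC_right assms)
  thus ?thesis using assms by simp
qed

lemma orthonormal_norm_sum:
  assumes "finite S" "\<And>m n. m \<in> S \<Longrightarrow> n \<in> S \<Longrightarrow> cinner (f m) (f n) = (if m = n then 1 else 0)"
  shows "(norm (\<Sum>n\<in>S. c n *\<^sub>C f n :: 'a::complex_hilbert))\<^sup>2 = (\<Sum>n\<in>S. (cmod (c n))\<^sup>2)"
proof -
  have "cinner (\<Sum>n\<in>S. c n *\<^sub>C f n) (\<Sum>n\<in>S. c n *\<^sub>C f n) = (\<Sum>n\<in>S. cnj (c n) * c n)"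
    unfolding cinner_sum_left[of "\<lambda>n. c n *\<^sub>C f n"]
    by (rule sum.cong) (simp_all add: cinner_scaleC_left orthonormal_cinner_sum assms)
  also have "\<dots> = complex_of_real (\<Sum>n\<in>S. (cmod (c n))\<^sup>2)"
    by (simp add: complex_norm_square mult.commute del: of_real_power)
  finally show ?thesis unfolding cinner_self using of_real_eq_iff by blast
qed

lemma orthonormal_bessel:
  fixes x :: "'a::complex_hilbert"
  assumes "finite S" "\<And>m n. m \<in> S \<Longrightarrow> n \<in> S \<Longrightarrow> cinner (f m) (f n) = (if m = n then 1 else 0)"
  shows "(norm (x - (\<Sum>n\<in>S. cinner (f n) x *\<^sub>C f n)))\<^sup>2 = (norm x)\<^sup>2 - (\<Sum>n\<in>S. (cmod (cinner (f n) x))\<^sup>2)"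
proof -
  have "cinner x (\<Sum>n\<in>S. cinner (f n) x *\<^sub>C f n) = (\<Sum>n\<in>S. cinner (f n) x * cnj (cinner (f n) x))"
    unfolding cinner_sum_right cinner_scaleC_right
    by (rule sum.cong) (auto simp: cinner_commute[of x])
  also have "\<dots> = complex_of_real (\<Sum>n\<in>S. (cmod (cinner (f n) x))\<^sup>2)"
    by (simp only: of_real_sum complex_norm_square)
  finally show ?thesis by (simp add: norm_diff_sq orthonormal_norm_sum assms)
qed

lemma
  fixes f :: "nat \<Rightarrow> 'a::complex_hilbert"
  assumes f: "is_onb f"
  shows onb_ortho: "cinner (f m) (f n) = (if m = n then 1 else 0)"
    and onb_eqI: "(\<And>n. cinner (f n) x = cinner (f n) y) \<Longrightarrow> x = y"
    and onb_norm: "norm (f n) = 1"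
proof -
  show 1: "cinner (f m) (f n) = (if m = n then 1 else 0)" for m n
    using f by (simp add: is_onb_def)
  have "\<forall>n. cinner (f n) (x - y) = 0" if "\<And>n. cinner (f n) x = cinner (f n) y"
    using that by (simp add: cinner_diff_right)
  thus "(\<And>n. cinner (f n) x = cinner (f n) y) \<Longrightarrow> x = y"
    using f unfolding is_onb_def by (metis eq_iff_diff_eq_0)
  have "(norm (f n))\<^sup>2 = 1" using 1[of n n] unfolding cinner_self
    by (metis of_real_eq_1_iff)
  thus "norm (f n) = 1" by (simp add: power2_eq_1_iff) (smt (verit) norm_ge_zero)
qed

lemma riesz_fischer:
  fixes f :: "nat \<Rightarrow> 'a::complex_hilbert"
  assumes f: "is_onb f" and c: "summable (\<lambda>n. (cmod (c n))\<^sup>2)"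
  obtains y where "(\<lambda>n. c n *\<^sub>C f n) sums y" "\<And>n. cinner (f n) y = c n"
proof -
  let ?s = "\<lambda>k. \<Sum>n<k. c n *\<^sub>C f n"
  have "Cauchy ?s"
  proof (rule metric_CauchyI)
    fix e :: real assume e: "e > 0"
    obtain N where N: "\<And>m n. m \<ge> N \<Longrightarrow> norm (\<Sum>k\<in>{m..<n}. (cmod (c k))\<^sup>2) < e\<^sup>2"
      using c e unfolding summable_Cauchy by (metis zero_less_power)
    have *: "dist (?s m) (?s n) < e" if "m \<ge> N" "m \<le> n" for m n
    proof -
      have "norm (\<Sum>k\<in>{m..<n}. c k *\<^sub>C f k) < e"
      proof (rule power_less_imp_less_base)
      show "(norm (\<Sum>k\<in>{m..<n}. c k *\<^sub>C f k))\<^sup>2 < e\<^sup>2"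
          using N[OF that(1), of n] by (subst orthonormal_norm_sum) (auto simp: onb_ortho[OF f] sum_nonneg)
      qed (use e in simp)
      moreover have "?s n - ?s m = (\<Sum>k\<in>{m..<n}. c k *\<^sub>C f k)"
        using sum_diff_nat_ivl[of 0 m n "\<lambda>k. c k *\<^sub>C f k"] that by (simp add: lessThan_atLeast0)
      ultimately show ?thesis by (simp add: dist_norm norm_minus_commute[of "?s m"])
    qed
    show "\<exists>N. \<forall>m\<ge>N. \<forall>n\<ge>N. dist (?s m) (?s n) < e"
      using * by (metis dist_commute linorder_linear)
  qed
  hence "summable (\<lambda>n. c n *\<^sub>C f n)" by (simp add: summable_iff_convergent Cauchy_convergent_iff)
  then obtain y where y: "(\<lambda>n. c n *\<^sub>C f n) sums y" by blast
  have "cinner (f n) y = c n" for n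
  proof (rule sums_unique2)
    show "(\<lambda>k. cinner (f n) (c k *\<^sub>C f k)) sums cinner (f n) y"
      by (rule bounded_linear.sums[OF bounded_linear_cinner_right y])
    have "(\<lambda>k. if k = n then c k else 0) sums c n" by (rule sums_single)
    thus "(\<lambda>k. cinner (f n) (c k *\<^sub>C f k)) sums c n"
      by (rule sums_cong[THEN iffD1, rotated]) (auto simp: cinner_scaleC_right onb_ortho[OF f])
  qed
  thus ?thesis using y that by blast
qed

lemma
  fixes f :: "nat \<Rightarrow> 'a::complex_hilbert"
  assumes f: "is_onb f"
  shows onb_expansion: "(\<lambda>n. cinner (f n) x *\<^sub>C f n) sums x"
    and onb_parseval: "(\<lambda>n. (cmod (cinner (f n) x))\<^sup>2) sums (norm x)\<^sup>2"
    and onb_cinner: "(\<lambda>n. cnj (cinner (f n) z) * cinner (f n) x) sums cinner z x"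
proof -
  have eq: "(norm (x - (\<Sum>n<k. cinner (f n) x *\<^sub>C f n)))\<^sup>2 = (norm x)\<^sup>2 - (\<Sum>n<k. (cmod (cinner (f n) x))\<^sup>2)"
    for k
    by (rule orthonormal_bessel) (auto simp: onb_ortho[OF f])
  have "(\<Sum>n<k. (cmod (cinner (f n) x))\<^sup>2) \<le> (norm x)\<^sup>2" for k
    using eq[of k] by (smt (verit) zero_le_power2)
  hence "summable (\<lambda>n. (cmod (cinner (f n) x))\<^sup>2)"
    by (intro summableI_nonneg_bounded) auto
  then obtain y where y: "(\<lambda>n. cinner (f n) x *\<^sub>C f n) sums y" "\<And>n. cinner (f n) y = cinner (f n) x"
    using riesz_fischer[OF f] by metis
  have "y = x" by (rule onb_eqI[OF f]) (rule y(2))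
  thus ex: "(\<lambda>n. cinner (f n) x *\<^sub>C f n) sums x" using y(1) by simp
  have "(\<lambda>k. x - (\<Sum>n<k. cinner (f n) x *\<^sub>C f n)) \<longlonglongrightarrow> x - x"
    using tendsto_diff[OF tendsto_const ex[unfolded sums_def]] .
  hence "(\<lambda>k. (norm x)\<^sup>2 - (norm (x - (\<Sum>n<k. cinner (f n) x *\<^sub>C f n)))\<^sup>2) \<longlonglongrightarrow> (norm x)\<^sup>2 - (norm (x - x))\<^sup>2"
    by (rule tendsto_diff[OF tendsto_const tendsto_power[OF tendsto_norm]])
  thus "(\<lambda>n. (cmod (cinner (f n) x))\<^sup>2) sums (norm x)\<^sup>2" unfolding sums_def eq by simp
  have "(\<lambda>n. cinner z (cinner (f n) x *\<^sub>C f n)) sums cinner z x"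
    by (rule bounded_linear.sums[OF bounded_linear_cinner_right ex])
  thus "(\<lambda>n. cnj (cinner (f n) z) * cinner (f n) x) sums cinner z x"
    by (simp add: cinner_scaleC_right cinner_commute[of z] mult.commute)
qed

section \<open>Diagonal operators in an orthonormal basis, bounded and unbounded\<close>

definition diag :: "(nat \<Rightarrow> 'a::complex_hilbert) \<Rightarrow> (nat \<Rightarrow> complex) \<Rightarrow> 'a \<Rightarrow> 'a" where
  "diag f c x = (\<Sum>n. (c n * cinner (f n) x) *\<^sub>C f n)"

lemma cinner_diag:
  fixes f :: "nat \<Rightarrow> 'a::complex_hilbert"
  assumes f: "is_onb f" and c: "summable (\<lambda>n. (cmod (c n * cinner (f n) x))\<^sup>2)"
  shows "cinner (f n) (diag f c x) = c n * cinner (f n) x"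
  using riesz_fischer[OF f c] unfolding diag_def by (metis sums_unique)

lemma summable_bounded_coeff:
  fixes f :: "nat \<Rightarrow> 'a::complex_hilbert"
  assumes f: "is_onb f" and c: "\<And>n. cmod (c n) \<le> K"
  shows "summable (\<lambda>n. (cmod (c n * cinner (f n) x))\<^sup>2)"
proof (rule summable_comparison_test')
  show "summable (\<lambda>n. K\<^sup>2 * (cmod (cinner (f n) x))\<^sup>2)"
    using onb_parseval[OF f, of x] by (auto simp: sums_iff intro: summable_mult)
  show "norm ((cmod (c n * cinner (f n) x))\<^sup>2) \<le> K\<^sup>2 * (cmod (cinner (f n) x))\<^sup>2" for n
    using power_mono[OF c[of n], of 2] by (simp add: norm_mult power_mult_distrib mult_right_mono)
qed

lemma cinner_diag_bounded:
  fixes f :: "nat \<Rightarrow> 'a::complex_hilbert"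
  assumes f: "is_onb f" and c: "\<And>n. cmod (c n) \<le> K"
  shows "cinner (f n) (diag f c x) = c n * cinner (f n) x"
  by (intro cinner_diag f summable_bounded_coeff[OF f c])

lemma norm_diag_le:
  fixes f :: "nat \<Rightarrow> 'a::complex_hilbert"
  assumes f: "is_onb f" and c: "\<And>n. cmod (c n) \<le> K"
  shows "norm (diag f c x) \<le> K * norm x"
proof (rule power2_le_imp_le)
  have "(\<lambda>n. (cmod (c n * cinner (f n) x))\<^sup>2) sums (norm (diag f c x))\<^sup>2"
    using onb_parseval[OF f, of "diag f c x"] by (simp add: cinner_diag_bounded[OF f c])
  moreover have "(\<lambda>n. K\<^sup>2 * (cmod (cinner (f n) x))\<^sup>2) sums (K\<^sup>2 * (norm x)\<^sup>2)"
    by (intro sums_mult onb_parseval f)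
  ultimately have "(norm (diag f c x))\<^sup>2 \<le> K\<^sup>2 * (norm x)\<^sup>2"
    by (rule sums_le[rotated])
      (auto simp: norm_mult power_mult_distrib intro!: mult_right_mono power_mono c)
  thus "(norm (diag f c x))\<^sup>2 \<le> (K * norm x)\<^sup>2" by (simp add: power_mult_distrib)
  show "0 \<le> K * norm x" using order_trans[OF norm_ge_zero c] by (intro mult_nonneg_nonneg) auto
qed

lemma diag_bounded_ops:
  fixes f :: "nat \<Rightarrow> 'a::complex_hilbert"
  assumes f: "is_onb f" and c: "\<And>n. cmod (c n) \<le> K"
  shows "diag f c \<in> bounded_ops"
proof (rule bounded_opsI[where K = K])
  fix x y a
  show "diag f c (x + y) = diag f c x + diag f c y"
    by (rule onb_eqI[OF f]) (simp add: cinner_diag_bounded[OF f c] cinner_add_right distrib_left)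
  show "diag f c (a *\<^sub>C x) = a *\<^sub>C diag f c x"
    by (rule onb_eqI[OF f]) (simp add: cinner_diag_bounded[OF f c] cinner_scaleC_right)
  show "norm (diag f c x) \<le> K * norm x" by (rule norm_diag_le[OF f c])
qed

lemma diag_onb:
  fixes f :: "nat \<Rightarrow> 'a::complex_hilbert"
  assumes f: "is_onb f" and c: "\<And>n. cmod (c n) \<le> K"
  shows "diag f c (f n) = c n *\<^sub>C f n"
  by (rule onb_eqI[OF f])
    (simp add: cinner_diag_bounded[OF f c] cinner_scaleC_right onb_ortho[OF f])

lemma cinner_diag_right:
  fixes f :: "nat \<Rightarrow> 'a::complex_hilbert"
  assumes f: "is_onb f" and c: "\<And>n. cmod (c n) \<le> K"
  shows "cinner z (diag f c x) = cinner (diag f (\<lambda>n. cnj (c n)) z) x"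
proof (rule sums_unique2)
  have c': "\<And>n. cmod (cnj (c n)) \<le> K" using c by simp
  show "(\<lambda>n. cnj (cinner (f n) z) * cinner (f n) (diag f c x)) sums cinner z (diag f c x)"
    by (rule onb_cinner[OF f])
  show "(\<lambda>n. cnj (cinner (f n) z) * cinner (f n) (diag f c x)) sums
    cinner (diag f (\<lambda>n. cnj (c n)) z) x"
    using onb_cinner[OF f, of "diag f (\<lambda>n. cnj (c n)) z" x]
    by (simp add: cinner_diag_bounded[OF f c] cinner_diag_bounded[OF f c'] mult_ac)
qed

lemma cadj_diag:
  fixes f :: "nat \<Rightarrow> 'a::complex_hilbert"
  assumes f: "is_onb f" and c: "\<And>n. cmod (c n) \<le> K"
  shows "cadj (diag f c) = diag f (\<lambda>n. cnj (c n))"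
  by (rule cadj_eqI) (simp add: cinner_diag_right[OF f c])

lemma diag_comp:
  fixes f :: "nat \<Rightarrow> 'a::complex_hilbert"
  assumes f: "is_onb f" and c: "\<And>n. cmod (c n) \<le> K" and d: "\<And>n. cmod (d n) \<le> L"
  shows "diag f c \<circ> diag f d = diag f (\<lambda>n. c n * d n)"
proof
  have cd: "cmod (c n * d n) \<le> K * L" for n
    using mult_mono[OF c[of n] d[of n]] order_trans[OF norm_ge_zero c] by (simp add: norm_mult)
  show "(diag f c \<circ> diag f d) x = diag f (\<lambda>n. c n * d n) x" for x
    by (rule onb_eqI[OF f])
      (simp add: cinner_diag_bounded[OF f c] cinner_diag_bounded[OF f d] cinner_diag_bounded[OF f cd])
qed

lemma diag_one: "is_onb f \<Longrightarrow> diag f (\<lambda>_. 1) = id"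
  by (rule ext, rule onb_eqI, assumption) (simp add: cinner_diag_bounded[where K = 1])

lemma diag_eqI:
  assumes f: "is_onb f" and c: "\<And>n. cmod (c n) \<le> K" and A: "A \<in> bounded_ops"
    and eq: "\<And>n. A (f n) = c n *\<^sub>C f n"
  shows "A = diag f c"
proof
  fix x
  have "(\<lambda>n. A (cinner (f n) x *\<^sub>C f n)) sums A x"
    by (rule bounded_linear.sums[OF bounded_ops_bounded_linear[OF A] onb_expansion[OF f]])
  thus "A x = diag f c x"
    by (simp add: diag_def bounded_opsD[OF A] eq scaleC_scaleC mult.commute sums_iff)
qed

text \<open>Dominated convergence for series, along an arbitrary filter so that it serves limits at
  a real time as well as limits of sequences.\<close>

lemma tendsto_suminf_dominated:
  fixes a :: "nat \<Rightarrow> 'b \<Rightarrow> real"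
  assumes "\<And>k. (a k \<longlongrightarrow> 0) F" "\<And>k n. \<bar>a k n\<bar> \<le> M k" "summable M" "F \<noteq> bot"
  shows "((\<lambda>n. \<Sum>k. a k n) \<longlongrightarrow> 0) F"
proof -
  have "\<forall>\<^sub>F (k, n) in at_top \<times>\<^sub>F F. norm (a k n) \<le> M k"
    by (rule always_eventually) (use assms(2) in auto)
  from tannerys_theorem[of a "\<lambda>_. 0", OF assms(1) this assms(3,4)] show ?thesis by simp
qed

text \<open>Parseval turns the squared distance into a series dominated by
  \<open>(2 * K)\<^sup>2\<close> times the squared coefficients of x. The c t n converge only one by
  one, so the conclusion is strong convergence; it gives sigma-additivity of the diagonal spectral
  measure and strong continuity of the unitary group.\<close>

lemma tendsto_diag:
  fixes f :: "nat \<Rightarrow> 'a::complex_hilbert"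
  assumes f: "is_onb f" and c: "\<And>t n. cmod (c t n) \<le> K" and d: "\<And>n. cmod (d n) \<le> K"
    and lim: "\<And>n. ((\<lambda>t. c t n) \<longlongrightarrow> d n) F" and F: "F \<noteq> bot"
  shows "((\<lambda>t. diag f (c t) x) \<longlongrightarrow> diag f d x) F"
proof -
  let ?a = "\<lambda>n t. (cmod ((c t n - d n) * cinner (f n) x))\<^sup>2"
  have "(norm (diag f (c t) x - diag f d x))\<^sup>2 = (\<Sum>n. ?a n t)" for t
    using onb_parseval[OF f, of "diag f (c t) x - diag f d x"]
    by (simp add: cinner_diff_right cinner_diag_bounded[OF f c] cinner_diag_bounded[OF f d]
        sums_iff left_diff_distrib)
  moreover have "((\<lambda>t. \<Sum>n. ?a n t) \<longlongrightarrow> 0) F"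
  proof (rule tendsto_suminf_dominated[where M = "\<lambda>n. (2 * K)\<^sup>2 * (cmod (cinner (f n) x))\<^sup>2"])
    fix n
    have "(?a n \<longlongrightarrow> (cmod ((d n - d n) * cinner (f n) x))\<^sup>2) F"
      by (intro tendsto_intros lim)
    thus "(?a n \<longlongrightarrow> 0) F" by simp
    fix t
    have "cmod (c t n - d n) \<le> 2 * K"
      using norm_triangle_ineq4[of "c t n" "d n"] c[of t n] d[of n] by linarith
    hence "(cmod (c t n - d n))\<^sup>2 \<le> (2 * K)\<^sup>2" by (intro power_mono) auto
    thus "\<bar>?a n t\<bar> \<le> (2 * K)\<^sup>2 * (cmod (cinner (f n) x))\<^sup>2"
      unfolding norm_mult power_mult_distrib[of "cmod _"] abs_mult
      by (simp add: mult_right_mono)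
  next
    show "summable (\<lambda>n. (2 * K)\<^sup>2 * (cmod (cinner (f n) x))\<^sup>2)"
      using onb_parseval[OF f, of x] by (auto simp: sums_iff intro: summable_mult)
  qed (rule F)
  ultimately have "((\<lambda>t. (norm (diag f (c t) x - diag f d x))\<^sup>2) \<longlongrightarrow> 0) F" by simp
  hence "((\<lambda>t. sqrt ((norm (diag f (c t) x - diag f d x))\<^sup>2)) \<longlongrightarrow> sqrt 0) F"
    by (rule tendsto_real_sqrt)
  hence "((\<lambda>t. norm (diag f (c t) x - diag f d x)) \<longlongrightarrow> 0) F" by simp
  thus ?thesis by (simp add: tendsto_norm_zero_iff LIM_zero_iff)
qed

text \<open>The domain is maximal: all x whose multiplied coefficients are square summable. In
  coordinates this is the square integrability condition of \<open>pvm_domain\<close>, so the graph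
  can equal a spectral integral and not merely be contained in one.\<close>

definition diag_op :: "(nat \<Rightarrow> 'a::complex_hilbert) \<Rightarrow> (nat \<Rightarrow> complex) \<Rightarrow> 'a operator" where
  "diag_op f c = {(x, y). summable (\<lambda>n. (cmod (c n * cinner (f n) x))\<^sup>2) \<and>
     (\<forall>n. cinner (f n) y = c n * cinner (f n) x)}"

lemma diag_op_bounded:
  fixes f :: "nat \<Rightarrow> 'a::complex_hilbert"
  assumes f: "is_onb f" and c: "\<And>n. cmod (c n) \<le> K"
  shows "diag_op f c = graph_of (diag f c)"
proof -
  have "y = diag f c x" if "\<forall>n. cinner (f n) y = c n * cinner (f n) x" for x y
    by (rule onb_eqI[OF f]) (simp add: that cinner_diag_bounded[OF f c])
  thus ?thesis
    unfolding diag_op_def graph_of_def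
    by (auto simp: summable_bounded_coeff[OF f c] cinner_diag_bounded[OF f c])
qed

lemma op_apply_graph_of [simp]: "op_apply (graph_of A) = A"
  by (rule ext) (simp add: op_apply_def graph_of_def)

lemma diag_op_onb:
  fixes f :: "nat \<Rightarrow> 'a::complex_hilbert"
  assumes f: "is_onb f"
  shows "(f n, c n *\<^sub>C f n) \<in> diag_op f c"
proof -
  have "summable (\<lambda>k. (cmod (c k * cinner (f k) (f n)))\<^sup>2)"
    by (rule summable_finite[of "{n}"]) (auto simp: onb_ortho[OF f])
  thus ?thesis by (simp add: diag_op_def cinner_scaleC_right onb_ortho[OF f])
qed

section \<open>Eigenbases of injective Hilbert-Schmidt operators\<close>

lemma nonneg_sums_swap_le:
  fixes a :: "nat \<Rightarrow> nat \<Rightarrow> real"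
  assumes "\<And>m n. 0 \<le> a m n" "\<And>m. a m sums r m" "\<And>n. (\<lambda>m. a m n) sums c n" "r sums R"
  shows "(\<Sum>n<k. c n) \<le> R"
proof (rule sums_le)
  show "(\<lambda>m. \<Sum>n<k. a m n) sums (\<Sum>n<k. c n)" by (intro sums_sum assms)
  show "(\<Sum>n<k. a m n) \<le> r m" for m
    using sum_le_suminf[of "a m" "{..<k}"] assms(1,2) by (auto simp: sums_iff)
qed fact

text \<open>Tonelli for double series: every finite sum of column totals is at most the sum of the
  row totals, and the same estimate with rows and columns exchanged gives the reverse
  inequality.\<close>

lemma nonneg_sums_swap:
  fixes a :: "nat \<Rightarrow> nat \<Rightarrow> real"
  assumes a: "\<And>m n. 0 \<le> a m n" "\<And>m. a m sums r m" "\<And>n. (\<lambda>m. a m n) sums c n" "r sums R"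
  shows "c sums R"
proof -
  have c0: "0 \<le> c n" for n by (rule sums_le[OF _ sums_zero a(3)]) (rule a)
  have le: "(\<Sum>n<k. c n) \<le> R" for k by (rule nonneg_sums_swap_le[OF a])
  have sc: "summable c" by (rule summableI_nonneg_bounded[OF c0 le])
  have "(\<Sum>m<k. r m) \<le> suminf c" for k
    by (rule nonneg_sums_swap_le[of "\<lambda>n m. a m n" c r, OF a(1) a(3) a(2) summable_sums[OF sc]])
  hence "R \<le> suminf c" using a(4) by (intro LIMSEQ_le_const2[of "\<lambda>k. \<Sum>m<k. r m"]) (auto simp: sums_def)
  moreover have "suminf c \<le> R" by (rule suminf_le_const[OF sc le])
  ultimately show ?thesis using sc by (simp add: sums_iff)
qed

text \<open>The Hilbert-Schmidt norm does not depend on the basis: the squares |<f n, A e_m>|^2 sum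
  over n to ||A e_m||^2 by Parseval for f, and over m to ||B f n||^2, with B the adjoint of A, by
  Parseval for \<open>ebasis\<close>.\<close>

lemma hs_norm_onb:
  fixes X :: "'a::separable_hilbert hs"
  assumes f: "is_onb f"
  shows "(\<lambda>n. (norm (hs_op X (f n)))\<^sup>2) sums (norm X)\<^sup>2"
    and "(\<lambda>n. (norm (cadj (hs_op X) (f n)))\<^sup>2) sums (norm X)\<^sup>2"
proof -
  have *: "(\<lambda>n. (norm (B (f n)))\<^sup>2) sums (norm X)\<^sup>2"
    if B: "\<And>x y. cinner (A y) x = cinner y (B x)" and A: "(\<lambda>n. (norm (A (ebasis n)))\<^sup>2) sums (norm X)\<^sup>2"
    for A B :: "'a \<Rightarrow> 'a"
  proof (rule nonneg_sums_swap[OF _ _ _ A])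
    show "(\<lambda>n. (cmod (cinner (f n) (A (ebasis m))))\<^sup>2) sums (norm (A (ebasis m)))\<^sup>2" for m
      by (rule onb_parseval[OF f])
    show "(\<lambda>m. (cmod (cinner (f n) (A (ebasis m))))\<^sup>2) sums (norm (B (f n)))\<^sup>2" for n
      using ebasis_expansion(2)[of "B (f n)"] by (simp add: cmod_cinner_commute[of "f n"] B)
  qed simp
  show "(\<lambda>n. (norm (hs_op X (f n)))\<^sup>2) sums (norm X)\<^sup>2"
    by (rule *[of "cadj (hs_op X)"]) (use hs_inner_self[of X] in \<open>simp_all add: cinner_cadj power2_norm_eq_inner\<close>)
  show "(\<lambda>n. (norm (cadj (hs_op X) (f n)))\<^sup>2) sums (norm X)\<^sup>2"
    by (rule *[OF _ hs_norm_sums]) (simp add: cinner_cadj')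
qed

section \<open>Compactness of Hilbert-Schmidt operators\<close>

lemma bounded_combinations_in_compact:
  fixes v :: "nat \<Rightarrow> 'a::complex_hilbert"
  shows "\<exists>K. compact K \<and> (\<forall>c. (\<forall>n<N. cmod (c n) \<le> 1) \<longrightarrow> (\<Sum>n<N. c n *\<^sub>C v n) \<in> K)"
proof (induction N)
  case (Suc N)
  then obtain K where K: "compact K" "\<And>c. (\<forall>n<N. cmod (c n) \<le> 1) \<Longrightarrow> (\<Sum>n<N. c n *\<^sub>C v n) \<in> K"
    by blast
  have "bounded_linear (\<lambda>c. c *\<^sub>C v N)"
    by (rule bounded_linear_intro[where K = "norm (v N)"])
      (auto simp: scaleC_add_left scaleR_scaleC scaleC_scaleC norm_scaleC scaleR_conv_of_real)
  hence "compact ((\<lambda>c. c *\<^sub>C v N) ` cball 0 1)"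
    by (intro compact_continuous_image linear_continuous_on compact_cball)
  hence "compact {x + y | x y. x \<in> K \<and> y \<in> (\<lambda>c. c *\<^sub>C v N) ` cball 0 1}"
    by (rule compact_sums[OF K(1)])
  moreover have "(\<Sum>n<Suc N. c n *\<^sub>C v n) \<in> {x + y | x y. x \<in> K \<and> y \<in> (\<lambda>c. c *\<^sub>C v N) ` cball 0 1}"
    if "\<forall>n<Suc N. cmod (c n) \<le> 1" for c
    unfolding sum.lessThan_Suc
    by (rule CollectI, intro exI conjI, rule refl, rule K(2)) (use that in auto)
  ultimately show ?case by blast
qed (auto intro!: exI[of _ "{0}"])

text \<open>The squared norm of T composed with the projection off the first N basis vectors is a
  tail of the series of ||T e_n||^2; T is thus a norm limit of finite rank operators.\<close>

lemma hs_tail_tendsto: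
  fixes T :: "'a::separable_hilbert hs"
  shows "(\<lambda>N. norm (Abs_hs (hs_op T \<circ> diag ebasis (\<lambda>n. if n < N then 0 else 1)))) \<longlonglongrightarrow> 0"
proof -
  let ?R = "\<lambda>N. Abs_hs (hs_op T \<circ> diag ebasis (\<lambda>n. if n < N then 0 else 1))"
  have b: "cmod (if n < N then 0 else 1) \<le> 1" for n N :: nat by simp
  have R: "hs_op (?R N) = hs_op T \<circ> diag ebasis (\<lambda>n. if n < N then 0 else 1)" for N
    by (intro Abs_hs_op hilbert_schmidt_comp_right hs_hs_op diag_bounded_ops[OF is_onb_ebasis b])
  have "(norm (?R N))\<^sup>2 = (\<Sum>n. if n < N then 0 else (norm (hs_op T (ebasis n)))\<^sup>2)" for N
  proof -
    have "(norm (hs_op (?R N) (ebasis n)))\<^sup>2 = (if n < N then 0 else (norm (hs_op T (ebasis n)))\<^sup>2)" for n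
      unfolding R comp_apply diag_onb[OF is_onb_ebasis b] by (simp add: bounded_opsD(3))
    thus ?thesis using hs_norm_sums[of "?R N"] by (simp add: sums_iff)
  qed
  moreover have "(\<lambda>N. \<Sum>n. if n < N then 0 else (norm (hs_op T (ebasis n)))\<^sup>2) \<longlonglongrightarrow> 0"
  proof (rule tendsto_suminf_dominated[where M = "\<lambda>n. (norm (hs_op T (ebasis n)))\<^sup>2"])
    fix k
    show "(\<lambda>N. if k < N then 0 else (norm (hs_op T (ebasis k)))\<^sup>2) \<longlonglongrightarrow> 0"
      using eventually_gt_at_top[of k] by (rule tendsto_eventually[OF eventually_mono]) simp
  qed auto
  ultimately have "(\<lambda>N. (norm (?R N))\<^sup>2) \<longlonglongrightarrow> 0" by simp
  from tendsto_real_sqrt[OF this] show ?thesis by simp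
qed

text \<open>Up to a small tail, the image of the unit ball consists of combinations of finitely many
  vectors \<open>hs_op T (ebasis n)\<close> with coefficients of modulus at most 1. The image is
  therefore totally bounded and its closure compact.\<close>

lemma hs_op_seq_compact:
  fixes T :: "'a::separable_hilbert hs"
  assumes x: "\<And>k::nat. norm (x k) \<le> 1"
  obtains r l where "strict_mono r" "(\<lambda>k. hs_op T (x (r k))) \<longlonglongrightarrow> l"
proof -
  let ?S = "closure (hs_op T ` cball 0 1)"
  have "\<exists>k. finite k \<and> ?S \<subseteq> (\<Union>x\<in>k. ball x e)" if e: "e > 0" for e
  proof -
    let ?R = "\<lambda>N. Abs_hs (hs_op T \<circ> diag ebasis (\<lambda>n. if n < N then 0 else 1))"
    obtain N where N: "norm (?R N) < e / 3"
      using LIMSEQ_D[OF hs_tail_tendsto[of T], of "e / 3"] e by auto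
    have b: "cmod (if n < N then 0 else 1) \<le> 1" for n by simp
    have R: "hs_op (?R N) = hs_op T \<circ> diag ebasis (\<lambda>n. if n < N then 0 else 1)"
      by (intro Abs_hs_op hilbert_schmidt_comp_right hs_hs_op diag_bounded_ops[OF is_onb_ebasis b])
    obtain K where K: "compact K"
      "\<And>c. (\<forall>n<N. cmod (c n) \<le> 1) \<Longrightarrow> (\<Sum>n<N. c n *\<^sub>C hs_op T (ebasis n)) \<in> K"
      using bounded_combinations_in_compact[of N "\<lambda>n. hs_op T (ebasis n)"] by blast
    obtain k where k: "finite k" "K \<subseteq> (\<Union>x\<in>k. ball x (e/3))"
      using K(1) e unfolding compact_eq_totally_bounded by (metis zero_less_divide_iff zero_less_numeral)
    \<comment> \<open>One e/3 pays for the tail and one for the net of the compact set. The balls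
      are closed so that their finite union contains the closure as well; the remaining e/3 makes
      them open again.\<close>
    have "hs_op T ` cball 0 1 \<subseteq> (\<Union>x\<in>k. cball x (2*e/3))"
    proof safe
      fix y :: 'a assume y: "y \<in> cball 0 1"
      let ?c = "\<lambda>n. cinner (ebasis n) y"
      have "cmod (?c n) \<le> 1" for n
        using cmod_cinner_le[of "ebasis n" y] y by simp
      hence "(\<Sum>n<N. ?c n *\<^sub>C hs_op T (ebasis n)) \<in> K" by (intro K) auto
      then obtain z where z: "z \<in> k" "dist z (\<Sum>n<N. ?c n *\<^sub>C hs_op T (ebasis n)) < e/3"
        using k(2) by auto
      have "y - (\<Sum>n<N. ?c n *\<^sub>C ebasis n) = diag ebasis (\<lambda>n. if n < N then 0 else 1) y"
        by (rule onb_eqI[OF is_onb_ebasis])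
          (simp add: cinner_diff_right cinner_ebasis_sum cinner_diag_bounded[OF is_onb_ebasis b])
      hence "hs_op T y - (\<Sum>n<N. ?c n *\<^sub>C hs_op T (ebasis n)) = hs_op (?R N) y"
        by (simp add: R bounded_linear.linear[OF bounded_ops_bounded_linear, THEN linear_sum]
            bounded_linear.linear[OF bounded_ops_bounded_linear, THEN linear_diff] bounded_opsD(2)
            flip: \<open>y - _ = _\<close>)
      moreover have "norm (hs_op (?R N) y) \<le> norm (?R N)"
        using hs_op_norm_le[of "?R N" y] y mult_left_mono[of "norm y" 1 "norm (?R N)"] by simp
      ultimately have "dist (hs_op T y) (\<Sum>n<N. ?c n *\<^sub>C hs_op T (ebasis n)) < e/3"
        using N by (simp add: dist_norm)
      hence "dist z (hs_op T y) \<le> 2*e/3"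
        using z(2) dist_triangle2[of z "hs_op T y" "\<Sum>n<N. ?c n *\<^sub>C hs_op T (ebasis n)"] by simp
      thus "hs_op T y \<in> (\<Union>x\<in>k. cball x (2*e/3))" using z(1) by auto
    qed
    hence "?S \<subseteq> (\<Union>x\<in>k. cball x (2*e/3))"
      using k(1) by (intro closure_minimal closed_UN) auto
    also have "\<dots> \<subseteq> (\<Union>x\<in>k. ball x e)" using e by (intro UN_mono) auto
    finally show ?thesis using k(1) by blast
  qed
  hence "compact ?S" by (simp add: compact_eq_totally_bounded complete_eq_closed)
  hence "seq_compact ?S" by (simp add: compact_eq_seq_compact_metric)
  moreover have "\<forall>k. hs_op T (x k) \<in> ?S"
    using x closure_subset[of "hs_op T ` cball 0 1"] by auto
  ultimately obtain l r where "strict_mono r" "((\<lambda>k. hs_op T (x k)) \<circ> r) \<longlonglongrightarrow> l"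
    using seq_compactE[of ?S "\<lambda>k. hs_op T (x k)"] by blast
  thus ?thesis using that by (simp add: comp_def)
qed

text \<open>Variational principle on the orthogonal complement M of known eigenvectors; M is
  invariant under A = T*T because A is symmetric. With s the supremum of ||T x|| on the unit sphere
  of M, a maximising sequence satisfies ||A x - s^2 x|| -> 0, and compactness of T provides a
  convergent subsequence, whose limit is an eigenvector for s^2.\<close>

lemma hs_max_eigenvector:
  fixes T :: "'a::separable_hilbert hs" and F :: "'a set"
  defines "M \<equiv> {x. \<forall>v\<in>F. cinner v x = 0}" and "A \<equiv> \<lambda>x. cadj (hs_op T) (hs_op T x)"
  assumes inj: "\<And>x. hs_op T x = 0 \<Longrightarrow> x = 0"
    and eig: "\<And>v. v \<in> F \<Longrightarrow> \<exists>c. A v = c *\<^sub>C v" and M: "w \<in> M" "w \<noteq> 0"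
  shows "\<exists>u\<in>M. \<exists>\<sigma>>0. norm u = 1 \<and> A u = complex_of_real \<sigma> *\<^sub>C u \<and>
    (\<forall>x\<in>M. (norm (hs_op T x))\<^sup>2 \<le> \<sigma> * (norm x)\<^sup>2)"
proof -
  let ?T = "hs_op T"
  have Mscale: "c *\<^sub>C x \<in> M" if "x \<in> M" for c x using that by (simp add: M_def cinner_scaleC_right)
  have AM: "A x \<in> M" if x: "x \<in> M" for x
    unfolding M_def
  proof safe
    fix v assume v: "v \<in> F"
    obtain c where c: "A v = c *\<^sub>C v" using eig[OF v] by blast
    have "cinner v (A x) = cinner (A v) x" by (simp add: A_def cinner_cadj cinner_cadj')
    also have "\<dots> = 0" using x v by (simp add: c cinner_scaleC_left M_def)
    finally show "cinner v (A x) = 0" .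
  qed
  let ?V = "{norm (?T x) | x. x \<in> M \<and> norm x = 1}"
  define s where "s = Sup ?V"
  have bdd: "bdd_above ?V"
  proof (rule bdd_aboveI[of _ "norm T"])
    fix y assume "y \<in> ?V"
    then obtain x where "y = norm (?T x)" "norm x = 1" by blast
    thus "y \<le> norm T" using hs_op_norm_le[of T x] by simp
  qed
  have unit: "complex_of_real (inverse (norm x)) *\<^sub>C x \<in> M" "norm (complex_of_real (inverse (norm x)) *\<^sub>C x) = 1"
    if "x \<in> M" "x \<noteq> 0" for x
    using that by (auto simp: Mscale norm_scaleC norm_inverse)
  have le: "norm (?T x) \<le> s * norm x" if x: "x \<in> M" for x
  proof (cases "x = 0")
    case False
    have "norm (?T (complex_of_real (inverse (norm x)) *\<^sub>C x)) \<le> s"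
      unfolding s_def using unit[OF x False] by (intro cSup_upper bdd) auto
    hence "inverse (norm x) * norm (?T x) \<le> s"
      by (simp add: bounded_opsD(2) norm_scaleC norm_inverse del: of_real_inverse)
    thus ?thesis using False by (simp add: field_simps)
  qed (simp add: bounded_opsD(3))
  have s0: "s > 0"
  proof -
    have "0 < norm (?T w)" using inj M(2) by auto
    also have "\<dots> \<le> s * norm w" by (rule le[OF M(1)])
    finally show ?thesis using M(2) by (simp add: zero_less_mult_iff)
  qed
  have ne: "?V \<noteq> {}" using unit[OF M] by auto
  have "\<exists>x. x \<in> M \<and> norm x = 1 \<and> s - inverse (real (Suc k)) < norm (?T x)" for k
    using less_cSup_iff[OF ne bdd, of "s - inverse (real (Suc k))"] by (auto simp: s_def[symmetric])
  then obtain x where x: "\<And>k. x k \<in> M" "\<And>k. norm (x k) = 1"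
    "\<And>k. s - inverse (real (Suc k)) < norm (?T (x k))"
    by metis
  have "(\<lambda>k. norm (?T (x k))) \<longlonglongrightarrow> s"
  proof (rule tendsto_sandwich)
    show "(\<lambda>k. s - inverse (real (Suc k))) \<longlonglongrightarrow> s"
      using tendsto_diff[OF tendsto_const LIMSEQ_inverse_real_of_nat] by simp
    show "\<forall>\<^sub>F k in sequentially. norm (?T (x k)) \<le> s"
      using le[OF x(1)] x(2) by simp
  qed (use x(3) in \<open>auto intro!: always_eventually less_imp_le\<close>)
  hence lim: "(\<lambda>k. 2 * s^4 - 2 * s\<^sup>2 * (norm (?T (x k)))\<^sup>2) \<longlonglongrightarrow> 2 * s^4 - 2 * s\<^sup>2 * s\<^sup>2"
    by (intro tendsto_intros)
  let ?d = "\<lambda>k. A (x k) - complex_of_real (s\<^sup>2) *\<^sub>C x k"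
  \<comment> \<open>Expanding the square leaves ||A x||^2 - 2 s^2 ||T x||^2 + s^4, and ||A x|| <=
    s^2 because ||A x||^2 = <T x, T A x> with both x and A x in M.\<close>
  have d: "(norm (?d k))\<^sup>2 \<le> 2 * s^4 - 2 * s\<^sup>2 * (norm (?T (x k)))\<^sup>2" for k
  proof -
    have AA: "cinner (A y) z = cinner (?T y) (?T z)" for y z by (simp add: A_def cinner_cadj)
    have "(norm (A (x k)))\<^sup>2 = cmod (cinner (?T (x k)) (?T (A (x k))))"
      using arg_cong[OF cinner_self[of "A (x k)"], of cmod] by (simp add: AA norm_power)
    also have "\<dots> \<le> (s * norm (x k)) * (s * norm (A (x k)))"
      by (rule order_trans[OF cmod_cinner_le]) (intro mult_mono le x AM mult_nonneg_nonneg; use s0 in simp)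
    finally have "norm (A (x k)) * norm (A (x k)) \<le> s\<^sup>2 * norm (A (x k))"
      by (simp add: x(2) power2_eq_square mult_ac)
    hence "norm (A (x k)) \<le> s\<^sup>2" by (cases "norm (A (x k)) = 0") auto
    hence "(norm (A (x k)))\<^sup>2 \<le> (s\<^sup>2)\<^sup>2" by (intro power_mono) auto
    moreover have "Re (cinner (A (x k)) (complex_of_real (s\<^sup>2) *\<^sub>C x k)) = s\<^sup>2 * (norm (?T (x k)))\<^sup>2"
      by (simp add: cinner_scaleC_right AA cinner_self flip: of_real_power of_real_mult)
    ultimately show ?thesis
      unfolding norm_diff_sq by (simp add: norm_scaleC x(2) norm_power)
  qed
  have "(\<lambda>k. (norm (?d k))\<^sup>2) \<longlonglongrightarrow> 0"
  proof (rule tendsto_sandwich[of "\<lambda>_. 0"])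
    show "(\<lambda>k. 2 * s^4 - 2 * s\<^sup>2 * (norm (?T (x k)))\<^sup>2) \<longlonglongrightarrow> 0"
      using lim by (simp add: power2_eq_square power4_eq_xxxx mult.assoc)
  qed (use d in \<open>auto intro!: always_eventually\<close>)
  from tendsto_real_sqrt[OF this] have d0: "?d \<longlonglongrightarrow> 0" by (simp add: tendsto_norm_zero_iff)
  obtain r l where r: "strict_mono r" and l: "(\<lambda>k. ?T (x (r k))) \<longlonglongrightarrow> l"
    using hs_op_seq_compact[of x T] x(2) by (metis order_refl)
  let ?l = "cadj (hs_op T) l"
  have Al: "(\<lambda>k. A (x (r k))) \<longlonglongrightarrow> ?l"
    unfolding A_def by (rule bounded_linear.tendsto[OF bounded_ops_bounded_linear l]) (simp add: cadj_bounded)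
  \<comment> \<open>A x and s^2 x have the same limit along the subsequence, and s > 0 allows
    division by s^2, so x itself converges.\<close>
  have "(\<lambda>k. A (x (r k)) - ?d (r k)) \<longlonglongrightarrow> ?l - 0"
    using d0 r by (intro tendsto_diff Al) (auto simp: comp_def dest: LIMSEQ_subseq_LIMSEQ)
  hence "(\<lambda>k. complex_of_real (s\<^sup>2) *\<^sub>C x (r k)) \<longlonglongrightarrow> ?l" by simp
  hence "(\<lambda>k. complex_of_real (inverse (s\<^sup>2)) *\<^sub>C complex_of_real (s\<^sup>2) *\<^sub>C x (r k)) \<longlonglongrightarrow> complex_of_real (inverse (s\<^sup>2)) *\<^sub>C ?l"
    by (rule bounded_linear.tendsto[OF bounded_ops_bounded_linear[OF scaleC_in_bounded_ops]])
  moreover define u where "u = complex_of_real (inverse (s\<^sup>2)) *\<^sub>C ?l"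
  ultimately have xu: "(\<lambda>k. x (r k)) \<longlonglongrightarrow> u"
    using s0 by (simp add: scaleC_scaleC flip: of_real_power of_real_mult)
  have "u \<in> M"
    unfolding M_def
  proof safe
    fix v assume v: "v \<in> F"
    have "(\<lambda>k. cinner v (x (r k))) \<longlonglongrightarrow> cinner v u"
      by (rule bounded_linear.tendsto[OF bounded_linear_cinner_right xu])
    moreover have "(\<lambda>k. cinner v (x (r k))) = (\<lambda>k. 0)" using x(1) v by (auto simp: M_def)
    ultimately show "cinner v u = 0" by (simp add: LIMSEQ_const_iff)
  qed
  moreover have "norm u = 1"
    using tendsto_norm[OF xu] by (simp add: x(2) LIMSEQ_const_iff)
  moreover have "A u = complex_of_real (s\<^sup>2) *\<^sub>C u"
  proof -
    have "(\<lambda>k. A (x (r k))) \<longlonglongrightarrow> A u"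
      using bounded_linear.tendsto[OF bounded_ops_bounded_linear[OF bounded_ops_comp[OF
            cadj_bounded[OF hs_op_bounded[of T]] hs_op_bounded[of T]]] xu]
      by (simp add: A_def comp_def)
    hence "A u = ?l" using Al LIMSEQ_unique by blast
    thus ?thesis using s0 by (simp add: u_def scaleC_scaleC flip: of_real_power of_real_mult)
  qed
  moreover have "(norm (?T x))\<^sup>2 \<le> s\<^sup>2 * (norm x)\<^sup>2" if "x \<in> M" for x
    using power_mono[OF le[OF that], of 2] by (simp add: power_mult_distrib)
  ultimately show ?thesis using s0 by (intro bexI[of _ u] exI[of _ "s\<^sup>2"]) auto
qed

text \<open>If F were total, its Bessel sum for every \<open>ebasis n\<close> would be 1. Summing
  over N basis vectors and exchanging the sums bounds N by the number of elements of F, by Bessel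
  for \<open>ebasis\<close>. This keeps the greedy choice of eigenvectors from stopping.\<close>

lemma finite_orthonormal_not_total:
  fixes F :: "'a::separable_hilbert set"
  assumes "finite F" "\<And>u v. u \<in> F \<Longrightarrow> v \<in> F \<Longrightarrow> cinner u v = (if u = v then 1 else 0)"
  shows "\<exists>x. x \<noteq> 0 \<and> (\<forall>v\<in>F. cinner v x = 0)"
proof (rule ccontr)
  assume *: "\<not> ?thesis"
  have 1: "(\<Sum>v\<in>F. (cmod (cinner v (ebasis n)))\<^sup>2) = 1" for n
  proof -
    let ?y = "ebasis n - (\<Sum>v\<in>F. cinner v (ebasis n) *\<^sub>C v)"
    have "\<forall>v\<in>F. cinner v ?y = 0"
      using orthonormal_cinner_sum[of F "\<lambda>v. v"] assms by (simp add: cinner_diff_right)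
    hence "?y = 0" using * by blast
    thus ?thesis using orthonormal_bessel[of F "\<lambda>v. v" "ebasis n"] assms by simp
  qed
  have "real N \<le> real (card F)" for N
  proof -
    have "real N = (\<Sum>n<N. \<Sum>v\<in>F. (cmod (cinner v (ebasis n)))\<^sup>2)" by (simp add: 1)
    also have "\<dots> = (\<Sum>v\<in>F. \<Sum>n<N. (cmod (cinner (ebasis n) v))\<^sup>2)"
      by (subst sum.swap) (simp add: cmod_cinner_commute)
    also have "\<dots> \<le> (\<Sum>v\<in>F. 1)"
    proof (rule sum_mono)
      fix v assume v: "v \<in> F"
      have "(norm v)\<^sup>2 = 1" using assms(2)[OF v v] unfolding cinner_self by (metis of_real_eq_1_iff)
      thus "(\<Sum>n<N. (cmod (cinner (ebasis n) v))\<^sup>2) \<le> 1" using bessel[of v N] by simp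
    qed
    finally show ?thesis by simp
  qed
  from this[of "Suc (card F)"] show False by simp
qed

text \<open>The eigenvectors are chosen greedily: \<open>f n\<close> maximises \<open>\<parallel>T x\<parallel>\<close> over the unit sphere of the
  orthogonal complement of its predecessors. A vector orthogonal to all of them satisfies
  \<open>\<parallel>T x\<parallel>\<^sup>2 \<le> \<sigma> n \<parallel>x\<parallel>\<^sup>2\<close> with \<open>\<sigma> n = \<parallel>T (f n)\<parallel>\<^sup>2\<close> summable by Bessel's inequality for \<open>T*\<close>.\<close>

lemma hs_eigenbasis:
  fixes T :: "'a::separable_hilbert hs"
  assumes inj: "\<And>x. hs_op T x = 0 \<Longrightarrow> x = 0"
  obtains f :: "nat \<Rightarrow> 'a" and \<sigma> :: "nat \<Rightarrow> real" where "is_onb f" "\<And>n. \<sigma> n > 0"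
    "\<And>n. cadj (hs_op T) (hs_op T (f n)) = complex_of_real (\<sigma> n) *\<^sub>C f n"
    "\<sigma> sums (norm T)\<^sup>2"
proof -
  let ?T = "hs_op T"
  define A where "A = (\<lambda>x. cadj ?T (?T x))"
  define good where "good F u \<sigma> \<longleftrightarrow> (\<forall>v\<in>F. cinner v u = 0) \<and> \<sigma> > 0 \<and> norm u = 1 \<and>
    A u = complex_of_real \<sigma> *\<^sub>C u \<and> (\<forall>x. (\<forall>v\<in>F. cinner v x = 0) \<longrightarrow> (norm (?T x))\<^sup>2 \<le> \<sigma> * (norm x)\<^sup>2)"
    for F u \<sigma>
  define pick where "pick F = (SOME u. \<exists>\<sigma>. good F u \<sigma>)" for F
  define F where "F = rec_nat {} (\<lambda>_ F. insert (pick F) F)"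
  define f where "f n = pick (F n)" for n
  have F0: "F 0 = {}" and FS: "F (Suc n) = insert (f n) (F n)" for n by (simp_all add: F_def f_def)
  have FI: "F n = f ` {..<n}" for n by (induction n) (auto simp: F0 FS lessThan_Suc)
  have step: "\<exists>\<sigma>. good (F n) (f n) \<sigma>"
    if orth: "\<And>u v. u \<in> F n \<Longrightarrow> v \<in> F n \<Longrightarrow> cinner u v = (if u = v then 1 else 0)"
      and eig: "\<And>v. v \<in> F n \<Longrightarrow> \<exists>c. A v = c *\<^sub>C v" for n
  proof -
    obtain w where "w \<noteq> 0" "\<forall>v\<in>F n. cinner v w = 0"
    proof -
      have "finite (F n)" using FI[of n] by simp
      thus ?thesis using finite_orthonormal_not_total[of "F n"] orth that by blast
    qed
    hence "\<exists>u \<sigma>. good (F n) u \<sigma>"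
      using hs_max_eigenvector[of T "F n" w] inj eig unfolding good_def A_def by blast
    thus ?thesis unfolding f_def pick_def by (rule someI_ex)
  qed
  have self: "cinner u u = 1" if "norm u = 1" for u :: 'a using that by (simp add: cinner_self)
  \<comment> \<open>Orthonormality of F n and the eigenvector property are what \<open>step\<close>
    asks for, so both are carried through one induction.\<close>
  have inv: "(\<forall>u\<in>F n. \<forall>v\<in>F n. cinner u v = (if u = v then 1 else 0)) \<and> (\<forall>v\<in>F n. \<exists>c. A v = c *\<^sub>C v)" for n
  proof (induction n)
    case (Suc n)
    obtain \<sigma> where g: "good (F n) (f n) \<sigma>" using step[of n] Suc by blast
    have "cinner v (f n) = 0" "cinner (f n) v = 0" if "v \<in> F n" for v
      using g that unfolding good_def by (auto, metis cinner_commute complex_cnj_zero)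
    moreover have "cinner (f n) (f n) = 1" using g self by (simp add: good_def)
    moreover have "\<exists>c. A (f n) = c *\<^sub>C f n" using g unfolding good_def by blast
    moreover have "f n \<notin> F n" using calculation by force
    ultimately show ?case using Suc unfolding FS by auto
  qed (simp add: F0)
  have "\<exists>\<sigma>. good (F n) (f n) \<sigma>" for n using step[of n] inv[of n] by blast
  then obtain \<sigma> where g: "\<And>n. good (F n) (f n) (\<sigma> n)" by metis
  have ortho: "cinner (f m) (f n) = (if m = n then 1 else 0)" for m n
  proof -
    have lt: "cinner (f m) (f n) = 0" if "m < n" for m n
      using g[of n] that unfolding good_def FI by auto
    show ?thesis
    proof (cases m n rule: linorder_cases)
      case greater
      thus ?thesis using lt[OF greater] by (metis cinner_commute complex_cnj_zero less_irrefl)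
    qed (use lt g self in \<open>auto simp: good_def\<close>)
  qed
  have eig: "cadj ?T (?T (f n)) = complex_of_real (\<sigma> n) *\<^sub>C f n" for n
    using g by (simp add: good_def A_def)
  have nT: "(norm (?T (f n)))\<^sup>2 = \<sigma> n" for n
  proof -
    have "complex_of_real ((norm (?T (f n)))\<^sup>2) = complex_of_real (\<sigma> n)"
      using cinner_cadj'[of ?T "f n" "?T (f n)"]
      by (simp add: eig cinner_scaleC_right ortho flip: cinner_self[of "?T (f n)"] of_real_power)
    thus ?thesis by (simp only: of_real_eq_iff)
  qed
  \<comment> \<open>Totality of f will follow from this bound, so \<open>hs_norm_onb\<close> cannot
    be applied to f yet; only orthonormality enters, through Bessel for the vectors
    \<open>cadj ?T (ebasis m)\<close>.\<close>
  have "(\<Sum>n<k. \<sigma> n) \<le> (norm T)\<^sup>2" for k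
  proof (rule sums_le)
    have "(\<lambda>m. (cmod (cinner (ebasis m) (?T (f n))))\<^sup>2) sums \<sigma> n" for n
      using ebasis_expansion(2)[of "?T (f n)"] by (simp add: nT)
    thus "(\<lambda>m. \<Sum>n<k. (cmod (cinner (ebasis m) (?T (f n))))\<^sup>2) sums (\<Sum>n<k. \<sigma> n)"
      by (intro sums_sum)
    show "(\<lambda>m. (norm (cadj ?T (ebasis m)))\<^sup>2) sums (norm T)\<^sup>2"
      using hs_inner_self[of T] by (simp add: power2_norm_eq_inner)
    fix m
    have "0 \<le> (norm (cadj ?T (ebasis m)))\<^sup>2 - (\<Sum>n<k. (cmod (cinner (f n) (cadj ?T (ebasis m))))\<^sup>2)"
      by (subst orthonormal_bessel[symmetric]) (auto simp: ortho)
    thus "(\<Sum>n<k. (cmod (cinner (ebasis m) (?T (f n))))\<^sup>2) \<le> (norm (cadj ?T (ebasis m)))\<^sup>2"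
      by (simp add: cinner_cadj' cmod_cinner_commute[of "ebasis m"])
  qed
  moreover have pos: "\<sigma> n > 0" for n using g by (simp add: good_def)
  ultimately have "summable \<sigma>" by (intro summableI_nonneg_bounded) (auto intro: less_imp_le)
  hence \<sigma>0: "\<sigma> \<longlonglongrightarrow> 0" by (rule summable_LIMSEQ_zero)
  have onb: "is_onb f"
    unfolding is_onb_def
  proof (intro conjI allI impI)
    fix x assume x: "\<forall>n. cinner (f n) x = 0"
    have "(norm (?T x))\<^sup>2 \<le> \<sigma> n * (norm x)\<^sup>2" for n
      using g[of n] x unfolding good_def FI by auto
    moreover have "(\<lambda>n. \<sigma> n * (norm x)\<^sup>2) \<longlonglongrightarrow> 0 * (norm x)\<^sup>2" by (intro tendsto_mult \<sigma>0 tendsto_const)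
    ultimately have "(norm (?T x))\<^sup>2 \<le> 0"
      by (intro LIMSEQ_le_const[of "\<lambda>n. \<sigma> n * (norm x)\<^sup>2"]) auto
    thus "x = 0" using inj by simp
  qed (rule ortho)
  show ?thesis
    using that[OF onb pos eig] hs_norm_onb(1)[OF onb, of T] by (simp add: nT)
qed

section \<open>Projection-valued measures\<close>

text \<open>The factor i^k cancels the conjugate in front of <z, x>, the form being antilinear on
  the left; the three other terms carry sums of i^k or (-1)^k over k < 4 and vanish.\<close>

lemma polarization:
  "(\<Sum>k<4. \<i> ^ k * complex_of_real ((norm (x + \<i> ^ k *\<^sub>C z))\<^sup>2)) / 4 = cinner z (x::'a::complex_hilbert)"
proof -
  have *: "complex_of_real ((norm (x + c *\<^sub>C z))\<^sup>2) =
      cinner x x + c * cinner x z + cnj c * cinner z x + cnj c * c * cinner z z" for c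
    by (simp add: cinner_add_left cinner_add_right cinner_scaleC_left cinner_scaleC_right algebra_simps
        del: of_real_power flip: cinner_self)
  show ?thesis
    unfolding * by (simp add: eval_nat_numeral algebra_simps)
qed

locale pvm =
  fixes P :: "real set \<Rightarrow> 'a::separable_hilbert \<Rightarrow> 'a"
  assumes pvm: "proj_valued_measure P"
begin

abbreviation \<mu> where "\<mu> \<equiv> pvm_measure P"

lemma orth_proj: "E \<in> sets borel \<Longrightarrow> orth_projection (P E)"
  using pvm by (simp add: proj_valued_measure_def)

lemma bounded: "E \<in> sets borel \<Longrightarrow> P E \<in> bounded_ops"
  using orth_proj by (simp add: orth_projection_def)

lemma idem: "E \<in> sets borel \<Longrightarrow> P E (P E x) = P E x"
  using orth_proj[of E] unfolding orth_projection_def by (metis comp_apply)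

lemma self_adj: "E \<in> sets borel \<Longrightarrow> cinner (P E x) y = cinner x (P E y)"
  using orth_proj[of E] cinner_cadj[OF bounded, of E x y] by (simp add: orth_projection_def)

lemma UNIV_id [simp]: "P UNIV x = x"
  using pvm by (simp add: proj_valued_measure_def)

lemma sigma_additive:
  fixes E :: "nat \<Rightarrow> real set"
  shows "range E \<subseteq> sets borel \<Longrightarrow> disjoint_family E \<Longrightarrow> (\<lambda>i. P (E i) x) sums P (\<Union>i. E i) x"
  using pvm by (simp add: proj_valued_measure_def)

lemma empty [simp]: "P {} x = 0"
proof -
  have "(\<lambda>i::nat. P {} x) sums P (\<Union>i::nat. {}) x"
    by (rule sigma_additive) (auto simp: disjoint_family_on_def)
  hence "(\<lambda>i::nat. P {} x) \<longlonglongrightarrow> 0" by (intro summable_LIMSEQ_zero) (auto simp: sums_iff)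
  thus ?thesis by (simp add: LIMSEQ_const_iff)
qed

lemma disj_Un:
  assumes "E \<in> sets borel" "F \<in> sets borel" "E \<inter> F = {}"
  shows "P (E \<union> F) x = P E x + P F x"
proof -
  have "(\<lambda>i. P (binaryset E F i) x) sums P (\<Union>i. binaryset E F i) x"
    by (rule sigma_additive)
      (use assms in \<open>auto simp: range_binaryset_eq disjoint_family_on_def binaryset_def\<close>)
  moreover have "(\<lambda>i. P (binaryset E F i) x) sums (P E x + P F x)"
    by (rule binaryset_sums) simp
  ultimately show ?thesis by (metis sums_unique2 UN_binaryset_eq)
qed

lemma norm_sq: "E \<in> sets borel \<Longrightarrow> complex_of_real ((norm (P E x))\<^sup>2) = cinner x (P E x)"
  unfolding cinner_self[symmetric] by (simp add: self_adj idem)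

lemma norm_sq_Re: "E \<in> sets borel \<Longrightarrow> Re (cinner x (P E x)) = (norm (P E x))\<^sup>2"
  by (simp flip: norm_sq)

text \<open>P(E) + P(F) is again a projection. Comparing ||(P(E) + P(F)) y||^2 with <y, (P(E) +
  P(F)) y> leaves Re <P(E) y, P(F) y> = 0, and y = P(F) x turns this into ||P(E) P(F) x||^2 =
  0.\<close>

lemma disj_comp:
  assumes EF: "E \<in> sets borel" "F \<in> sets borel" "E \<inter> F = {}"
  shows "P E (P F x) = 0"
proof -
  have Re0: "Re (cinner (P E y) (P F y)) = 0" for y
  proof -
    have "(norm (P (E \<union> F) y))\<^sup>2 = Re (cinner y (P E y)) + Re (cinner y (P F y))"
      using EF norm_sq_Re[of "E \<union> F" y] by (simp add: disj_Un cinner_add_right)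
    thus ?thesis using EF by (simp add: disj_Un norm_add_sq norm_sq_Re)
  qed
  have "(norm (P E (P F x)))\<^sup>2 = Re (cinner (P E (P F x)) (P F x))"
    using EF by (simp add: self_adj flip: norm_sq_Re)
  also have "\<dots> = 0" using Re0[of "P F x"] EF by (simp add: idem)
  finally show ?thesis by simp
qed

lemma Int:
  assumes EF: "E \<in> sets borel" "F \<in> sets borel"
  shows "P E (P F x) = P (E \<inter> F) x"
proof -
  have F: "P F x = P (E \<inter> F) x + P (F - E) x"
    using disj_Un[of "E \<inter> F" "F - E" x] EF by (simp add: Int_commute Int_Diff_Un)
      (metis Diff_disjoint Int_Diff_Un Int_commute Int_left_commute inf_bot_right)
  have E: "P E y = P (E \<inter> F) y + P (E - F) y" for y
    using disj_Un[of "E \<inter> F" "E - F" y] EF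
    by (metis Diff_Diff_Int Diff_disjoint Int_Diff_Un Int_Diff_disjoint sets.Diff sets.Int)
  have "P E (P F x) = P E (P (E \<inter> F) x)"
    unfolding F using EF by (simp add: bounded_opsD(1)[OF bounded] disj_comp)
  also have "\<dots> = P (E \<inter> F) x"
  proof -
    have "(E - F) \<inter> (E \<inter> F) = {}" by blast
    hence "P (E - F) (P (E \<inter> F) x) = 0" using EF by (intro disj_comp) auto
    thus ?thesis using EF E[of "P (E \<inter> F) x"] by (simp add: idem)
  qed
  finally show ?thesis .
qed

lemma sets_pvm [simp, measurable_cong]: "sets (\<mu> x) = sets borel"
  and space_pvm [simp]: "space (\<mu> x) = UNIV"
  by (simp_all add: pvm_measure_def) (metis sets.sigma_sets_eq space_borel)

text \<open>The values of \<open>measure_of\<close> are zero unless the set function is a measure,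
  so countable additivity has to be extracted from the strong sigma-additivity of P.\<close>

lemma emeasure_pvm:
  assumes E: "E \<in> sets borel"
  shows "emeasure (\<mu> x) E = ennreal ((norm (P E x))\<^sup>2)"
proof -
  let ?m = "\<lambda>E. ennreal (Re (cinner x (P E x)))"
  have "emeasure (\<mu> x) E = ?m E"
  proof (rule emeasure_measure_of[OF pvm_measure_def])
    show "positive (sets (\<mu> x)) ?m" by (simp add: positive_def)
    show "countably_additive (sets (\<mu> x)) ?m"
    proof (rule countably_additiveI)
      fix A :: "nat \<Rightarrow> real set"
      assume A: "range A \<subseteq> sets (\<mu> x)" "disjoint_family A"
      have "(\<lambda>i. Re (cinner x (P (A i) x))) sums Re (cinner x (P (\<Union>i. A i) x))"
        using A by (intro sums_Re bounded_linear.sums[OF bounded_linear_cinner_right] sigma_additive) auto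
      moreover have "0 \<le> Re (cinner x (P (A i) x))" for i
        using A by (subst norm_sq_Re) auto
      ultimately show "(\<Sum>i. ?m (A i)) = ?m (\<Union>i. A i)" by (rule suminf_ennreal_eq[rotated])
    qed
  qed (use E in auto)
  thus ?thesis by (simp add: norm_sq_Re E)
qed

lemma measure_pvm: "E \<in> sets borel \<Longrightarrow> measure (\<mu> x) E = (norm (P E x))\<^sup>2"
  by (simp add: measure_def emeasure_pvm)

lemma finite_pvm [simp]: "finite_measure (\<mu> x)"
  by (rule finite_measureI) (simp add: emeasure_pvm)

lemma integrable_bounded:
  fixes g :: "real \<Rightarrow> 'b::{banach, second_countable_topology}"
  assumes "g \<in> borel_measurable borel" "\<And>s. norm (g s) \<le> C"
  shows "integrable (\<mu> x) g"
  using assms by (intro finite_measure.integrable_const_bound[OF finite_pvm, where B = C]) auto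

text \<open>P(G) cuts P(E) x down to P(G \<inter> E) x, so the measure of the combination has the
  density |a 1_E + c 1_F|^2 with respect to \<open>\<mu> x\<close>; \<open>h\<close> is this square
  written out. Nonnegativity is recorded because \<open>density\<close> reads \<open>h\<close>
  through \<open>ennreal\<close>.\<close>

lemma pvm_measure_combination:
  fixes a c :: complex
  assumes EF: "E \<in> sets borel" "F \<in> sets borel"
  defines "h \<equiv> \<lambda>s. (cmod a)\<^sup>2 * indicator E s + (cmod c)\<^sup>2 * indicator F s +
    2 * Re (cnj a * c) * indicator (E \<inter> F) s"
  shows "\<mu> (a *\<^sub>C P E x + c *\<^sub>C P F x) = density (\<mu> x) h" "\<And>s. 0 \<le> h s"
proof -
  have sq: "(cmod (a + c))\<^sup>2 = (cmod a)\<^sup>2 + (cmod c)\<^sup>2 + 2 * Re (cnj a * c)"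
    unfolding cmod_power2 by (simp add: power2_eq_square algebra_simps)
  show h0: "\<And>s. 0 \<le> h s"
    using sq unfolding h_def by (auto simp: indicator_def) (metis zero_le_power2)
  show "\<mu> (a *\<^sub>C P E x + c *\<^sub>C P F x) = density (\<mu> x) h"
  proof (rule measure_eqI)
    fix G assume "G \<in> sets (\<mu> (a *\<^sub>C P E x + c *\<^sub>C P F x))"
    hence G: "G \<in> sets borel" by simp
    let ?m = "\<lambda>E. (norm (P E x))\<^sup>2"
    let ?h = "\<lambda>s. (cmod a)\<^sup>2 * indicator (E \<inter> G) s + (cmod c)\<^sup>2 * indicator (F \<inter> G) s +
      2 * Re (cnj a * c) * indicator (E \<inter> F \<inter> G) s"
    have *: "E \<inter> G \<in> sets borel" "F \<inter> G \<in> sets borel" "E \<inter> F \<inter> G \<in> sets borel"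
      using EF G by auto
    have ip: "cinner (P (G \<inter> E) x) (P (G \<inter> F) x) = complex_of_real (?m (E \<inter> F \<inter> G))"
      using EF G by (simp add: self_adj Int norm_sq Int_ac del: of_real_power)
    have "(norm (P G (a *\<^sub>C P E x + c *\<^sub>C P F x)))\<^sup>2
      = (norm (a *\<^sub>C P (G \<inter> E) x + c *\<^sub>C P (G \<inter> F) x))\<^sup>2"
      using EF G by (simp add: bounded_opsD[OF bounded] Int)
    also have "\<dots> = (cmod a)\<^sup>2 * ?m (E \<inter> G) + (cmod c)\<^sup>2 * ?m (F \<inter> G) + 2 * Re (cnj a * c) * ?m (E \<inter> F \<inter> G)"
      unfolding norm_add_sq cinner_scaleC_left cinner_scaleC_right ip
      by (simp add: norm_scaleC power_mult_distrib Int_commute[of G] algebra_simps del: of_real_power)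
    also have "\<dots> = integral\<^sup>L (\<mu> x) ?h"
      using * by (simp add: measure_pvm finite_measure.emeasure_finite less_top[symmetric])
    also have heq: "?h = (\<lambda>s. h s * indicator G s)" by (auto simp: fun_eq_iff h_def indicator_def)
    also have "ennreal (integral\<^sup>L (\<mu> x) (\<lambda>s. h s * indicator G s)) =
      (\<integral>\<^sup>+s. ennreal (h s * indicator G s) \<partial>\<mu> x)"
    proof (rule nn_integral_eq_integral[symmetric])
      show "integrable (\<mu> x) (\<lambda>s. h s * indicator G s)"
        unfolding heq[symmetric] using * by (simp add: finite_measure.emeasure_finite less_top[symmetric])
    qed (use h0 in simp)
    also have "\<dots> = (\<integral>\<^sup>+s. ennreal (h s) * indicator G s \<partial>\<mu> x)"
      by (intro nn_integral_cong) (auto split: split_indicator)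
    also have "\<dots> = emeasure (density (\<mu> x) h) G"
    proof (rule emeasure_density[symmetric])
      show "(\<lambda>s. ennreal (h s)) \<in> borel_measurable (\<mu> x)" using EF unfolding h_def by measurable
    qed (use G in simp)
    finally show "emeasure (\<mu> (a *\<^sub>C P E x + c *\<^sub>C P F x)) G = emeasure (density (\<mu> x) h) G"
      by (simp add: emeasure_pvm G)
  qed simp
qed

lemma pvm_measure_proj:
  assumes E: "E \<in> sets borel"
  shows "\<mu> (c *\<^sub>C P E x) = density (\<mu> x) (\<lambda>s. (cmod c)\<^sup>2 * indicator E s)"
  using pvm_measure_combination(1)[OF E sets.empty_sets, where a = c and c = 0 and x = x] by simp

lemma
  fixes g :: "real \<Rightarrow> complex"
  assumes E: "E \<in> sets borel" and g: "g \<in> borel_measurable borel"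
  shows integrable_proj: "integrable (\<mu> (P E x)) g \<longleftrightarrow> integrable (\<mu> x) (\<lambda>s. indicator E s *\<^sub>R g s)"
    and integral_proj: "integral\<^sup>L (\<mu> (P E x)) g = (\<integral>s. indicator E s *\<^sub>R g s \<partial>\<mu> x)"
  using pvm_measure_proj[OF E, of 1 x] E g by (simp_all add: integrable_density integral_density)

lemma
  fixes g :: "real \<Rightarrow> complex"
  assumes g: "g \<in> borel_measurable borel" and c: "cmod c = 1"
  shows integrable_phase: "integrable (\<mu> (c *\<^sub>C x)) g \<longleftrightarrow> integrable (\<mu> x) g"
    and integral_phase: "integral\<^sup>L (\<mu> (c *\<^sub>C x)) g = integral\<^sup>L (\<mu> x) g"
  using pvm_measure_proj[of UNIV c x] g c by (simp_all add: density_1)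

text \<open>The density of \<open>\<mu> (P E x + \<i> ^ k P F x)\<close> is \<open>|1\<^sub>E + \<i> ^ k 1\<^sub>F|\<^sup>2\<close>, so polarization
  leaves \<open>1\<^sub>E 1\<^sub>F\<close>.\<close>

lemma pvm_integral2_proj:
  assumes EF: "E \<in> sets borel" "F \<in> sets borel" and g: "g \<in> borel_measurable borel"
    and int: "integrable (\<mu> x) (\<lambda>s. indicator (E \<union> F) s *\<^sub>R g s)"
  shows "pvm_integral2 P g (P F x) (P E x) = (\<integral>s. indicator (E \<inter> F) s *\<^sub>R g s \<partial>\<mu> x)"
proof -
  let ?h = "\<lambda>c s. indicator E s + (cmod c)\<^sup>2 * indicator F s + 2 * Re c * indicator (E \<inter> F) s"
  have mh [measurable]: "?h c \<in> borel_measurable borel" for c using EF by measurable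
  have I: "integral\<^sup>L (\<mu> (P E x + c *\<^sub>C P F x)) g = (\<integral>s. ?h c s *\<^sub>R g s \<partial>\<mu> x)" for c
    using pvm_measure_combination(1)[OF EF, where a = 1 and c = c and x = x]
      pvm_measure_combination(2)[OF EF, where a = 1 and c = c] EF g
    by (simp add: integral_density)
  have int_h: "integrable (\<mu> x) (\<lambda>s. ?h c s *\<^sub>R g s)" for c
  proof (rule Bochner_Integration.integrable_bound)
    \<comment> \<open>(1 + |c|)^2, an upper bound for |1_E + c 1_F|^2.\<close>
    let ?K = "1 + (cmod c)\<^sup>2 + 2 * cmod c"
    show "integrable (\<mu> x) (\<lambda>s. ?K *\<^sub>R (indicator (E \<union> F) s *\<^sub>R g s))"
      using int by (intro integrable_scaleR_right)
    have "\<bar>Re c\<bar> \<le> cmod c" "0 \<le> (cmod c)\<^sup>2" "0 \<le> cmod c" by (auto simp: abs_Re_le_cmod)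
    hence "\<bar>?h c s\<bar> \<le> \<bar>?K * indicator (E \<union> F) s\<bar>" for s
      unfolding indicator_def by (cases "s \<in> E"; cases "s \<in> F"; simp; linarith)
    thus "AE s in \<mu> x. norm (?h c s *\<^sub>R g s) \<le> norm (?K *\<^sub>R (indicator (E \<union> F) s *\<^sub>R g s))"
      by (intro AE_I2) (simp only: norm_scaleR abs_mult[symmetric] mult.assoc[symmetric] mult_right_mono norm_ge_zero)
  qed (use g in measurable)
  have "pvm_integral2 P g (P F x) (P E x) = (\<Sum>k<4. \<integral>s. (\<i> ^ k / 4) * (?h (\<i> ^ k) s *\<^sub>R g s) \<partial>\<mu> x)"
    unfolding pvm_integral2_def I sum_divide_distrib
    by (simp only: integral_mult_right_zero integral_divide_zero times_divide_eq_left)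
  also have "\<dots> = (\<integral>s. (\<Sum>k<4. (\<i> ^ k / 4) * (?h (\<i> ^ k) s *\<^sub>R g s)) \<partial>\<mu> x)"
    by (rule Bochner_Integration.integral_sum[symmetric]) (intro integrable_mult_right int_h)
  also have "\<dots> = (\<integral>s. indicator (E \<inter> F) s *\<^sub>R g s \<partial>\<mu> x)"
    by (intro Bochner_Integration.integral_cong refl)
      (auto simp: eval_nat_numeral indicator_def scaleR_conv_of_real algebra_simps)
  finally show ?thesis .
qed

lemma proj_in_domain:
  assumes E: "E \<in> sets borel" and f: "f \<in> borel_measurable borel"
    and int: "integrable (\<mu> x) (\<lambda>s. indicator E s *\<^sub>R complex_of_real ((cmod (f s))\<^sup>2))"
  shows "P E x \<in> pvm_domain P f"
proof -
  have "integrable (\<mu> (P E x)) (\<lambda>s. complex_of_real ((cmod (f s))\<^sup>2))"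
    using int f by (subst integrable_proj[OF E]) auto
  from integrable_Re[OF this] show ?thesis by (simp add: pvm_domain_def)
qed

text \<open>The measure is finite, so square integrable functions are integrable: |f| <= |f|^2 +
  1.\<close>

lemma domain_integrable:
  assumes f: "f \<in> borel_measurable borel" and x: "x \<in> pvm_domain P f"
  shows "integrable (\<mu> x) f"
proof (rule Bochner_Integration.integrable_bound)
  show "integrable (\<mu> x) (\<lambda>s. (cmod (f s))\<^sup>2 + 1)"
    using x by (intro Bochner_Integration.integrable_add finite_measure.integrable_const finite_pvm)
      (simp add: pvm_domain_def)
  have "cmod (f s) \<le> (cmod (f s))\<^sup>2 + 1" for s
    using sum_squares_bound[of "cmod (f s)" 1] norm_ge_zero[of "f s"] unfolding power_one mult_1_right
    by linarith
  thus "AE s in \<mu> x. norm (f s) \<le> norm ((cmod (f s))\<^sup>2 + 1)" by (simp add: abs_of_nonneg)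
qed (use f in simp)

text \<open>If the mean of \<open>g\<close> over every bounded Borel set equals \<open>d\<close>, then \<open>\<mu> x\<close> sits on the level
  set \<open>g = d\<close>, here a single point.\<close>

lemma proj_concentrated:
  fixes g :: "real \<Rightarrow> real"
  assumes g [measurable]: "g \<in> borel_measurable borel" and l: "\<And>s. g s = d \<longleftrightarrow> s = l"
    and int: "\<And>n E. E \<in> sets borel \<Longrightarrow> E \<subseteq> {-real n..real n} \<Longrightarrow>
      integrable (\<mu> x) (\<lambda>s. indicator E s * g s)"
    and mean: "\<And>n E. E \<in> sets borel \<Longrightarrow> E \<subseteq> {-real n..real n} \<Longrightarrow>
      (\<integral>s. indicator E s * g s \<partial>\<mu> x) = d * measure (\<mu> x) E"
    and E: "E \<in> sets borel"
  shows "P E x = (if l \<in> E then x else 0)"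
proof -
  \<comment> \<open>c = 1 and c = -1 select the sets g > d and g < d. The cut to [-n, n] is there
    because integrability and mean are given for bounded sets only; on A n the function c (g - d) is
    positive with integral zero.\<close>
  have null: "A n \<in> null_sets (\<mu> x)"
    if A: "A n = {s \<in> {-real n..real n}. 0 < c * (g s - d)}" for c n A
  proof -
    have [measurable]: "A n \<in> sets borel" unfolding A by measurable
    have sub: "A n \<subseteq> {-real n..real n}" using A by auto
    have i1: "integrable (\<mu> x) (indicator (A n) :: real \<Rightarrow> real)"
      by (intro integrable_bounded[of _ 1]) (auto simp: indicator_def)
    have i: "integrable (\<mu> x) (\<lambda>s. c * (indicator (A n) s * g s - d * indicator (A n) s))"
      by (intro integrable_mult_right Bochner_Integration.integrable_diff int[OF _ sub] i1) auto
    have "(\<integral>s. c * (indicator (A n) s * g s - d * indicator (A n) s) \<partial>\<mu> x) = 0"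
      using int[OF _ sub] mean[OF _ sub] i1 by simp
    moreover have "0 \<le> c * (indicator (A n) s * g s - d * indicator (A n) s)" for s
      using A by (auto simp: indicator_def)
    ultimately have "AE s in \<mu> x. c * (indicator (A n) s * g s - d * indicator (A n) s) = 0"
      using integral_nonneg_eq_0_iff_AE[OF i] by simp
    hence "AE s in \<mu> x. s \<notin> A n"
      by eventually_elim (use A in \<open>auto simp: indicator_def split: if_splits\<close>)
    thus ?thesis by (subst AE_iff_null_sets) auto
  qed
  let ?A = "\<lambda>c n. {s \<in> {-real n..real n}. 0 < c * (g s - d)}"
  have "(\<Union>n. ?A 1 n \<union> ?A (-1) n) \<in> null_sets (\<mu> x)"
    by (intro null_sets_UN null_sets.Un null[of "?A 1" _ 1] null[of "?A (-1)" _ "-1"]) auto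
  moreover have "- {l} \<subseteq> (\<Union>n. ?A 1 n \<union> ?A (-1) n)"
  proof
    fix s assume "s \<in> - {l}"
    hence "g s \<noteq> d" using l by auto
    moreover obtain n where "\<bar>s\<bar> \<le> real n" using real_arch_simple by blast
    ultimately show "s \<in> (\<Union>n. ?A 1 n \<union> ?A (-1) n)" by (intro UN_I[of n]) (auto simp: abs_le_iff)
  qed
  ultimately have "- {l} \<in> null_sets (\<mu> x)" using null_sets_subset[of _ "\<mu> x" "- {l}"] by simp
  hence "P (- {l}) x = 0" using emeasure_pvm[of "- {l}" x] by (simp add: null_sets_def)
  hence x: "P {l} x = x" using disj_Un[of "{l}" "- {l}" x] by simp
  have "P E x = P E (P {l} x)" by (simp add: x)
  also have "\<dots> = P (E \<inter> {l}) x" using E by (simp add: Int)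
  finally show ?thesis using x by (cases "l \<in> E") auto
qed

text \<open>Testing the eigenvalue equation with z = P(E) x gives d ||P(E) x||^2 as the integral of
  s over E, which is the mean hypothesis of \<open>proj_concentrated\<close>.\<close>

lemma eigenvector_concentrated:
  assumes x: "(x, complex_of_real d *\<^sub>C x) \<in> spectral_integral P complex_of_real"
    and E: "E \<in> sets borel"
  shows "P E x = (if d \<in> E then x else 0)"
proof (rule proj_concentrated[where g = "\<lambda>s. s" and d = d])
  fix n and E :: "real set" assume E: "E \<in> sets borel" "E \<subseteq> {-real n..real n}"
  have dom: "x \<in> pvm_domain P complex_of_real" using x by (simp add: spectral_integral_def)
  hence i: "integrable (\<mu> x) complex_of_real" by (intro domain_integrable) auto
  hence ii: "integrable (\<mu> x) (\<lambda>s. indicator E s *\<^sub>R complex_of_real s)"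
    using E by (intro integrable_mult_indicator) auto
  have "P E x \<in> pvm_domain P complex_of_real"
    using E dom by (intro proj_in_domain integrable_mult_indicator)
      (auto simp: pvm_domain_def simp flip: of_real_power)
  hence "cinner (P E x) (complex_of_real d *\<^sub>C x) = pvm_integral2 P complex_of_real (P E x) x"
    using x by (simp add: spectral_integral_def)
  also have "\<dots> = (\<integral>s. indicator E s *\<^sub>R complex_of_real s \<partial>\<mu> x)"
    using pvm_integral2_proj[of UNIV E complex_of_real x] i E by simp
  finally have eq: "complex_of_real (d * (norm (P E x))\<^sup>2) = (\<integral>s. indicator E s *\<^sub>R complex_of_real s \<partial>\<mu> x)"
    using E by (simp add: cinner_scaleC_right self_adj flip: norm_sq)
  show "integrable (\<mu> x) (\<lambda>s. indicator E s * s)" using integrable_Re[OF ii] by simp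
  show "(\<integral>s. indicator E s * s \<partial>\<mu> x) = d * measure (\<mu> x) E"
    using arg_cong[OF eq, of Re] integral_Re[OF ii] E by (simp add: measure_pvm)
qed (use E in auto)

end

section \<open>Functional calculus of diagonal operators\<close>

context pvm
begin

context
  fixes f :: "nat \<Rightarrow> 'a" and l :: "nat \<Rightarrow> real"
  assumes f: "is_onb f"
    and Pf: "\<And>E i. E \<in> sets borel \<Longrightarrow> P E (f i) = (if l i \<in> E then f i else 0)"
begin

lemma cinner_proj_onb:
  "E \<in> sets borel \<Longrightarrow> cinner (f i) (P E x) = (if l i \<in> E then cinner (f i) x else 0)"
  by (simp add: Pf flip: self_adj)

text \<open>The weights |<f i, x>|^2 on the index set are pushed forward along l. Integrals against
  \<open>\<mu> x\<close> thereby become series over i, also when eigenvalues repeat.\<close>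

lemma pvm_measure_diag:
  "\<mu> x = distr (density (count_space UNIV) (\<lambda>i. ennreal ((cmod (cinner (f i) x))\<^sup>2))) borel l"
proof (rule measure_eqI)
  fix E assume "E \<in> sets (\<mu> x)"
  hence E: "E \<in> sets borel" by simp
  have "(\<lambda>i. (cmod (cinner (f i) x))\<^sup>2 * indicator E (l i)) sums (norm (P E x))\<^sup>2"
    using onb_parseval[OF f, of "P E x"]
    by (rule sums_cong[THEN iffD1, rotated]) (simp add: cinner_proj_onb E)
  hence "(\<Sum>i. ennreal ((cmod (cinner (f i) x))\<^sup>2 * indicator E (l i))) = ennreal ((norm (P E x))\<^sup>2)"
    by (intro suminf_ennreal_eq) simp
  also have "(\<Sum>i. ennreal ((cmod (cinner (f i) x))\<^sup>2 * indicator E (l i)))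
    = emeasure (density (count_space UNIV) (\<lambda>i. ennreal ((cmod (cinner (f i) x))\<^sup>2))) (l -` E)"
    by (subst emeasure_density)
      (auto simp: nn_integral_count_space_nat ennreal_mult' indicator_def intro!: suminf_cong)
  finally show "emeasure (\<mu> x) E =
    emeasure (distr (density (count_space UNIV) (\<lambda>i. ennreal ((cmod (cinner (f i) x))\<^sup>2))) borel l) E"
    using E by (simp add: emeasure_pvm emeasure_distr)
qed simp

lemma
  fixes g :: "real \<Rightarrow> 'b::{banach, second_countable_topology}"
  assumes g: "g \<in> borel_measurable borel"
  shows integrable_diag: "integrable (\<mu> x) g \<longleftrightarrow> summable (\<lambda>i. (cmod (cinner (f i) x))\<^sup>2 * norm (g (l i)))"
    and integral_diag: "integrable (\<mu> x) g \<Longrightarrow>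
      (\<lambda>i. (cmod (cinner (f i) x))\<^sup>2 *\<^sub>R g (l i)) sums integral\<^sup>L (\<mu> x) g"
proof -
  have i: "integrable (\<mu> x) g \<longleftrightarrow> integrable (count_space UNIV) (\<lambda>i. (cmod (cinner (f i) x))\<^sup>2 *\<^sub>R g (l i))"
    unfolding pvm_measure_diag using g by (simp add: integrable_distr_eq integrable_density)
  thus "integrable (\<mu> x) g \<longleftrightarrow> summable (\<lambda>i. (cmod (cinner (f i) x))\<^sup>2 * norm (g (l i)))"
    by (simp add: integrable_count_space_nat_iff)
  have "integral\<^sup>L (\<mu> x) g = integral\<^sup>L (count_space UNIV) (\<lambda>i. (cmod (cinner (f i) x))\<^sup>2 *\<^sub>R g (l i))"
    unfolding pvm_measure_diag using g by (simp add: integral_distr integral_density)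
  thus "integrable (\<mu> x) g \<Longrightarrow> (\<lambda>i. (cmod (cinner (f i) x))\<^sup>2 *\<^sub>R g (l i)) sums integral\<^sup>L (\<mu> x) g"
    using sums_integral_count_space_nat i by simp
qed

text \<open>Polarization applied term by term makes \<open>pvm_integral2\<close> the series of cnj
  <f i, z> g(l i) <f i, x>. Testing with z = f j reads off the coefficients of y; conversely the
  series is <z, y> by Parseval.\<close>

lemma spectral_integral_diag:
  assumes g: "g \<in> borel_measurable borel"
  shows "spectral_integral P g = diag_op f (\<lambda>i. g (l i))"
proof -
  have dom: "x \<in> pvm_domain P g \<longleftrightarrow> summable (\<lambda>i. (cmod (g (l i) * cinner (f i) x))\<^sup>2)" for x
    using g by (simp add: pvm_domain_def integrable_diag norm_mult power_mult_distrib mult.commute)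
  \<comment> \<open>\<open>pvm_integral2\<close> integrates over the measures of x + i^k z, so the
    domain has to be closed under such combinations.\<close>
  have int: "integrable (\<mu> (x + c *\<^sub>C z)) g" if "x \<in> pvm_domain P g" "z \<in> pvm_domain P g" for x z c
  proof (rule domain_integrable[OF g], unfold dom, rule summable_comparison_test')
    let ?a = "\<lambda>x i. (cmod (g (l i) * cinner (f i) x))\<^sup>2"
    show "summable (\<lambda>i. 2 * ?a x i + 2 * (cmod c)\<^sup>2 * ?a z i)"
      using that unfolding dom by (intro summable_add summable_mult)
    fix i
    let ?p = "g (l i) * cinner (f i) x" and ?q = "c * (g (l i) * cinner (f i) z)"
    have "(cmod (?p + ?q))\<^sup>2 \<le> (cmod ?p + cmod ?q)\<^sup>2"
      by (rule power_mono[OF norm_triangle_ineq]) simp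
    also have "\<dots> \<le> 2 * (cmod ?p)\<^sup>2 + 2 * (cmod ?q)\<^sup>2"
      using sum_squares_bound[of "cmod ?p" "cmod ?q"] by (simp add: power2_sum)
    finally show "norm (?a (x + c *\<^sub>C z) i) \<le> 2 * ?a x i + 2 * (cmod c)\<^sup>2 * ?a z i"
      by (simp add: cinner_add_right cinner_scaleC_right algebra_simps norm_mult power_mult_distrib)
  qed
  have B: "(\<lambda>i. cnj (cinner (f i) z) * (g (l i) * cinner (f i) x)) sums pvm_integral2 P g z x"
    if xz: "x \<in> pvm_domain P g" "z \<in> pvm_domain P g" for x z
  proof -
    have "(\<lambda>i. (\<Sum>k<4. \<i> ^ k * ((cmod (cinner (f i) (x + \<i> ^ k *\<^sub>C z)))\<^sup>2 *\<^sub>R g (l i))) / 4)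
      sums pvm_integral2 P g z x"
      unfolding pvm_integral2_def by (intro sums_divide sums_sum sums_mult integral_diag g int xz)
    moreover have "(\<Sum>k<4. \<i> ^ k * ((cmod (p + \<i> ^ k * q))\<^sup>2 *\<^sub>R r)) / 4 = cnj q * (r * p)" for p q r
    proof -
      have sq: "complex_of_real ((cmod (p + c * q))\<^sup>2) = (p + c * q) * (cnj p + cnj c * cnj q)" for c
        by (simp only: complex_norm_square complex_cnj_add complex_cnj_mult)
      show ?thesis unfolding scaleR_conv_of_real sq by (simp add: eval_nat_numeral algebra_simps)
    qed
    ultimately show ?thesis by (simp add: cinner_add_right cinner_scaleC_right)
  qed
  have fdom: "f j \<in> pvm_domain P g" for j
    unfolding dom by (rule summable_finite[of "{j}"]) (auto simp: onb_ortho[OF f])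
  show ?thesis
  proof (intro equalityI subsetI; clarify)
    fix x y assume xy: "(x, y) \<in> spectral_integral P g"
    hence x: "x \<in> pvm_domain P g" by (simp add: spectral_integral_def)
    have "cinner (f j) y = g (l j) * cinner (f j) x" for j
    proof -
      have "(\<lambda>i. if i = j then g (l i) * cinner (f i) x else 0) sums cinner (f j) y"
        using B[OF x fdom[of j]] xy fdom[of j]
        by (auto simp: spectral_integral_def onb_ortho[OF f] if_distrib[of cnj] if_distrib[of "\<lambda>c. c * _"]
            cong: if_cong)
      from sums_unique2[OF this sums_single] show ?thesis .
    qed
    thus "(x, y) \<in> diag_op f (\<lambda>i. g (l i))" using x by (simp add: diag_op_def dom)
  next
    fix x y assume xy: "(x, y) \<in> diag_op f (\<lambda>i. g (l i))"
    hence x: "x \<in> pvm_domain P g" by (simp add: diag_op_def dom)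
    have "cinner z y = pvm_integral2 P g z x" if z: "z \<in> pvm_domain P g" for z
      using onb_cinner[OF f, of z y] B[OF x z] xy by (auto simp: diag_op_def dest: sums_unique2)
    thus "(x, y) \<in> spectral_integral P g" using x by (simp add: spectral_integral_def)
  qed
qed

end

end

text \<open>Finite disjoint unions are additive coefficient by coefficient; the passage to countable
  unions is \<open>tendsto_diag\<close> with coefficients 0 and 1.\<close>

lemma diag_proj_valued_measure:
  fixes f :: "nat \<Rightarrow> 'a::separable_hilbert" and l :: "nat \<Rightarrow> real"
  assumes f: "is_onb f"
  shows "proj_valued_measure (\<lambda>E. diag f (\<lambda>i. if l i \<in> E then 1 else 0))"
proof -
  let ?P = "\<lambda>E. diag f (\<lambda>i. if l i \<in> E then 1 else 0)"
  have b: "cmod (if l i \<in> E then 1 else 0) \<le> 1" for i E by simp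
  have proj: "orth_projection (?P E)" for E
    unfolding orth_projection_def
    by (simp add: diag_bounded_ops[OF f b] diag_comp[OF f b b] cadj_diag[OF f b] if_distrib cong: if_cong)
  have "(\<lambda>i. ?P (E i) x) sums ?P (\<Union>i. E i) x" if disj: "disjoint_family E" for E :: "nat \<Rightarrow> real set" and x
  proof -
    have ind: "(\<Sum>i<k. if s \<in> E i then 1 else 0) = (if s \<in> (\<Union>i<k. E i) then 1 else 0 :: complex)" for k s
    proof (induction k)
      case (Suc k)
      have "s \<notin> (\<Union>i<k. E i)" if "s \<in> E k"
        using disj that unfolding disjoint_family_on_def by (auto, metis disjoint_iff less_irrefl UNIV_I)
      thus ?case using Suc by (auto simp: lessThan_Suc)
    qed simp
    have "(\<Sum>i<k. ?P (E i) x) = ?P (\<Union>i<k. E i) x" for k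
    proof (rule onb_eqI[OF f])
      fix n
      have "cinner (f n) (\<Sum>i<k. ?P (E i) x) = (\<Sum>i<k. if l n \<in> E i then 1 else 0) * cinner (f n) x"
        by (simp add: cinner_sum_right cinner_diag_bounded[OF f b] sum_distrib_right)
      thus "cinner (f n) (\<Sum>i<k. ?P (E i) x) = cinner (f n) (?P (\<Union>i<k. E i) x)"
        unfolding ind cinner_diag_bounded[OF f b] .
    qed
    moreover have "(\<lambda>k. ?P (\<Union>i<k. E i) x) \<longlonglongrightarrow> ?P (\<Union>i. E i) x"
    proof (rule tendsto_diag[OF f b b])
      fix n
      show "(\<lambda>k. if l n \<in> (\<Union>i<k. E i) then 1 else 0) \<longlonglongrightarrow> (if l n \<in> (\<Union>i. E i) then 1 else 0 :: complex)"
      proof (cases "l n \<in> (\<Union>i. E i)")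
        case True
        then obtain i where i: "l n \<in> E i" by blast
        have "\<forall>\<^sub>F k in sequentially. (if l n \<in> (\<Union>i<k. E i) then 1 else 0) = (1 :: complex)"
          using eventually_gt_at_top[of i] by eventually_elim (use i in auto)
        thus ?thesis using True by (simp add: tendsto_eventually)
      qed auto
    qed simp
    ultimately show ?thesis unfolding sums_def by simp
  qed
  thus ?thesis by (auto simp: proj_valued_measure_def proj diag_one[OF f])
qed

text \<open>The union in \<open>functional_calculus\<close> has a single value: each f i is an
  eigenvector, which fixes P(E) f i for every spectral measure P of the operator. The diagonal
  measure shows that the union is not empty.\<close>

lemma functional_calculus_diag_op:
  fixes f :: "nat \<Rightarrow> 'a::separable_hilbert" and l :: "nat \<Rightarrow> real"
  assumes f: "is_onb f" and g: "g \<in> borel_measurable borel"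
  shows "functional_calculus g (diag_op f (\<lambda>i. complex_of_real (l i))) = diag_op f (\<lambda>i. g (l i))"
proof -
  let ?h = "diag_op f (\<lambda>i. complex_of_real (l i))"
  have "spectral_integral P g = diag_op f (\<lambda>i. g (l i))" if P: "spectral_measure_of ?h P" for P
  proof -
    interpret pvm P by standard (use P in \<open>simp add: spectral_measure_of_def\<close>)
    have "P E (f i) = (if l i \<in> E then f i else 0)" if "E \<in> sets borel" for E i
      using P diag_op_onb[OF f, of i "\<lambda>i. complex_of_real (l i)"] that
      by (intro eigenvector_concentrated) (simp_all add: spectral_measure_of_def)
    thus ?thesis by (rule spectral_integral_diag[OF f _ g])
  qed
  moreover have "spectral_measure_of ?h (\<lambda>E. diag f (\<lambda>i. if l i \<in> E then 1 else 0))" (is "spectral_measure_of _ ?P")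
  proof -
    interpret pvm ?P by standard (rule diag_proj_valued_measure[OF f])
    have "?P E (f i) = (if l i \<in> E then f i else 0)" for E i
      by (subst diag_onb[OF f, where K = 1]) auto
    hence "spectral_integral ?P complex_of_real = ?h" by (intro spectral_integral_diag f) auto
    thus ?thesis using pvm by (simp add: spectral_measure_of_def)
  qed
  ultimately show ?thesis unfolding functional_calculus_def by blast
qed

section \<open>The spectrum of \<open>-2 log |T|\<close>\<close>

lemma id_bounded_ops: "id \<in> bounded_ops"
  by (rule bounded_opsI[where K = 1]) auto

lemma cadj_id [simp]: "cadj id = id"
  by (rule cadj_eqI) simp

lemma hs_op_vee_id: "A \<in> bounded_ops \<Longrightarrow> hs_op ((A \<or>\<^sub>H id) X) x = A (hs_op X x)"
  by (simp add: hs_op_vee id_bounded_ops)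

lemma bounded_linear_hs_op: "bounded_linear (\<lambda>X. hs_op X x)"
  by (rule bounded_linear_intro[where K = "norm x"]) (auto simp: hs_op_norm_le)

text \<open>Evaluation at x is continuous in the Hilbert-Schmidt norm, so if \<Omega> x = 0 then
  every operator in the closure of all A \<Omega> annihilates x. By cyclicity this includes
  \<open>x \<otimes>\<^sub>H x\<close>, which sends x to ||x||^2 x.\<close>

lemma cyclic_injective:
  fixes \<Omega> :: "'a::separable_hilbert hs"
  assumes cyc: "cyclic_vector A_left \<Omega>" and x: "hs_op \<Omega> x = 0"
  shows "x = 0"
proof -
  have "closed {Y::'a hs. hs_op Y x = 0}"
    by (intro closed_Collect_eq linear_continuous_on bounded_linear_hs_op continuous_on_const)
  moreover have "(\<lambda>X. X \<Omega>) ` A_left \<subseteq> {Y. hs_op Y x = 0}"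
    using x by (auto simp: A_left_def hilbert_schmidt_def hs_op_vee_id bounded_opsD(3))
  ultimately have "closure ((\<lambda>X. X \<Omega>) ` A_left) \<subseteq> {Y. hs_op Y x = 0}" by (intro closure_minimal)
  hence "hs_op (x \<otimes>\<^sub>H x) x = 0" using cyc by (auto simp: cyclic_vector_def)
  thus ?thesis using norm_scaleC[of "cinner x x" x] by (auto simp: hs_op_tensor cinner_self)
qed

text \<open>The coefficient <e_j, X e_k> is continuous in X for the Hilbert-Schmidt norm and picks a
  k j out of the double series, since \<open>e \<otimes>\<^sub>H f\<close> sends a unit vector e to
  f. T has the same coefficient by its defining expansion.\<close>

lemma associated_operator_eq:
  fixes \<Omega> T :: "'a::separable_hilbert hs"
  assumes "associated_operator \<Omega> T"
  shows "T = \<Omega>"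
proof -
  obtain a where a: "((\<lambda>(m, n). a m n *\<^sub>C (ebasis m \<otimes>\<^sub>H ebasis n)) has_sum \<Omega>) UNIV"
    "\<And>m. (\<lambda>n. a m n *\<^sub>C ebasis n) sums hs_op T (ebasis m)"
    using assms unfolding associated_operator_def by blast
  have "hs_op T (ebasis k) = hs_op \<Omega> (ebasis k)" for k
  proof (rule onb_eqI[OF is_onb_ebasis])
    fix j
    let ?t = "\<lambda>(m, n). a m n *\<^sub>C (ebasis m \<otimes>\<^sub>H ebasis n) :: 'a hs"
    have "(\<lambda>n. cinner (ebasis j :: 'a) (a k n *\<^sub>C ebasis n)) sums cinner (ebasis j) (hs_op T (ebasis k))"
      using bounded_linear.sums[OF bounded_linear_cinner_right a(2)] .
    moreover have "(\<lambda>n. cinner (ebasis j :: 'a) (a k n *\<^sub>C ebasis n)) = (\<lambda>n. if n = j then a k n else 0)"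
      by (auto simp: cinner_scaleC_right ebasis_orthonormal)
    ultimately have T: "cinner (ebasis j) (hs_op T (ebasis k)) = a k j"
      using sums_single[of j "a k"] by (simp add: sums_unique2)
    have "((\<lambda>p. cinner (ebasis j) (hs_op (?t p) (ebasis k))) has_sum cinner (ebasis j) (hs_op \<Omega> (ebasis k))) UNIV"
      using has_sum_bounded_linear[OF bounded_linear_compose[OF bounded_linear_cinner_right[of "ebasis j"]
            bounded_linear_hs_op[of "ebasis k"]] a(1)]
      by simp
    moreover have "((\<lambda>p. cinner (ebasis j) (hs_op (?t p) (ebasis k))) has_sum a k j) UNIV"
      by (rule has_sum_finite_neutralI[of "{(k, j)}"])
        (auto simp: hs_op_tensor cinner_scaleC_right ebasis_orthonormal split: if_splits)
    ultimately show "cinner (ebasis j) (hs_op T (ebasis k)) = cinner (ebasis j) (hs_op \<Omega> (ebasis k))"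
      unfolding T by (rule has_sum_unique[symmetric])
  qed
  hence "(\<lambda>n. (norm (hs_op (T - \<Omega>) (ebasis n)))\<^sup>2) = (\<lambda>n. 0)" by simp
  hence "norm (T - \<Omega>) = 0" using hs_norm_sums[of "T - \<Omega>"] by (simp add: sums_iff)
  thus ?thesis by simp
qed

text \<open>The factor 2 absorbs the square root in ln (sqrt \<sigma>), so exp(-ev) is the
  eigenvalue \<sigma> of T*T itself. Summability makes \<sigma> tend to 0 from above, which is the
  divergence of ev.\<close>

lemma op_log_op_abs_spectrum:
  fixes T :: "'a::separable_hilbert hs"
  assumes inj: "\<And>x. hs_op T x = 0 \<Longrightarrow> x = 0"
  obtains f :: "nat \<Rightarrow> 'a" and ev :: "nat \<Rightarrow> real" where "is_onb f"
    "\<And>i. (f i, complex_of_real (ev i) *\<^sub>C f i) \<in> op_scale (-2) (op_log (op_abs (hs_op T)))"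
    "filterlim ev at_top sequentially" "(\<lambda>i. exp (- ev i)) sums (norm T)\<^sup>2"
proof -
  obtain f :: "nat \<Rightarrow> 'a" and \<sigma> where f: "is_onb f" and \<sigma>: "\<And>n. \<sigma> n > 0"
    "\<And>n. cadj (hs_op T) (hs_op T (f n)) = complex_of_real (\<sigma> n) *\<^sub>C f n" "\<sigma> sums (norm T)\<^sup>2"
    using hs_eigenbasis[OF inj] by metis
  have \<sigma>0: "\<sigma> \<longlonglongrightarrow> 0" using \<sigma>(3) by (intro summable_LIMSEQ_zero) (auto simp: sums_iff)
  hence "bounded (range \<sigma>)" by (intro convergent_imp_bounded) (auto simp: convergent_def)
  then obtain K where K: "\<And>n. cmod (complex_of_real (\<sigma> n)) \<le> K"
    by (auto simp: bounded_iff)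
  have "cadj (hs_op T) \<circ> hs_op T = diag f (\<lambda>n. complex_of_real (\<sigma> n))"
    by (rule diag_eqI[OF f K]) (simp_all add: bounded_ops_comp cadj_bounded \<sigma>(2))
  hence TT: "graph_of (cadj (hs_op T) \<circ> hs_op T) = diag_op f (\<lambda>n. complex_of_real (\<sigma> n))"
    by (simp add: diag_op_bounded[OF f K])
  have "op_log (op_abs (hs_op T)) = diag_op f (\<lambda>n. complex_of_real (ln (sqrt (\<sigma> n))))"
    unfolding op_log_def op_abs_def TT
    by (subst functional_calculus_diag_op[OF f], simp) (subst functional_calculus_diag_op[OF f], simp_all)
  hence "(f i, complex_of_real (ln (sqrt (\<sigma> i))) *\<^sub>C f i) \<in> op_log (op_abs (hs_op T))" for i
    using diag_op_onb[OF f, of i "\<lambda>n. complex_of_real (ln (sqrt (\<sigma> n)))"] by simp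
  hence "(f i, (-2) *\<^sub>C complex_of_real (ln (sqrt (\<sigma> i))) *\<^sub>C f i) \<in> op_scale (-2) (op_log (op_abs (hs_op T)))" for i
    unfolding op_scale_def by blast
  moreover have "(-2) *\<^sub>C complex_of_real (ln (sqrt (\<sigma> i))) *\<^sub>C f i = complex_of_real (- ln (\<sigma> i)) *\<^sub>C f i" for i
    using \<sigma>(1)[of i] by (simp add: scaleC_scaleC ln_sqrt)
  moreover have "filterlim (\<lambda>i. - ln (\<sigma> i)) at_top sequentially"
    using \<sigma>0 \<sigma>(1)
    by (subst filterlim_uminus_at_top, simp, intro filterlim_compose[OF ln_at_0])
      (auto simp: filterlim_at less_imp_neq[symmetric] intro!: always_eventually)
  moreover have "(\<lambda>i. exp (- (- ln (\<sigma> i)))) sums (norm T)\<^sup>2" using \<sigma> by simp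
  ultimately show ?thesis using that[OF f, of "\<lambda>i. - ln (\<sigma> i)"] by simp
qed

section \<open>Operators with Hilbert-Schmidt exponential\<close>

lemma scaleC_minus_left: "(- c) *\<^sub>C x = - (c *\<^sub>C (x::'a::complex_hilbert))"
  by (metis scaleC_minus_one scaleC_scaleC mult_minus1)

lemma bounded_bilinear_cinner: "bounded_bilinear (cinner :: 'a::complex_hilbert \<Rightarrow> _)"
  unfolding bounded_bilinear_def
  by (auto simp: cinner_add_left cinner_add_right scaleR_scaleC cinner_scaleC_left cinner_scaleC_right
      scaleR_conv_of_real intro!: exI[of _ 1] cmod_cinner_le)

lemmas tendsto_cinner = bounded_bilinear.tendsto[OF bounded_bilinear_cinner]

section \<open>Spectral integrals of bounded and locally bounded functions\<close>

context pvm
begin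

text \<open>The integral over \<open>\<mu> u\<close> is a combination of the squares ||P(E j) u||^2,
  so \<open>polarization\<close> applies to P(E j) x and P(E j) z for each j.\<close>

lemma pvm_integral2_simple:
  assumes J: "finite J" "\<And>j. j \<in> J \<Longrightarrow> E j \<in> sets borel"
  shows "pvm_integral2 P (\<lambda>s. complex_of_real (\<Sum>j\<in>J. c j * indicator (E j) s)) z x
    = cinner z (\<Sum>j\<in>J. complex_of_real (c j) *\<^sub>C P (E j) x)"
proof -
  have "integral\<^sup>L (\<mu> u) (\<lambda>s. complex_of_real (\<Sum>j\<in>J. c j * indicator (E j) s))
    = (\<Sum>j\<in>J. complex_of_real (c j) * complex_of_real ((norm (P (E j) u))\<^sup>2))" for u
  proof -
    have "(\<integral>s. (\<Sum>j\<in>J. c j * indicator (E j) s) \<partial>\<mu> u) = (\<Sum>j\<in>J. \<integral>s. c j * indicator (E j) s \<partial>\<mu> u)"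
      using J by (intro Bochner_Integration.integral_sum)
        (auto simp: finite_measure.emeasure_finite less_top[symmetric])
    also have "\<dots> = (\<Sum>j\<in>J. c j * (norm (P (E j) u))\<^sup>2)"
      using J by (intro sum.cong) (auto simp: measure_pvm)
    finally show ?thesis unfolding integral_complex_of_real by simp
  qed
  hence "pvm_integral2 P (\<lambda>s. complex_of_real (\<Sum>j\<in>J. c j * indicator (E j) s)) z x
    = (\<Sum>k<4. \<Sum>j\<in>J. \<i> ^ k * (complex_of_real (c j) * complex_of_real ((norm (P (E j) (x + \<i> ^ k *\<^sub>C z)))\<^sup>2))) / 4"
    by (simp only: pvm_integral2_def sum_distrib_left)
  also have "\<dots> = (\<Sum>j\<in>J. complex_of_real (c j) *
      ((\<Sum>k<4. \<i> ^ k * complex_of_real ((norm (P (E j) x + \<i> ^ k *\<^sub>C P (E j) z))\<^sup>2)) / 4))"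
    using J by (subst sum.swap)
      (simp add: sum_divide_distrib sum_distrib_left bounded_opsD[OF bounded] mult_ac)
  also have "\<dots> = (\<Sum>j\<in>J. complex_of_real (c j) * cinner z (P (E j) x))"
    unfolding polarization using J by (intro sum.cong) (simp_all add: self_adj idem)
  finally show ?thesis by (simp add: cinner_sum_right cinner_scaleC_right)
qed

text \<open>\<open>\<mu> u\<close> has total mass ||u||^2, and ||x + i^k z|| <= ||x|| + ||z||. What
  matters is uniformity over unit vectors z: uniform convergence of integrands then becomes norm
  convergence of the vectors that represent the integrals.\<close>

lemma pvm_integral2_bound:
  assumes g: "g \<in> borel_measurable borel" and C: "\<And>s. cmod (g s) \<le> C"
  shows "cmod (pvm_integral2 P g z x) \<le> C * (norm x + norm z)\<^sup>2"
proof -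
  have C0: "0 \<le> C" using C[of 0] norm_ge_zero order_trans by blast
  have I: "cmod (integral\<^sup>L (\<mu> u) g) \<le> C * (norm u)\<^sup>2" for u
  proof -
    have "cmod (integral\<^sup>L (\<mu> u) g) \<le> (\<integral>s. cmod (g s) \<partial>\<mu> u)" by (rule integral_norm_bound)
    also have "\<dots> \<le> (\<integral>s. C \<partial>\<mu> u)"
      using g C by (intro integral_mono integrable_bounded[where C = C]) (auto simp: C0)
    also have "\<dots> = C * (norm u)\<^sup>2" using measure_pvm[of UNIV u] by simp
    finally show ?thesis .
  qed
  have "cmod (pvm_integral2 P g z x) \<le> (\<Sum>k<4. cmod (\<i> ^ k * integral\<^sup>L (\<mu> (x + \<i> ^ k *\<^sub>C z)) g)) / 4"
    unfolding pvm_integral2_def norm_divide by (simp add: norm_sum divide_right_mono)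
  also have "\<dots> \<le> (\<Sum>k<4::nat. C * (norm x + norm z)\<^sup>2) / 4"
  proof (intro divide_right_mono sum_mono)
    fix k :: nat
    have "cmod (\<i> ^ k * integral\<^sup>L (\<mu> (x + \<i> ^ k *\<^sub>C z)) g) \<le> C * (norm (x + \<i> ^ k *\<^sub>C z))\<^sup>2"
      using I by (simp add: norm_mult norm_power)
    also have "\<dots> \<le> C * (norm x + norm z)\<^sup>2"
      using norm_triangle_ineq[of x "\<i> ^ k *\<^sub>C z"]
      by (intro mult_left_mono power_mono C0) (auto simp: norm_scaleC norm_power)
    finally show "cmod (\<i> ^ k * integral\<^sup>L (\<mu> (x + \<i> ^ k *\<^sub>C z)) g) \<le> C * (norm x + norm z)\<^sup>2" .
  qed simp
  finally show ?thesis by simp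
qed

lemma pvm_integral2_diff:
  assumes "g \<in> borel_measurable borel" "\<And>s. cmod (g s) \<le> C"
    and "h \<in> borel_measurable borel" "\<And>s. cmod (h s) \<le> D"
  shows "pvm_integral2 P (\<lambda>s. g s - h s) z x = pvm_integral2 P g z x - pvm_integral2 P h z x"
proof -
  have "integral\<^sup>L (\<mu> u) (\<lambda>s. g s - h s) = integral\<^sup>L (\<mu> u) g - integral\<^sup>L (\<mu> u) h" for u
    by (intro Bochner_Integration.integral_diff integrable_bounded[OF assms(1,2)] integrable_bounded[OF assms(3,4)])
  thus ?thesis
    by (simp add: pvm_integral2_def right_diff_distrib sum_subtractf diff_divide_distrib)
qed

text \<open>\<open>g\<close> is a uniform limit of simple functions, for which \<open>\<integral> g dP\<close> is a finite sum.\<close>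

lemma bounded_spectral_integral:
  fixes g :: "real \<Rightarrow> real"
  assumes g [measurable]: "g \<in> borel_measurable borel" and C: "\<And>s. 0 \<le> g s" "\<And>s. g s \<le> C"
  obtains y where "\<And>z. cinner z y = pvm_integral2 P (\<lambda>s. complex_of_real (g s)) z x"
proof -
  let ?r = "\<lambda>k. real (Suc k)"
  \<comment> \<open>g rounded down to multiples of 1/(k+1): the error is at most 1/(k+1), and 0 <= g
    <= C leaves finitely many values.\<close>
  define gk where "gk k s = real_of_int \<lfloor>?r k * g s\<rfloor> / ?r k" for k s
  have gk_meas [measurable]: "gk k \<in> borel_measurable borel" for k unfolding gk_def by measurable
  have gk_le: "gk k s \<le> g s" and gk_ge: "g s - 1 / ?r k \<le> gk k s" and gk0: "0 \<le> gk k s" for k s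
  proof -
    have "real_of_int \<lfloor>?r k * g s\<rfloor> \<le> ?r k * g s" "?r k * g s - 1 \<le> real_of_int \<lfloor>?r k * g s\<rfloor>"
      by linarith+
    hence "gk k s \<le> ?r k * g s / ?r k" "(?r k * g s - 1) / ?r k \<le> gk k s"
      unfolding gk_def by (intro divide_right_mono; simp)+
    thus "gk k s \<le> g s" "g s - 1 / ?r k \<le> gk k s"
      by (simp_all add: diff_divide_distrib del: of_nat_Suc)
    show "0 \<le> gk k s" using C by (simp add: gk_def)
  qed
  have bg: "cmod (complex_of_real (g s)) \<le> C" "cmod (complex_of_real (gk k s)) \<le> C" for k s
    using C[of s] gk0[of k s] gk_le[of k s] by auto
  let ?J = "\<lambda>k. {0..\<lceil>?r k * C\<rceil>}" and ?E = "\<lambda>k j. {s. \<lfloor>?r k * g s\<rfloor> = j}"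
  have gk_sum: "gk k s = (\<Sum>j\<in>?J k. (real_of_int j / ?r k) * indicator (?E k j) s)" for k s
  proof -
    have "?r k * g s \<le> ?r k * C" "0 \<le> ?r k * g s" using C by (auto intro: mult_left_mono)
    hence "\<lfloor>?r k * g s\<rfloor> \<le> \<lceil>?r k * C\<rceil>" "0 \<le> \<lfloor>?r k * g s\<rfloor>" by linarith+
    hence "\<lfloor>?r k * g s\<rfloor> \<in> ?J k" by simp
    moreover have "(\<Sum>j\<in>?J k. (real_of_int j / ?r k) * indicator (?E k j) s)
      = (\<Sum>j\<in>?J k. if j = \<lfloor>?r k * g s\<rfloor> then real_of_int j / ?r k else 0)"
      by (rule sum.cong) (auto simp: indicator_def)
    ultimately show ?thesis by (simp add: gk_def)
  qed
  define y where "y k = (\<Sum>j\<in>?J k. complex_of_real (real_of_int j / ?r k) *\<^sub>C P (?E k j) x)" for k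
  have y: "cinner z (y k) = pvm_integral2 P (\<lambda>s. complex_of_real (gk k s)) z x" for z k
    unfolding gk_sum y_def by (rule pvm_integral2_simple[symmetric]) auto
  have diff: "norm (y m - y n) \<le> (2 / ?r N) * (norm x + 1)\<^sup>2" if N: "N \<le> m" "N \<le> n" for m n N
  proof (cases "y m = y n")
    case False
    let ?w = "y m - y n"
    \<comment> \<open>The unit vector in the direction of the difference, for which the pairing
      attains the norm.\<close>
    let ?z = "complex_of_real (inverse (norm ?w)) *\<^sub>C ?w"
    have z1: "norm ?z = 1" using False by (simp add: norm_scaleC norm_inverse del: of_real_inverse)
    have "norm ?w = cmod (cinner ?z ?w)"
      using False by (simp add: cinner_scaleC_left cinner_self norm_mult norm_inverse norm_power power2_eq_square
          del: of_real_inverse)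
    also have "cinner ?z ?w = pvm_integral2 P (\<lambda>s. complex_of_real (gk m s) - complex_of_real (gk n s)) ?z x"
      unfolding cinner_diff_right y by (rule pvm_integral2_diff[symmetric, OF _ bg(2) _ bg(2)]) auto
    also have "cmod \<dots> \<le> (2 / ?r N) * (norm x + norm ?z)\<^sup>2"
    proof (rule pvm_integral2_bound)
      fix s
      have "1 / ?r m \<le> 1 / ?r N" "1 / ?r n \<le> 1 / ?r N" using N by (auto simp: frac_le)
      hence "\<bar>gk m s - gk n s\<bar> \<le> 2 / ?r N"
        using gk_le[of m s] gk_le[of n s] gk_ge[of s m] gk_ge[of s n] by (simp add: abs_le_iff del: of_nat_Suc)
      thus "cmod (complex_of_real (gk m s) - complex_of_real (gk n s)) \<le> 2 / ?r N"
        by (simp flip: of_real_diff del: of_nat_Suc)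
    qed auto
    finally show ?thesis unfolding z1 .
  qed simp
  have lim0: "(\<lambda>N. c / ?r N) \<longlonglongrightarrow> 0" for c
    using tendsto_mult[OF tendsto_const LIMSEQ_inverse_real_of_nat, of c] by (simp add: divide_inverse)
  have "Cauchy y"
  proof (rule metric_CauchyI)
    fix e :: real assume e: "e > 0"
    obtain N where N: "2 * (norm x + 1)\<^sup>2 / ?r N < e"
      using LIMSEQ_D[OF lim0[of "2 * (norm x + 1)\<^sup>2"] e] by fastforce
    show "\<exists>M. \<forall>m\<ge>M. \<forall>n\<ge>M. dist (y m) (y n) < e"
      using diff[of N] N unfolding dist_norm by (auto intro!: exI[of _ N] intro: le_less_trans)
  qed
  then obtain y' where y': "y \<longlonglongrightarrow> y'" using Cauchy_convergent convergent_def by blast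
  have "cinner z y' = pvm_integral2 P (\<lambda>s. complex_of_real (g s)) z x" for z
  proof (rule LIMSEQ_unique)
    show "(\<lambda>k. cinner z (y k)) \<longlonglongrightarrow> cinner z y'" by (intro tendsto_cinner tendsto_const y')
    have bnd: "cmod (cinner z (y k) - pvm_integral2 P (\<lambda>s. complex_of_real (g s)) z x) \<le> (1 / ?r k) * (norm x + norm z)\<^sup>2" for k
    proof -
      have "cinner z (y k) - pvm_integral2 P (\<lambda>s. complex_of_real (g s)) z x
        = pvm_integral2 P (\<lambda>s. complex_of_real (gk k s) - complex_of_real (g s)) z x"
        unfolding y by (rule pvm_integral2_diff[symmetric, OF _ bg(2) _ bg(1)]) auto
      also have "cmod \<dots> \<le> (1 / ?r k) * (norm x + norm z)\<^sup>2"
      proof (rule pvm_integral2_bound)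
        show "cmod (complex_of_real (gk k s) - complex_of_real (g s)) \<le> 1 / ?r k" for s
          using gk_le[of k s] gk_ge[of s k] by (simp flip: of_real_diff del: of_nat_Suc)
      qed auto
      finally show ?thesis .
    qed
    have lim: "(\<lambda>k. (1 / ?r k) * (norm x + norm z)\<^sup>2) \<longlonglongrightarrow> 0"
      using lim0[of "(norm x + norm z)\<^sup>2"] by simp
    have "(\<lambda>k. cinner z (y k) - pvm_integral2 P (\<lambda>s. complex_of_real (g s)) z x) \<longlonglongrightarrow> 0"
      by (rule Lim_null_comparison[OF always_eventually[OF allI[OF bnd]] lim])
    thus "(\<lambda>k. cinner z (y k)) \<longlonglongrightarrow> pvm_integral2 P (\<lambda>s. complex_of_real (g s)) z x"
      by (simp add: LIM_zero_iff)
  qed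
  thus ?thesis using that by blast
qed

text \<open>Off E the function g may be unbounded, and test vectors z reach there. But P(-E) (P(E) x
  + c z) = c P(-E) z, so the part of the integral off E is the same for all phases c = i^k and drops
  out of the polarization sum, because the four powers add up to 0. What remains is the bounded
  function 1_E g.\<close>

lemma local_spectral_integral:
  fixes g :: "real \<Rightarrow> real"
  assumes g [measurable]: "g \<in> borel_measurable borel" and E [measurable]: "E \<in> sets borel"
    and C: "\<And>s. s \<in> E \<Longrightarrow> 0 \<le> g s" "\<And>s. s \<in> E \<Longrightarrow> g s \<le> C" "0 \<le> C"
  shows "\<exists>y. (P E x, y) \<in> spectral_integral P (\<lambda>s. complex_of_real (g s))"
proof -
  let ?f = "\<lambda>s. complex_of_real (g s)" and ?x = "P E x"
  have bE: "cmod (indicator E s *\<^sub>R ?f s) \<le> C" for s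
    using C by (auto simp: indicator_def)
  have dom: "?x \<in> pvm_domain P ?f"
  proof (rule proj_in_domain)
    show "integrable (\<mu> x) (\<lambda>s. indicator E s *\<^sub>R complex_of_real ((cmod (?f s))\<^sup>2))"
      using C by (intro integrable_bounded[where C = "C\<^sup>2"])
        (auto simp: indicator_def norm_power intro!: power_mono)
  qed auto
  obtain y where y: "\<And>z. cinner z y = pvm_integral2 P (\<lambda>s. complex_of_real (indicator E s * g s)) z ?x"
    by (rule bounded_spectral_integral[of "\<lambda>s. indicator E s * g s" C ?x])
      (use C in \<open>auto simp: indicator_def\<close>)
  have "cinner z y = pvm_integral2 P ?f z ?x" if z: "z \<in> pvm_domain P ?f" for z
  proof -
    have zi: "integrable (\<mu> z) (\<lambda>s. indicator (- E) s *\<^sub>R ?f s)"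
      by (intro integrable_mult_indicator domain_integrable z) auto
    have I: "integral\<^sup>L (\<mu> (?x + c *\<^sub>C z)) ?f = integral\<^sup>L (\<mu> (?x + c *\<^sub>C z)) (\<lambda>s. complex_of_real (indicator E s * g s))
        + (\<integral>s. indicator (- E) s *\<^sub>R ?f s \<partial>\<mu> z)" if c: "cmod c = 1" for c
    proof -
      let ?u = "?x + c *\<^sub>C z"
      have u: "P (- E) ?u = c *\<^sub>C P (- E) z"
        by (simp add: bounded_opsD[OF bounded] disj_comp)
      have "integrable (\<mu> (c *\<^sub>C P (- E) z)) ?f"
        using zi by (simp add: integrable_phase c integrable_proj)
      hence i2: "integrable (\<mu> ?u) (\<lambda>s. indicator (- E) s *\<^sub>R ?f s)"
        by (subst integrable_proj[symmetric]) (simp_all add: u)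
      have i1: "integrable (\<mu> ?u) (\<lambda>s. indicator E s *\<^sub>R ?f s)"
        by (rule integrable_bounded[OF _ bE]) auto
      have "integral\<^sup>L (\<mu> ?u) ?f = (\<integral>s. indicator E s *\<^sub>R ?f s + indicator (- E) s *\<^sub>R ?f s \<partial>\<mu> ?u)"
        by (intro Bochner_Integration.integral_cong) (auto simp: indicator_def)
      also have "\<dots> = (\<integral>s. indicator E s *\<^sub>R ?f s \<partial>\<mu> ?u) + (\<integral>s. indicator (- E) s *\<^sub>R ?f s \<partial>\<mu> ?u)"
        by (rule Bochner_Integration.integral_add[OF i1 i2])
      also have "(\<integral>s. indicator (- E) s *\<^sub>R ?f s \<partial>\<mu> ?u) = integral\<^sup>L (\<mu> (c *\<^sub>C P (- E) z)) ?f"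
        by (subst integral_proj[symmetric]) (simp_all add: u)
      also have "\<dots> = (\<integral>s. indicator (- E) s *\<^sub>R ?f s \<partial>\<mu> z)"
        by (subst integral_phase, simp, rule c, rule integral_proj) simp_all
      finally show ?thesis by (simp add: scaleR_conv_of_real)
    qed
    have "(\<Sum>k<4. \<i> ^ k * (a k + b)) = (\<Sum>k<4. \<i> ^ k * a k)" for a :: "nat \<Rightarrow> complex" and b
      by (simp add: eval_nat_numeral algebra_simps)
    moreover have "cmod (\<i> ^ k) = 1" for k by (simp add: norm_power)
    ultimately show ?thesis unfolding y pvm_integral2_def by (simp only: I)
  qed
  thus ?thesis using dom by (auto simp: spectral_integral_def)
qed

lemma proj_exhaust: "(\<lambda>n. P {-real n..real n} x) \<longlonglongrightarrow> x"
proof -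
  let ?B = "\<lambda>n. {-real n..real n}"
  have "(\<lambda>n. measure (\<mu> x) (?B n)) \<longlonglongrightarrow> measure (\<mu> x) (\<Union>n. ?B n)"
    by (rule finite_measure.finite_Lim_measure_incseq) (auto simp: incseq_def)
  moreover have "(\<Union>n. ?B n) = UNIV"
    by (auto simp: abs_le_iff[symmetric]) (metis abs_le_iff minus_le_iff real_arch_simple)
  ultimately have lim: "(\<lambda>n. (norm (P (?B n) x))\<^sup>2) \<longlonglongrightarrow> (norm x)\<^sup>2" by (simp add: measure_pvm)
  have "(norm (x - P (?B n) x))\<^sup>2 = (norm x)\<^sup>2 - (norm (P (?B n) x))\<^sup>2" for n
    by (simp add: norm_diff_sq norm_sq_Re)
  hence "(\<lambda>n. (norm (x - P (?B n) x))\<^sup>2) \<longlonglongrightarrow> (norm x)\<^sup>2 - (norm x)\<^sup>2"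
    using tendsto_diff[OF tendsto_const lim, of "(norm x)\<^sup>2"] by simp
  from tendsto_real_sqrt[OF this] have "(\<lambda>n. norm (P (?B n) x - x)) \<longlonglongrightarrow> 0"
    by (simp add: norm_minus_commute)
  thus ?thesis by (simp add: tendsto_norm_zero_iff LIM_zero_iff)
qed

end

section \<open>Diagonalisation of h through its exponential\<close>

lemma symmetric_of_real_quadratic_form:
  fixes S :: "'a::complex_hilbert \<Rightarrow> 'a"
  assumes S: "S \<in> bounded_ops" and real: "\<And>x. Im (cinner x (S x)) = 0"
  shows "cinner (S z) x = cinner z (S x)"
proof -
  have "Im (cinner z (S x) + cinner x (S z)) = 0"
    using real[of "x + z"] real[of x] real[of z]
    by (simp add: bounded_opsD[OF S] cinner_add_left cinner_add_right)
  moreover have "Im (\<i> * cinner x (S z) - \<i> * cinner z (S x)) = 0"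
    using real[of "x + \<i> *\<^sub>C z"] real[of x] real[of z]
    by (simp add: bounded_opsD[OF S] cinner_add_left cinner_add_right cinner_scaleC_left cinner_scaleC_right)
  ultimately have "cinner z (S x) = cnj (cinner x (S z))" by (simp add: complex_eq_iff)
  thus ?thesis by (simp add: cinner_commute[of "S z"])
qed

text \<open>\<open>S\<close> is positive and injective since \<open>\<langle>x, S x\<rangle> = \<integral> exp (- s / 2) d\<mu> x\<close>, so it has an eigenbasis;
  each eigenvector sits on a single point of the spectral measure.\<close>

lemma exp_hilbert_schmidt_diagonal:
  fixes h :: "'a::separable_hilbert operator"
  assumes S: "hilbert_schmidt S"
    and fc: "functional_calculus (\<lambda>s. complex_of_real (exp (- s / 2))) h = graph_of S"
  obtains f :: "nat \<Rightarrow> 'a" and l :: "nat \<Rightarrow> real" where "is_onb f"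
    "h = diag_op f (\<lambda>i. complex_of_real (l i))" "\<And>i. S (f i) = complex_of_real (exp (- l i / 2)) *\<^sub>C f i"
proof -
  let ?\<phi> = "\<lambda>s::real. exp (- s / 2)" and ?B = "\<lambda>n. {-real n..real n}"
  let ?f = "\<lambda>s. complex_of_real (?\<phi> s)"
  \<comment> \<open>The graph of an everywhere defined operator is not empty, so neither is the
    family of measures in the union that defines the functional calculus.\<close>
  have "(0, S 0) \<in> functional_calculus ?f h" unfolding fc by (auto simp: graph_of_def)
  then obtain P where P: "spectral_measure_of h P" unfolding functional_calculus_def by blast
  interpret pvm P by standard (use P in \<open>simp add: spectral_measure_of_def\<close>)
  have Sb: "S \<in> bounded_ops" using S by (simp add: hilbert_schmidt_def)
  have SI: "(x, y) \<in> spectral_integral P ?f \<Longrightarrow> y = S x" for x y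
    using P fc by (auto simp: functional_calculus_def graph_of_def)
  have loc: "(P E x, S (P E x)) \<in> spectral_integral P ?f" if "E \<in> sets borel" "E \<subseteq> ?B n" for E n x
  proof -
    have "\<exists>y. (P E x, y) \<in> spectral_integral P ?f"
      using that by (intro local_spectral_integral[where C = "exp (real n / 2)"]) auto
    thus ?thesis using SI by blast
  qed
  have int: "integrable (\<mu> x) (\<lambda>s. indicator E s * ?\<phi> s)" if "E \<in> sets borel" "E \<subseteq> ?B n" for E n x
    using that by (intro integrable_bounded[where C = "exp (real n / 2)"]) (auto simp: indicator_def)
  have quad: "cinner (P F x) (S (P E x)) = complex_of_real (\<integral>s. indicator (E \<inter> F) s * ?\<phi> s \<partial>\<mu> x)"
    if E: "E \<in> sets borel" "E \<subseteq> ?B n" and F: "F \<in> sets borel" "F \<subseteq> ?B m" for E F m n x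
  proof -
    have "P F x \<in> pvm_domain P ?f" using loc[OF F] by (auto simp: spectral_integral_def)
    hence "cinner (P F x) (S (P E x)) = pvm_integral2 P ?f (P F x) (P E x)"
      using loc[OF E] by (auto simp: spectral_integral_def)
    also have "\<dots> = (\<integral>s. indicator (E \<inter> F) s *\<^sub>R ?f s \<partial>\<mu> x)"
    proof (rule pvm_integral2_proj[OF E(1) F(1)])
      have "E \<union> F \<subseteq> ?B (max m n)" using E F by force
      from integrable_of_real[OF int[OF _ this]] show "integrable (\<mu> x) (\<lambda>s. indicator (E \<union> F) s *\<^sub>R ?f s)"
        using E F by (simp add: scaleR_conv_of_real)
    qed auto
    also have "\<dots> = (\<integral>s. complex_of_real (indicator (E \<inter> F) s * ?\<phi> s) \<partial>\<mu> x)"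
      by (simp add: scaleR_conv_of_real)
    finally show ?thesis unfolding integral_complex_of_real .
  qed
  have quad_lim: "(\<lambda>n. cinner (P (?B n) x) (S (P (?B n) x))) \<longlonglongrightarrow> cinner x (S x)" for x
    by (intro tendsto_cinner proj_exhaust bounded_linear.tendsto[OF bounded_ops_bounded_linear[OF Sb]])
  have quad_eq: "cinner (P (?B n) x) (S (P (?B n) x)) = complex_of_real (\<integral>s. indicator (?B n) s * ?\<phi> s \<partial>\<mu> x)"
    for n x using quad[of "?B n" n "?B n" n x] by simp
  have Im0: "Im (cinner x (S x)) = 0" for x
    using tendsto_Im[OF quad_lim[of x]] by (simp add: quad_eq LIMSEQ_const_iff)
  \<comment> \<open>On [-m, m] the function exp(-s/2) is at least exp(-m/2). The bound yields
    positivity (m = 0) and injectivity (all m, since P([-m, m]) x tends to x).\<close>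
  have Re_ge: "exp (- real m / 2) * (norm (P (?B m) x))\<^sup>2 \<le> Re (cinner x (S x))" for m x
  proof (rule LIMSEQ_le_const[OF tendsto_Re[OF quad_lim[of x]]])
    have "exp (- real m / 2) * (norm (P (?B m) x))\<^sup>2 \<le> (\<integral>s. indicator (?B n) s * ?\<phi> s \<partial>\<mu> x)" if "m \<le> n" for n
    proof -
      have "exp (- real m / 2) * (norm (P (?B m) x))\<^sup>2 = (\<integral>s. exp (- real m / 2) * indicator (?B m) s \<partial>\<mu> x)"
        by (simp add: measure_pvm)
      also have "\<dots> \<le> (\<integral>s. indicator (?B n) s * ?\<phi> s \<partial>\<mu> x)"
        using that by (intro integral_mono int[of _ n] integrable_mult_right integrable_bounded[where C = 1])
          (auto simp: indicator_def)
      finally show ?thesis .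
    qed
    thus "\<exists>N. \<forall>n\<ge>N. exp (- real m / 2) * (norm (P (?B m) x))\<^sup>2 \<le> Re (cinner (P (?B n) x) (S (P (?B n) x)))"
      unfolding quad_eq by (intro exI[of _ m]) simp
  qed
  have pos: "0 \<le> Re (cinner x (S x))" for x
    by (rule order_trans[OF _ Re_ge[of 0 x]]) simp
  have inj: "x = 0" if "S x = 0" for x
  proof -
    have "P (?B m) x = 0" for m
      using Re_ge[of m x] that by (simp add: mult_le_0_iff not_le)
    thus ?thesis using proj_exhaust[of x] by (simp add: LIMSEQ_const_iff)
  qed
  have sym: "cinner (S z) x = cinner z (S x)" for x z
    by (rule symmetric_of_real_quadratic_form[OF Sb Im0])
  have adj: "cadj S = S" by (rule cadj_eqI) (rule sym)
  obtain f :: "nat \<Rightarrow> 'a" and \<sigma> where f: "is_onb f" and \<sigma>: "\<And>n. \<sigma> n > 0"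
    "\<And>n. S (S (f n)) = complex_of_real (\<sigma> n) *\<^sub>C f n"
    using hs_eigenbasis[of "Abs_hs S", unfolded Abs_hs_op[OF S] adj, OF inj] by metis
  define l where "l n = - 2 * ln (sqrt (\<sigma> n))" for n
  have l: "?\<phi> (l n) = sqrt (\<sigma> n)" for n using \<sigma>(1) by (simp add: l_def)
  have Sf: "S (f n) = complex_of_real (?\<phi> (l n)) *\<^sub>C f n" for n
  proof -
    let ?s = "sqrt (\<sigma> n)"
    \<comment> \<open>With v = (S - sqrt \<sigma>) f, the equation S^2 f = \<sigma> f reads (S +
      sqrt \<sigma>) v = 0, and a positive S has no eigenvalue -sqrt \<sigma>.\<close>
    let ?v = "S (f n) - complex_of_real ?s *\<^sub>C f n"
    have s: "?s > 0" "complex_of_real (\<sigma> n) = complex_of_real ?s * complex_of_real ?s"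
      using \<sigma>(1)[of n] by (simp_all flip: of_real_mult)
    have lin: "S (x - y) = S x - S y" for x y
      using bounded_opsD(1)[OF Sb, of "x - y" y] by simp
    have "S ?v = (- complex_of_real ?s) *\<^sub>C ?v"
      unfolding scaleC_minus_left
      by (simp add: lin bounded_opsD(2)[OF Sb] \<sigma>(2) s(2) scaleC_diff_right scaleC_scaleC del: of_real_mult)
    hence "Re (cinner ?v (S ?v)) = - (?s * (norm ?v)\<^sup>2)"
      by (simp add: cinner_scaleC_right cinner_self flip: of_real_power of_real_mult)
    hence "?s * (norm ?v)\<^sup>2 \<le> 0" using pos[of ?v] by simp
    hence "?v = 0" using s(1) by (simp add: mult_le_0_iff)
    thus ?thesis by (simp only: l right_minus_eq)
  qed
  have "P E (f i) = (if l i \<in> E then f i else 0)" if "E \<in> sets borel" for E i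
  proof (rule proj_concentrated[where g = ?\<phi> and d = "?\<phi> (l i)"])
    fix n and E :: "real set" assume E: "E \<in> sets borel" "E \<subseteq> ?B n"
    \<comment> \<open>f i is not yet known to lie in the domain of the spectral integral, so it is
      approximated by P([-m, m]) f i; from m = n on the value no longer changes.\<close>
    have "(\<lambda>m. cinner (P (?B m) (f i)) (S (P E (f i)))) \<longlonglongrightarrow> cinner (f i) (S (P E (f i)))"
      by (intro tendsto_cinner proj_exhaust tendsto_const)
    moreover have "\<forall>\<^sub>F m in sequentially. cinner (P (?B m) (f i)) (S (P E (f i))) =
      complex_of_real (\<integral>s. indicator E s * ?\<phi> s \<partial>\<mu> (f i))"
      using eventually_ge_at_top[of n]
    proof eventually_elim
      case (elim m)
      have "E \<inter> ?B m = E" using E elim by force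
      thus ?case using quad[OF E, of "?B m" m] by simp
    qed
    ultimately have "cinner (f i) (S (P E (f i))) = complex_of_real (\<integral>s. indicator E s * ?\<phi> s \<partial>\<mu> (f i))"
      by (rule LIMSEQ_unique[OF _ tendsto_eventually])
    moreover have "cinner (f i) (S (P E (f i))) = complex_of_real (?\<phi> (l i) * (norm (P E (f i)))\<^sup>2)"
      using E by (simp add: Sf cinner_scaleC_left flip: sym norm_sq of_real_power)
    ultimately show "(\<integral>s. indicator E s * ?\<phi> s \<partial>\<mu> (f i)) = ?\<phi> (l i) * measure (\<mu> (f i)) E"
      using E by (simp only: measure_pvm of_real_eq_iff)
  qed (use that int in auto)
  hence "spectral_integral P complex_of_real = diag_op f (\<lambda>i. complex_of_real (l i))"
    by (intro spectral_integral_diag f) auto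
  thus ?thesis using that[OF f _ Sf] P by (simp add: spectral_measure_of_def)
qed

section \<open>The von Neumann algebra of left multiplications\<close>

text \<open>\<open>cinner X Y\<close> is the trace of Y X* over \<open>ebasis\<close>; polarizing
  the norm identity rewrites it as the trace of X* Y in any orthonormal basis.\<close>

lemma hs_cinner_onb:
  fixes X Y :: "'a::separable_hilbert hs"
  assumes f: "is_onb f"
  shows "(\<lambda>n. cinner (hs_op X (f n)) (hs_op Y (f n))) sums cinner X Y"
proof -
  have "(\<lambda>n. (\<Sum>k<4. \<i> ^ k * complex_of_real ((norm (hs_op (Y + \<i> ^ k *\<^sub>C X) (f n)))\<^sup>2)) / 4)
    sums ((\<Sum>k<4. \<i> ^ k * complex_of_real ((norm (Y + \<i> ^ k *\<^sub>C X))\<^sup>2)) / 4)"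
    by (intro sums_divide sums_sum sums_mult sums_of_real hs_norm_onb(1) f)
  thus ?thesis unfolding polarization by (simp add: polarization del: of_real_power)
qed

lemma bounded_ops_add: "A \<in> bounded_ops \<Longrightarrow> B \<in> bounded_ops \<Longrightarrow> (\<lambda>x. A x + B x) \<in> bounded_ops"
proof -
  assume A: "A \<in> bounded_ops" and B: "B \<in> bounded_ops"
  obtain K L where K: "\<And>x. norm (A x) \<le> K * norm x" and L: "\<And>x. norm (B x) \<le> L * norm x"
    using bounded_opsD(4)[OF A] bounded_opsD(4)[OF B] by metis
  show ?thesis
  proof (rule bounded_opsI[where K = "K + L"])
    show "norm (A x + B x) \<le> (K + L) * norm x" for x
      using norm_triangle_ineq[of "A x" "B x"] K[of x] L[of x] by (simp add: distrib_right)
  qed (simp_all add: bounded_opsD[OF A] bounded_opsD[OF B] scaleC_add_right)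
qed

lemma bounded_ops_scaleC: "A \<in> bounded_ops \<Longrightarrow> (\<lambda>x. c *\<^sub>C A x) \<in> bounded_ops"
  using bounded_ops_comp[OF scaleC_in_bounded_ops] by (simp add: comp_def)

lemma norm_vee_id_le:
  fixes A :: "'a::separable_hilbert \<Rightarrow> 'a"
  assumes A: "A \<in> bounded_ops" and K: "0 \<le> K" "\<And>x. norm (A x) \<le> K * norm x"
  shows "norm ((A \<or>\<^sub>H id) X) \<le> K * norm X"
proof (rule power2_le_imp_le)
  have "(norm ((A \<or>\<^sub>H id) X))\<^sup>2 \<le> K\<^sup>2 * (norm X)\<^sup>2"
    using power_mono[OF K(2), of _ 2]
    by (intro sums_le[OF _ hs_norm_sums sums_mult[OF hs_norm_sums]])
      (simp add: hs_op_vee_id A power_mult_distrib)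
  thus "(norm ((A \<or>\<^sub>H id) X))\<^sup>2 \<le> (K * norm X)\<^sup>2" by (simp add: power_mult_distrib)
qed (use K in simp)

text \<open>Adjoints turn right multiplication by B into left multiplication by B*, and by
  \<open>hs_norm_onb\<close> the norm can be computed from the adjoints.\<close>

lemma norm_hs_comp_right_le:
  fixes B :: "'a::separable_hilbert \<Rightarrow> 'a"
  assumes B: "B \<in> bounded_ops"
  shows "\<exists>K. \<forall>X Y. hs_op Y = hs_op X \<circ> B \<longrightarrow> norm Y \<le> K * norm X"
proof -
  obtain K where K: "K \<ge> 0" "\<And>x. norm (cadj B x) \<le> K * norm x"
    using bounded_opsD(4)[OF cadj_bounded[OF B]] by blast
  have "norm Y \<le> K * norm X" if Y: "hs_op Y = hs_op X \<circ> B" for X Y :: "'a hs"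
  proof (rule power2_le_imp_le)
    have "(norm Y)\<^sup>2 \<le> K\<^sup>2 * (norm X)\<^sup>2"
      using power_mono[OF K(2), of _ 2]
      by (intro sums_le[OF _ hs_norm_onb(2)[OF is_onb_ebasis] sums_mult[OF hs_norm_onb(2)[OF is_onb_ebasis]]])
        (simp add: Y cadj_comp B power_mult_distrib)
    thus "(norm Y)\<^sup>2 \<le> (K * norm X)\<^sup>2" by (simp add: power_mult_distrib)
  qed (use K in simp)
  thus ?thesis by blast
qed

lemma vee_id_bounded_ops: "A \<in> bounded_ops \<Longrightarrow> A \<or>\<^sub>H id \<in> bounded_ops"
proof -
  assume A: "A \<in> bounded_ops"
  obtain K where K: "K \<ge> 0" "\<And>x. norm (A x) \<le> K * norm x" using bounded_opsD(4)[OF A] by blast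
  show ?thesis
    by (rule bounded_opsI[where K = K]; (rule hs_eqI)?)
      (simp_all add: hs_op_vee_id A bounded_opsD[OF A] norm_vee_id_le[OF A K])
qed

lemma vee_id_comp: "A \<in> bounded_ops \<Longrightarrow> B \<in> bounded_ops \<Longrightarrow> (A \<or>\<^sub>H id) \<circ> (B \<or>\<^sub>H id) = (A \<circ> B) \<or>\<^sub>H id"
  by (rule ext, rule hs_eqI) (simp add: hs_op_vee_id bounded_ops_comp)

lemma vee_id_add:
  "A \<in> bounded_ops \<Longrightarrow> B \<in> bounded_ops \<Longrightarrow> (\<lambda>X. (A \<or>\<^sub>H id) X + (B \<or>\<^sub>H id) X) = (\<lambda>x. A x + B x) \<or>\<^sub>H id"
  by (rule ext, rule hs_eqI) (simp add: hs_op_vee_id bounded_ops_add)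

lemma vee_id_scaleC: "A \<in> bounded_ops \<Longrightarrow> (\<lambda>X. c *\<^sub>C (A \<or>\<^sub>H id) X) = (\<lambda>x. c *\<^sub>C A x) \<or>\<^sub>H id"
  by (rule ext, rule hs_eqI) (simp add: hs_op_vee_id bounded_ops_scaleC)

lemma id_vee_id: "id \<or>\<^sub>H id = id"
  by (rule ext, rule hs_eqI) (simp add: hs_op_vee_id id_bounded_ops)

lemma cinner_vee_id:
  fixes A :: "'a::separable_hilbert \<Rightarrow> 'a"
  assumes A: "A \<in> bounded_ops"
  shows "cinner ((cadj A \<or>\<^sub>H id) Y) X = cinner Y ((A \<or>\<^sub>H id) X)"
proof (rule sums_unique2[OF hs_cinner_onb[OF is_onb_ebasis]])
  show "(\<lambda>n. cinner (hs_op ((cadj A \<or>\<^sub>H id) Y) (ebasis n)) (hs_op X (ebasis n))) sums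
    cinner Y ((A \<or>\<^sub>H id) X)"
    using hs_cinner_onb[OF is_onb_ebasis, of Y "(A \<or>\<^sub>H id) X"]
    by (simp add: hs_op_vee_id A cadj_bounded cinner_cadj)
qed

lemma cadj_vee_id: "A \<in> bounded_ops \<Longrightarrow> cadj (A \<or>\<^sub>H id) = cadj A \<or>\<^sub>H id"
  by (rule cadj_eqI) (rule cinner_vee_id)

lemma left_vN_algebra_bounded: "X \<in> left_vN_algebra \<Longrightarrow> X \<in> bounded_ops"
  by (auto simp: left_vN_algebra_def vee_id_bounded_ops)

lemma norm_tensor: "norm (e \<otimes>\<^sub>H y) = norm e * norm y"
proof -
  have "(\<lambda>n. (norm (hs_op (e \<otimes>\<^sub>H y) (ebasis n)))\<^sup>2) sums ((norm e)\<^sup>2 * (norm y)\<^sup>2)"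
    using sums_mult2[OF ebasis_expansion(2)[of e], of "(norm y)\<^sup>2"]
    by (simp add: hs_op_tensor norm_scaleC power_mult_distrib cmod_cinner_commute[of e])
  hence "(norm (e \<otimes>\<^sub>H y))\<^sup>2 = (norm e * norm y)\<^sup>2"
    using hs_norm_sums sums_unique2 unfolding power_mult_distrib by blast
  thus ?thesis by (simp add: power2_eq_iff_nonneg)
qed

text \<open>An operator in the bicommutant commutes with right multiplication by the rank one operators
  \<open>e \<otimes>\<^sub>H x\<close>, where \<open>X \<circ> (e \<otimes>\<^sub>H x) = e \<otimes>\<^sub>H X x\<close>; hence it is left multiplication by
  \<open>y \<mapsto> (\<Phi> (e \<otimes>\<^sub>H y)) e\<close>.\<close>

lemma bicommutant_left_mult:
  fixes \<Phi> :: "'a::separable_hilbert hs \<Rightarrow> 'a hs"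
  assumes \<Phi>: "\<Phi> \<in> commutant (commutant left_vN_algebra)"
  shows "\<Phi> \<in> left_vN_algebra"
proof -
  have \<Phi>b: "\<Phi> \<in> bounded_ops" using \<Phi> by (simp add: commutant_def)
  let ?R = "\<lambda>(C::'a hs) (X::'a hs). Abs_hs (hs_op X \<circ> hs_op C)"
  have R: "hs_op (?R C X) = hs_op X \<circ> hs_op C" for C X
    by (intro Abs_hs_op hilbert_schmidt_comp_right) auto
  have RC: "?R C \<in> commutant left_vN_algebra" for C
  proof -
    obtain K where K: "\<And>X Y. hs_op Y = hs_op X \<circ> hs_op C \<Longrightarrow> norm Y \<le> K * norm X"
      using norm_hs_comp_right_le[OF hs_op_bounded[of C]] by blast
    have "?R C \<in> bounded_ops"
    proof (rule bounded_opsI[where K = K])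
      show "norm (?R C X) \<le> K * norm X" for X by (rule K[OF R])
    qed (rule hs_eqI, simp add: R)+
    moreover have "(A \<or>\<^sub>H id) \<circ> ?R C = ?R C \<circ> (A \<or>\<^sub>H id)" if "A \<in> bounded_ops" for A
      by (rule ext, rule hs_eqI) (simp add: R hs_op_vee_id that)
    ultimately show ?thesis by (auto simp: commutant_def left_vN_algebra_def)
  qed
  have comm: "?R C (\<Phi> X) = \<Phi> (?R C X)" for C X
  proof -
    have "?R C \<circ> \<Phi> = \<Phi> \<circ> ?R C"
      using \<Phi> RC[of C] unfolding commutant_def[of "commutant left_vN_algebra"] by blast
    thus ?thesis by (simp add: fun_eq_iff)
  qed
  let ?e = "ebasis 0 :: 'a"
  have RX: "?R (?e \<otimes>\<^sub>H x) X = ?e \<otimes>\<^sub>H (hs_op X x)" for x X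
    by (rule hs_eqI) (simp add: R hs_op_tensor bounded_opsD(2))
  define A where "A y = hs_op (\<Phi> (?e \<otimes>\<^sub>H y)) ?e" for y
  have AX: "A (hs_op X x) = hs_op (\<Phi> X) x" for X x
  proof -
    have "?e \<otimes>\<^sub>H hs_op (\<Phi> X) x = \<Phi> (?e \<otimes>\<^sub>H hs_op X x)"
      using comm[where C = "?e \<otimes>\<^sub>H x" and X = X] unfolding RX .
    from this[symmetric] show ?thesis by (simp add: A_def hs_op_tensor ebasis_orthonormal)
  qed
  obtain K where K: "\<And>X. norm (\<Phi> X) \<le> K * norm X" using bounded_opsD(4)[OF \<Phi>b] by blast
  have "A \<in> bounded_ops"
  proof (rule bounded_opsI[where K = K])
    fix x y :: 'a and c
    have "?e \<otimes>\<^sub>H (x + y) = (?e \<otimes>\<^sub>H x) + (?e \<otimes>\<^sub>H y)" "?e \<otimes>\<^sub>H (c *\<^sub>C x) = c *\<^sub>C (?e \<otimes>\<^sub>H x)"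
      by (rule hs_eqI, simp add: hs_op_tensor scaleC_add_right scaleC_scaleC mult.commute)+
    thus "A (x + y) = A x + A y" "A (c *\<^sub>C x) = c *\<^sub>C A x" by (simp_all add: A_def bounded_opsD[OF \<Phi>b])
    have "norm (A x) \<le> norm (\<Phi> (?e \<otimes>\<^sub>H x))" using hs_op_norm_le[of "\<Phi> (?e \<otimes>\<^sub>H x)" ?e] by (simp add: A_def)
    also have "\<dots> \<le> K * norm x" using K[of "?e \<otimes>\<^sub>H x"] by (simp add: norm_tensor)
    finally show "norm (A x) \<le> K * norm x" .
  qed
  moreover have "\<Phi> = A \<or>\<^sub>H id"
    by (rule ext, rule hs_eqI) (simp add: hs_op_vee_id calculation AX)
  ultimately show ?thesis by (auto simp: left_vN_algebra_def)
qed

lemma von_neumann_left_vN_algebra: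
  "von_neumann_algebra (left_vN_algebra :: ('a::separable_hilbert hs \<Rightarrow> 'a hs) set)"
proof -
  let ?M = "left_vN_algebra :: ('a hs \<Rightarrow> 'a hs) set"
  have M: "?M \<subseteq> bounded_ops" by (auto intro: left_vN_algebra_bounded)
  hence "?M \<subseteq> commutant (commutant ?M)" by (auto simp: commutant_def)
  hence "commutant (commutant ?M) = ?M" using bicommutant_left_mult by blast
  thus ?thesis
    using M unfolding von_neumann_algebra_def
    by (auto simp: left_vN_algebra_def vee_id_add vee_id_comp vee_id_scaleC cadj_vee_id
        intro: bounded_ops_add bounded_ops_comp bounded_ops_scaleC cadj_bounded)
qed

section \<open>The dynamics\<close>

locale dynamics =
  fixes f :: "nat \<Rightarrow> 'a::separable_hilbert" and l :: "nat \<Rightarrow> real"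
  assumes f: "is_onb f"
begin

definition U :: "real \<Rightarrow> 'a \<Rightarrow> 'a" where
  "U t = diag f (\<lambda>n. exp (\<i> * of_real (t * l n)))"

text \<open>Conjugation is defined on all maps of the Hilbert-Schmidt space, so the group law and
  multiplicativity are plain identities of functions.\<close>

definition \<alpha> :: "real \<Rightarrow> ('a hs \<Rightarrow> 'a hs) \<Rightarrow> 'a hs \<Rightarrow> 'a hs" where
  "\<alpha> t X = (U t \<or>\<^sub>H id) \<circ> X \<circ> (U (- t) \<or>\<^sub>H id)"

lemma phase: "cmod (exp (\<i> * of_real s)) \<le> 1" by simp

lemma U_bounded [simp]: "U t \<in> bounded_ops"
  unfolding U_def by (rule diag_bounded_ops[OF f phase])

lemma norm_U_le: "norm (U t x) \<le> norm x"
  using norm_diag_le[OF f phase] unfolding U_def by (metis mult_1)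

lemma cinner_U: "cinner (f n) (U t x) = exp (\<i> * of_real (t * l n)) * cinner (f n) x"
  unfolding U_def by (rule cinner_diag_bounded[OF f phase])

lemma U_add: "U s \<circ> U t = U (s + t)"
  unfolding U_def by (subst diag_comp[OF f phase phase]) (simp add: algebra_simps flip: exp_add)

lemma U_zero: "U 0 = id"
  by (simp add: U_def diag_one[OF f])

lemma cadj_U: "cadj (U t) = U (- t)"
  unfolding U_def by (subst cadj_diag[OF f phase]) (simp add: exp_cnj)

lemma U_continuous: "((\<lambda>t. U t x) \<longlongrightarrow> U s x) (at s)"
  unfolding U_def by (rule tendsto_diag[OF f phase phase]) (intro tendsto_intros, simp)

lemma W_comp: "(U s \<or>\<^sub>H id) ((U t \<or>\<^sub>H id) X) = (U (s + t) \<or>\<^sub>H id) X"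
  using vee_id_comp[of "U s" "U t"] by (simp add: U_add fun_eq_iff)

lemma W_cancel [simp]: "(U t \<or>\<^sub>H id) ((U (- t) \<or>\<^sub>H id) X) = X" "(U (- t) \<or>\<^sub>H id) ((U t \<or>\<^sub>H id) X) = X"
  by (simp_all add: W_comp U_zero id_vee_id)

lemma norm_W_le: "norm ((U t \<or>\<^sub>H id) X) \<le> norm X"
  using norm_vee_id_le[OF U_bounded, of 1 t X] by (simp add: norm_U_le)

lemma cinner_W: "cinner X ((U t \<or>\<^sub>H id) Y) = cinner ((U (- t) \<or>\<^sub>H id) X) Y"
  using cinner_vee_id[OF U_bounded, of t X Y] by (simp add: cadj_U)

text \<open>Strong continuity of U lifts to left multiplication: the squared norm is a series over
  basis vectors, dominated by 4 ||Y e_n||^2 because U t is a contraction.\<close>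

lemma W_continuous: "((\<lambda>t. (U t \<or>\<^sub>H id) Y) \<longlongrightarrow> (U s \<or>\<^sub>H id) Y) (at s)"
proof -
  let ?a = "\<lambda>n t. (norm (U t (hs_op Y (ebasis n)) - U s (hs_op Y (ebasis n))))\<^sup>2"
  have "(norm ((U t \<or>\<^sub>H id) Y - (U s \<or>\<^sub>H id) Y))\<^sup>2 = (\<Sum>n. ?a n t)" for t
    using hs_norm_sums[of "(U t \<or>\<^sub>H id) Y - (U s \<or>\<^sub>H id) Y"] by (simp add: sums_iff hs_op_vee_id)
  moreover have "((\<lambda>t. \<Sum>n. ?a n t) \<longlongrightarrow> 0) (at s)"
  proof (rule tendsto_suminf_dominated[where M = "\<lambda>n. 4 * (norm (hs_op Y (ebasis n)))\<^sup>2"])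
    fix n
    let ?y = "hs_op Y (ebasis n)"
    have "(?a n \<longlongrightarrow> (norm (U s ?y - U s ?y))\<^sup>2) (at s)"
      by (rule tendsto_power[OF tendsto_norm[OF tendsto_diff[OF U_continuous tendsto_const]]])
    thus "(?a n \<longlongrightarrow> 0) (at s)" by simp
    fix t
    have "norm (U t ?y - U s ?y) \<le> 2 * norm ?y"
      using norm_triangle_ineq4[of "U t ?y" "U s ?y"] norm_U_le[of t ?y] norm_U_le[of s ?y] by linarith
    from power_mono[OF this norm_ge_zero, of 2]
    show "\<bar>?a n t\<bar> \<le> 4 * (norm ?y)\<^sup>2" by (simp add: power_mult_distrib)
  qed (auto intro: summable_mult)
  ultimately have "((\<lambda>t. (norm ((U t \<or>\<^sub>H id) Y - (U s \<or>\<^sub>H id) Y))\<^sup>2) \<longlongrightarrow> 0) (at s)" by simp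
  from tendsto_real_sqrt[OF this] have "((\<lambda>t. norm ((U t \<or>\<^sub>H id) Y - (U s \<or>\<^sub>H id) Y)) \<longlongrightarrow> 0) (at s)"
    by simp
  thus ?thesis by (simp add: tendsto_norm_zero_iff LIM_zero_iff)
qed

lemma \<alpha>_vee: "A \<in> bounded_ops \<Longrightarrow> \<alpha> t (A \<or>\<^sub>H id) = (U t \<circ> A \<circ> U (- t)) \<or>\<^sub>H id"
  by (simp add: \<alpha>_def vee_id_comp bounded_ops_comp)

lemma UAU_bounded: "A \<in> bounded_ops \<Longrightarrow> U t \<circ> A \<circ> U s \<in> bounded_ops"
  by (intro bounded_ops_comp) auto

lemma \<alpha>_left_vN_algebra: "X \<in> left_vN_algebra \<Longrightarrow> \<alpha> t X \<in> left_vN_algebra"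
  by (auto simp: left_vN_algebra_def \<alpha>_vee intro: UAU_bounded)

lemma \<alpha>_add: "\<alpha> (s + t) X = \<alpha> s (\<alpha> t X)"
  by (auto simp: \<alpha>_def fun_eq_iff W_comp add.commute)

lemma \<alpha>_zero: "\<alpha> 0 X = X"
  by (auto simp: \<alpha>_def U_zero id_vee_id)

lemma star_automorphism_\<alpha>: "star_automorphism left_vN_algebra (\<alpha> t)"
  unfolding star_automorphism_def
proof (intro conjI ballI allI)
  have inv: "\<alpha> (- t) (\<alpha> t X) = X" "\<alpha> t (\<alpha> (- t) X) = X" for X
    by (simp_all add: \<alpha>_zero flip: \<alpha>_add)
  show "bij_betw (\<alpha> t) left_vN_algebra left_vN_algebra"
    by (rule bij_betw_byWitness[where f' = "\<alpha> (- t)"]) (auto simp: inv \<alpha>_left_vN_algebra)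
  have W: "(U t \<or>\<^sub>H id) \<in> bounded_ops" by (simp add: vee_id_bounded_ops)
  show "\<alpha> t (\<lambda>x. A x + B x) = (\<lambda>x. \<alpha> t A x + \<alpha> t B x)" for A B
    by (auto simp: \<alpha>_def bounded_opsD[OF W])
  show "\<alpha> t (A \<circ> B) = \<alpha> t A \<circ> \<alpha> t B" for A B
    by (auto simp: \<alpha>_def)
  show "\<alpha> t (\<lambda>x. c *\<^sub>C A x) = (\<lambda>x. c *\<^sub>C \<alpha> t A x)" for c A
    by (auto simp: \<alpha>_def bounded_opsD[OF W])
  fix X :: "'a hs \<Rightarrow> 'a hs" assume "X \<in> left_vN_algebra"
  then obtain A where A: "A \<in> bounded_ops" "X = A \<or>\<^sub>H id" by (auto simp: left_vN_algebra_def)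
  show "\<alpha> t (cadj X) = cadj (\<alpha> t X)"
    by (simp add: A \<alpha>_vee cadj_vee_id UAU_bounded cadj_bounded cadj_comp bounded_ops_comp cadj_U comp_assoc)
qed

text \<open>Moving U t to the left of the inner product writes each term as <U(-t) \<xi>, X U(-t)
  \<eta>>, continuous in t. The bound K (||\<xi> n||^2 + ||\<eta> n||^2) is free of t, so the series
  converges uniformly and every functional generating the topology is continuous along the
  orbit.\<close>

lemma \<alpha>_sigma_weak_continuous:
  assumes X: "X \<in> left_vN_algebra"
  shows "continuous_map euclidean sigma_weak_topology (\<lambda>t. \<alpha> t X)"
  unfolding sigma_weak_topology_def
proof (rule continuous_on_generated_topo)
  have Xb: "X \<in> bounded_ops" by (rule left_vN_algebra_bounded[OF X])
  have \<alpha>b: "\<alpha> t X \<in> bounded_ops" for t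
    by (intro left_vN_algebra_bounded \<alpha>_left_vN_algebra X)
  obtain K where K: "0 \<le> K" "\<And>Y. norm (X Y) \<le> K * norm Y" using bounded_opsD(4)[OF Xb] by blast
  have \<alpha>K: "norm (\<alpha> t X Y) \<le> K * norm Y" for t Y
    unfolding \<alpha>_def comp_def
    using norm_W_le[of t "X ((U (- t) \<or>\<^sub>H id) Y)"] K(2)[of "(U (- t) \<or>\<^sub>H id) Y"]
      mult_left_mono[OF norm_W_le[of "- t" Y] K(1)] by linarith
  fix S :: "('a hs \<Rightarrow> 'a hs) set"
  assume "S \<in> {{A \<in> bounded_ops. (\<Sum>n. cinner (\<xi> n) (A (\<eta> n))) \<in> V} | \<xi> \<eta> V.
        summable (\<lambda>n. (norm (\<xi> n))\<^sup>2) \<and> summable (\<lambda>n. (norm (\<eta> n))\<^sup>2) \<and> open V}"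
  then obtain \<xi> \<eta> V where S: "S = {A \<in> bounded_ops. (\<Sum>n. cinner (\<xi> n) (A (\<eta> n))) \<in> V}"
    "summable (\<lambda>n. (norm (\<xi> n))\<^sup>2)" "summable (\<lambda>n. (norm (\<eta> n))\<^sup>2)" "open V" by blast
  have cont: "continuous_on UNIV (\<lambda>t. cinner (\<xi> n) (\<alpha> t X (\<eta> n)))" for n
  proof (rule continuous_at_imp_continuous_on, rule ballI)
    fix s :: real
    have lim: "((\<lambda>t. (U (- t) \<or>\<^sub>H id) Y) \<longlongrightarrow> (U (- s) \<or>\<^sub>H id) Y) (at s)" for Y
      using filterlim_compose[OF W_continuous[of Y "- s"], of "\<lambda>t. - t" "at s"]
      by (simp add: filterlim_at tendsto_minus eventually_at_filter)
    show "isCont (\<lambda>t. cinner (\<xi> n) (\<alpha> t X (\<eta> n))) s"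
      unfolding isCont_def \<alpha>_def comp_def cinner_W
      by (intro tendsto_cinner lim bounded_linear.tendsto[OF bounded_ops_bounded_linear[OF Xb]])
  qed
  have "continuous_on UNIV (\<lambda>t. \<Sum>n. cinner (\<xi> n) (\<alpha> t X (\<eta> n)))"
  proof (rule uniform_limit_theorem)
    show "uniform_limit UNIV (\<lambda>N t. \<Sum>n<N. cinner (\<xi> n) (\<alpha> t X (\<eta> n)))
      (\<lambda>t. \<Sum>n. cinner (\<xi> n) (\<alpha> t X (\<eta> n))) sequentially"
    proof (rule Weierstrass_m_test)
      show "summable (\<lambda>n. K * ((norm (\<xi> n))\<^sup>2 + (norm (\<eta> n))\<^sup>2))"
        by (intro summable_mult summable_add S)
      fix n t
      have "cmod (cinner (\<xi> n) (\<alpha> t X (\<eta> n))) \<le> norm (\<xi> n) * (K * norm (\<eta> n))"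
        by (rule order_trans[OF cmod_cinner_le]) (intro mult_left_mono \<alpha>K norm_ge_zero)
      also have "\<dots> = K * (norm (\<xi> n) * norm (\<eta> n))" by simp
      also have "\<dots> \<le> K * ((norm (\<xi> n))\<^sup>2 + (norm (\<eta> n))\<^sup>2)"
      proof (rule mult_left_mono[OF _ K(1)])
        have "0 \<le> norm (\<xi> n) * norm (\<eta> n)" by simp
        thus "norm (\<xi> n) * norm (\<eta> n) \<le> (norm (\<xi> n))\<^sup>2 + (norm (\<eta> n))\<^sup>2"
          using sum_squares_bound[of "norm (\<xi> n)" "norm (\<eta> n)"] by linarith
      qed
      finally show "cmod (cinner (\<xi> n) (\<alpha> t X (\<eta> n))) \<le> K * ((norm (\<xi> n))\<^sup>2 + (norm (\<eta> n))\<^sup>2)" .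
    qed
    show "\<forall>\<^sub>F N in sequentially. continuous_on UNIV (\<lambda>t. \<Sum>n<N. cinner (\<xi> n) (\<alpha> t X (\<eta> n)))"
      by (intro always_eventually allI continuous_on_sum cont)
  qed simp
  hence "open ((\<lambda>t. \<Sum>n. cinner (\<xi> n) (\<alpha> t X (\<eta> n))) -` V)"
    using S(4) by (simp add: continuous_on_open_vimage)
  moreover have "(\<lambda>t. \<alpha> t X) -` S = (\<lambda>t. \<Sum>n. cinner (\<xi> n) (\<alpha> t X (\<eta> n))) -` V"
    by (auto simp: S(1) \<alpha>b)
  ultimately show "openin euclidean ((\<lambda>t. \<alpha> t X) -` S \<inter> topspace euclidean)" by simp
next
  have "\<alpha> t X \<in> bounded_ops" for t
    by (intro left_vN_algebra_bounded \<alpha>_left_vN_algebra X)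
  \<comment> \<open>All of \<open>bounded_ops\<close> is a generating set, with zero sequences and V
    = UNIV, so the generating sets cover the orbit.\<close>
  moreover have "(bounded_ops :: ('a hs \<Rightarrow> 'a hs) set) \<in> {{A \<in> bounded_ops. (\<Sum>n. cinner (\<xi> n) (A (\<eta> n))) \<in> V} | \<xi> \<eta> V.
        summable (\<lambda>n. (norm (\<xi> n))\<^sup>2) \<and> summable (\<lambda>n. (norm (\<eta> n))\<^sup>2) \<and> open V}"
    by (rule CollectI, rule exI[of _ "\<lambda>_. 0"], rule exI[of _ "\<lambda>_. 0"], rule exI[of _ UNIV]) simp
  ultimately show "(\<lambda>t. \<alpha> t X) ` topspace euclidean \<subseteq> \<Union> {{A \<in> bounded_ops. (\<Sum>n. cinner (\<xi> n) (A (\<eta> n))) \<in> V} | \<xi> \<eta> V.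
        summable (\<lambda>n. (norm (\<xi> n))\<^sup>2) \<and> summable (\<lambda>n. (norm (\<eta> n))\<^sup>2) \<and> open V}"
    by blast
qed

lemma automorphism_group_\<alpha>: "automorphism_group left_vN_algebra \<alpha>"
  by (simp add: automorphism_group_def star_automorphism_\<alpha> \<alpha>_zero \<alpha>_add \<alpha>_sigma_weak_continuous)

end

section \<open>The KMS state\<close>

lemma sigma_weak_continuous_vector_functional:
  "continuous_map sigma_weak_topology euclidean (\<lambda>A. cinner \<xi> (A \<eta>))"
  unfolding continuous_map_def
proof (intro conjI allI impI)
  fix V :: "complex set" assume V: "openin euclidean V"
  \<comment> \<open>Sequences concentrated at index 0 make the vector functional one of the
    generating functionals.\<close>
  let ?\<xi> = "\<lambda>n::nat. if n = 0 then \<xi> else 0" and ?\<eta> = "\<lambda>n::nat. if n = 0 then \<eta> else 0"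
  have eq: "(\<Sum>n. cinner (?\<xi> n) (A (?\<eta> n))) = cinner \<xi> (A \<eta>)" for A
    by (subst suminf_finite[of "{0}"]) auto
  have "{A \<in> bounded_ops. (\<Sum>n. cinner (?\<xi> n) (A (?\<eta> n))) \<in> V} \<in> {{A \<in> bounded_ops. (\<Sum>n. cinner (\<xi> n) (A (\<eta> n))) \<in> U} | \<xi> \<eta> U.
        summable (\<lambda>n. (norm (\<xi> n))\<^sup>2) \<and> summable (\<lambda>n. (norm (\<eta> n))\<^sup>2) \<and> open U}"
    using V
    by (intro CollectI exI[of _ ?\<xi>] exI[of _ ?\<eta>] exI[of _ V] conjI refl summable_finite[of "{0}"]) auto
  from topology_generated_by_Basis[OF this]
  have op: "openin sigma_weak_topology {A \<in> bounded_ops. cinner \<xi> (A \<eta>) \<in> V}"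
    unfolding eq sigma_weak_topology_def .
  have "topspace sigma_weak_topology \<subseteq> bounded_ops" unfolding sigma_weak_topology_def by auto
  moreover have "openin sigma_weak_topology (topspace sigma_weak_topology)" by simp
  ultimately have "{A \<in> topspace sigma_weak_topology. cinner \<xi> (A \<eta>) \<in> V}
    = topspace sigma_weak_topology \<inter> {A \<in> bounded_ops. cinner \<xi> (A \<eta>) \<in> V}" by auto
  thus "openin sigma_weak_topology {A \<in> topspace sigma_weak_topology. cinner \<xi> (A \<eta>) \<in> V}"
    using op by (simp add: openin_Int)
qed simp

lemma normal_vector_state:
  fixes \<xi> :: "'a::separable_hilbert hs"
  assumes \<xi>: "norm \<xi> = 1"
  shows "normal_state left_vN_algebra (\<lambda>X. cinner \<xi> (X \<xi>))"
proof -
  have "cinner \<xi> ((cadj X \<circ> X) \<xi>) = complex_of_real ((norm (X \<xi>))\<^sup>2)" if X: "X \<in> left_vN_algebra" for X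
  proof -
    obtain A where A: "A \<in> bounded_ops" "X = A \<or>\<^sub>H id" using X by (auto simp: left_vN_algebra_def)
    show ?thesis
      using cinner_vee_id[OF cadj_bounded[OF A(1)], of \<xi> "X \<xi>"]
      by (simp add: A cadj_vee_id cadj_cadj cinner_self)
  qed
  thus ?thesis
    unfolding normal_state_def state_def
    by (auto simp: cinner_add_right cinner_scaleC_right cinner_self \<xi> simp flip: of_real_power
        intro: continuous_map_from_subtopology sigma_weak_continuous_vector_functional)
qed

section \<open>Unconditional convergence of weighted double series\<close>

lemma summable_on_prod_rows:
  fixes c :: "nat \<Rightarrow> nat \<Rightarrow> real"
  assumes "\<And>i. 0 \<le> p i" "\<And>i j. 0 \<le> c i j" "\<And>i. c i sums r i" "\<And>i. r i \<le> K" "summable p"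
  shows "(\<lambda>(i, j). p i * c i j) summable_on UNIV"
proof -
  have r0: "0 \<le> r i" for i by (rule sums_le[OF _ sums_zero assms(3)]) (rule assms)
  have "(\<lambda>(i, j). p i * c i j) summable_on (UNIV \<times> UNIV)"
  proof (rule summable_on_SigmaI)
    show "((\<lambda>j. (\<lambda>(i, j). p i * c i j) (i, j)) has_sum (p i * r i)) UNIV" for i
    proof (rule norm_summable_imp_has_sum)
      show "(\<lambda>j. (\<lambda>(i, j). p i * c i j) (i, j)) sums (p i * r i)" using sums_mult[OF assms(3)] by simp
      thus "summable (\<lambda>j. norm ((\<lambda>(i, j). p i * c i j) (i, j)))"
        using assms(1,2) by (auto simp: sums_iff abs_mult)
    qed
    have "summable (\<lambda>i. p i * r i)"
    proof (rule summable_comparison_test')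
      show "summable (\<lambda>i. p i * K)" by (rule summable_mult2) (rule assms)
      show "norm (p i * r i) \<le> p i * K" for i using assms r0 by (simp add: abs_mult mult_left_mono)
    qed
    thus "(\<lambda>i. p i * r i) summable_on UNIV"
      using assms(1) r0 by (subst summable_on_UNIV_nonneg_real_iff) auto
  qed (use assms in auto)
  thus ?thesis by simp
qed

text \<open>Row i of the matrix has square sum ||A* f i||^2 and column j has ||A f j||^2, both
  bounded, so a summable weight may sit on either index.\<close>

lemma summable_on_matrix_coeffs:
  fixes A :: "'a::separable_hilbert \<Rightarrow> 'a"
  assumes f: "is_onb f" and A: "A \<in> bounded_ops" and p: "\<And>i. 0 \<le> p i" "summable p"
  shows "(\<lambda>(i, j). p i * (cmod (cinner (f i) (A (f j))))\<^sup>2) summable_on UNIV"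
    and "(\<lambda>(i, j). p j * (cmod (cinner (f i) (A (f j))))\<^sup>2) summable_on UNIV"
proof -
  obtain K where K: "\<And>x. norm (A x) \<le> K * norm x" using bounded_opsD(4)[OF A] by blast
  obtain L where L: "\<And>x. norm (cadj A x) \<le> L * norm x" using bounded_opsD(4)[OF cadj_bounded[OF A]] by blast
  show "(\<lambda>(i, j). p i * (cmod (cinner (f i) (A (f j))))\<^sup>2) summable_on UNIV"
  proof (rule summable_on_prod_rows[OF p(1) _ _ _ p(2)])
    show "(\<lambda>j. (cmod (cinner (f i) (A (f j))))\<^sup>2) sums (norm (cadj A (f i)))\<^sup>2" for i
      using onb_parseval[OF f, of "cadj A (f i)"]
      by (simp add: cinner_cadj'[OF A] cmod_cinner_commute[of "A _"])
    show "(norm (cadj A (f i)))\<^sup>2 \<le> L\<^sup>2" for i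
      using power_mono[OF L norm_ge_zero, of "f i" 2] by (simp add: onb_norm[OF f])
  qed simp
  have "(\<lambda>(j, i). p j * (cmod (cinner (f i) (A (f j))))\<^sup>2) summable_on UNIV"
  proof (rule summable_on_prod_rows[OF p(1) _ _ _ p(2)])
    show "(\<lambda>i. (cmod (cinner (f i) (A (f j))))\<^sup>2) sums (norm (A (f j)))\<^sup>2" for j
      by (rule onb_parseval[OF f])
    show "(norm (A (f j)))\<^sup>2 \<le> K\<^sup>2" for j
      using power_mono[OF K norm_ge_zero, of "f j" 2] by (simp add: onb_norm[OF f])
  qed simp
  thus "(\<lambda>(i, j). p j * (cmod (cinner (f i) (A (f j))))\<^sup>2) summable_on UNIV"
    using summable_on_swap[of "\<lambda>(j, i). p j * (cmod (cinner (f i) (A (f j))))\<^sup>2" UNIV UNIV] by simp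
qed

text \<open>Fubini for an unconditionally convergent double series, phrased with \<open>sums\<close>
  so that the inner sums may come from basis expansions.\<close>

lemma has_sum_iterated:
  fixes g :: "nat \<times> nat \<Rightarrow> complex"
  assumes g: "(g has_sum F) UNIV" and h: "\<And>i. (\<lambda>j. g (i, j)) sums h i"
  shows "h sums F"
proof (rule has_sum_imp_sums, rule has_sum_SigmaD)
  show "(g has_sum F) (UNIV \<times> UNIV)" using g by simp
  fix i
  have "(\<lambda>(i, j). g (i, j)) summable_on (UNIV \<times> UNIV)" using g by (auto simp: summable_on_def)
  from summable_on_SigmaD1[OF this UNIV_I] obtain s where "((\<lambda>j. g (i, j)) has_sum s) UNIV"
    by (auto simp: summable_on_def)
  moreover from has_sum_imp_sums[OF this] have "s = h i" using h sums_unique2 by blast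
  ultimately show "((\<lambda>j. g (i, j)) has_sum h i) UNIV" by simp
qed

section \<open>The Gibbs state and its KMS functions\<close>

locale gibbs = dynamics f l for f :: "nat \<Rightarrow> 'a::separable_hilbert" and l +
  fixes p :: "nat \<Rightarrow> real" and Z :: real and \<xi> :: "'a hs"
  assumes p: "\<And>n. p n = exp (- l n) / Z" and Z: "Z > 0" and summable_p: "summable p"
    and \<xi>: "\<And>n. hs_op \<xi> (f n) = complex_of_real (sqrt (p n)) *\<^sub>C f n" and norm_\<xi>: "norm \<xi> = 1"
begin

text \<open>\<xi> is the square root of the density matrix \<rho> with eigenvalues p, so on left
  multiplications this is A \<mapsto> Tr(\<rho> A); in the form of a vector state, normality and
  positivity are immediate.\<close>

definition \<omega> :: "('a hs \<Rightarrow> 'a hs) \<Rightarrow> complex" where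
  "\<omega> X = cinner \<xi> (X \<xi>)"

lemma p_pos: "0 < p n" using Z by (simp add: p)

lemma \<omega>_sums:
  assumes A: "A \<in> bounded_ops"
  shows "(\<lambda>n. complex_of_real (p n) * cinner (f n) (A (f n))) sums \<omega> (A \<or>\<^sub>H id)"
proof -
  have "complex_of_real (sqrt (p n)) * complex_of_real (sqrt (p n)) = complex_of_real (p n)" for n
    using p_pos[of n] by (simp flip: of_real_mult)
  thus ?thesis
    using hs_cinner_onb[OF f, of \<xi> "(A \<or>\<^sub>H id) \<xi>"]
    by (simp add: \<omega>_def hs_op_vee_id A \<xi> bounded_opsD(2)[OF A] cinner_scaleC_left cinner_scaleC_right
        flip: mult.assoc)
qed

text \<open>The (i, j) term of Tr(\<rho> A exp(izh) B exp(-izh)) in the eigenbasis, as a function of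
  the index pair to be summed without order: one boundary value sums over j before i, the other over
  i before j.\<close>

definition kms_term :: "('a \<Rightarrow> 'a) \<Rightarrow> ('a \<Rightarrow> 'a) \<Rightarrow> complex \<Rightarrow> nat \<times> nat \<Rightarrow> complex" where
  "kms_term A B z = (\<lambda>(i, j). complex_of_real (p i) * exp (\<i> * z * of_real (l j - l i)) *
     (cinner (f i) (A (f j)) * cinner (f j) (B (f i))))"

definition kms_bound :: "('a \<Rightarrow> 'a) \<Rightarrow> ('a \<Rightarrow> 'a) \<Rightarrow> nat \<times> nat \<Rightarrow> real" where
  "kms_bound A B = (\<lambda>(i, j). (p i + p j) * ((cmod (cinner (f i) (A (f j))))\<^sup>2 + (cmod (cinner (f j) (B (f i))))\<^sup>2))"

lemma kms_bound_summable:
  assumes A: "A \<in> bounded_ops" and B: "B \<in> bounded_ops"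
  shows "kms_bound A B summable_on UNIV"
proof -
  note s = summable_on_matrix_coeffs[OF f _ less_imp_le[OF p_pos] summable_p]
  have swap: "(\<lambda>(i, j). g j i) summable_on UNIV" if "(\<lambda>(i, j). g i j) summable_on UNIV"
    for g :: "nat \<Rightarrow> nat \<Rightarrow> real"
    using that summable_on_swap[of "\<lambda>(i, j). g i j" UNIV UNIV] by simp
  have "(\<lambda>x. (case x of (i, j) \<Rightarrow> p i * (cmod (cinner (f i) (A (f j))))\<^sup>2)
      + (case x of (i, j) \<Rightarrow> p j * (cmod (cinner (f i) (A (f j))))\<^sup>2)
      + (case x of (i, j) \<Rightarrow> p j * (cmod (cinner (f j) (B (f i))))\<^sup>2)
      + (case x of (i, j) \<Rightarrow> p i * (cmod (cinner (f j) (B (f i))))\<^sup>2)) summable_on UNIV"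
    by (intro summable_on_add s A B swap[OF s(1)[OF B]] swap[OF s(2)[OF B]])
  thus ?thesis unfolding kms_bound_def by (rule summable_on_cong[THEN iffD1, rotated]) (auto simp: algebra_simps)
qed

text \<open>At height y = Im z the modulus of the weight is the geometric mean of p i and p j with
  exponents 1 - y and y, hence at most the larger of them and so at most their sum. The matrix
  elements are separated by ab <= a^2 + b^2, each square being summable against either
  weight.\<close>

lemma kms_term_le:
  assumes z: "0 \<le> Im z" "Im z \<le> 1"
  shows "cmod (kms_term A B z x) \<le> kms_bound A B x"
proof (cases x)
  case (Pair i j)
  let ?y = "Im z" and ?a = "cmod (cinner (f i) (A (f j)))" and ?b = "cmod (cinner (f j) (B (f i)))"
  have "p i * exp (- (?y * (l j - l i))) = exp (- ((1 - ?y) * l i + ?y * l j)) / Z"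
    by (simp add: p algebra_simps flip: exp_add)
  also have "\<dots> \<le> p i + p j"
  proof -
    have "min (l i) (l j) \<le> (1 - ?y) * l i + ?y * l j"
    proof -
      have "(1 - ?y) * min (l i) (l j) \<le> (1 - ?y) * l i" "?y * min (l i) (l j) \<le> ?y * l j"
        using z by (auto intro!: mult_left_mono)
      thus ?thesis by (simp add: left_diff_distrib)
    qed
    hence "exp (- ((1 - ?y) * l i + ?y * l j)) \<le> exp (- min (l i) (l j))" by simp
    also have "\<dots> \<le> exp (- l i) + exp (- l j)" by (simp add: min_def)
    finally show ?thesis using Z by (simp add: p divide_right_mono flip: add_divide_distrib)
  qed
  finally have 1: "p i * exp (- (?y * (l j - l i))) \<le> p i + p j" .
  have "0 \<le> ?a * ?b" by simp
  hence 2: "?a * ?b \<le> ?a\<^sup>2 + ?b\<^sup>2" using sum_squares_bound[of ?a ?b] by linarith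
  have "cmod (kms_term A B z x) = (p i * exp (- (?y * (l j - l i)))) * (?a * ?b)"
    using p_pos[of i] by (simp add: kms_term_def Pair norm_mult)
  also have "\<dots> \<le> (p i + p j) * (?a\<^sup>2 + ?b\<^sup>2)"
    using p_pos[of i] p_pos[of j] by (intro mult_mono 1 2) auto
  finally show ?thesis by (simp add: kms_bound_def Pair)
qed

lemma kms_term_has_sum:
  assumes AB: "A \<in> bounded_ops" "B \<in> bounded_ops" and z: "0 \<le> Im z" "Im z \<le> 1"
  shows "(kms_term A B z has_sum infsum (kms_term A B z) UNIV) UNIV"
  by (rule has_sum_infsum, rule abs_summable_summable,
      rule Infinite_Sum.abs_summable_on_comparison_test'[OF kms_bound_summable[OF AB]], rule kms_term_le[OF z])

lemma matrix_product_sums: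
  assumes A: "A \<in> bounded_ops"
  shows "(\<lambda>j. cinner x (A (f j)) * cinner (f j) y) sums cinner x (A y)"
  using onb_cinner[OF f, of "cadj A x" y]
  by (simp add: cinner_cadj'[OF A] cinner_cadj[OF A] flip: cinner_commute)

text \<open>At real z the weight sits on i; summing over j first is the basis expansion between A
  and the evolved B.\<close>

lemma kms_boundary_real:
  assumes A: "A \<in> bounded_ops" and B: "B \<in> bounded_ops"
  shows "infsum (kms_term A B (of_real t)) UNIV = \<omega> ((A \<or>\<^sub>H id) \<circ> \<alpha> t (B \<or>\<^sub>H id))"
proof -
  let ?C = "A \<circ> (U t \<circ> B \<circ> U (- t))"
  have Uf: "U (- t) (f i) = exp (- \<i> * of_real (t * l i)) *\<^sub>C f i" for i
    unfolding U_def by (subst diag_onb[OF f phase]) simp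
  have "(\<lambda>j. kms_term A B (of_real t) (i, j)) sums (complex_of_real (p i) * cinner (f i) (?C (f i)))" for i
  proof -
    have "(\<lambda>j. cinner (f i) (A (f j)) * cinner (f j) (U t (B (U (- t) (f i))))) sums cinner (f i) (?C (f i))"
      using matrix_product_sums[OF A] by simp
    hence "(\<lambda>j. complex_of_real (p i) * (cinner (f i) (A (f j)) * (exp (\<i> * of_real (t * l j)) *
        (exp (- \<i> * of_real (t * l i)) * cinner (f j) (B (f i)))))) sums
      (complex_of_real (p i) * cinner (f i) (?C (f i)))"
      by (intro sums_mult) (simp add: cinner_U Uf bounded_opsD(2)[OF B] cinner_scaleC_right)
    thus ?thesis
      by (rule sums_cong[THEN iffD1, rotated])
        (simp add: kms_term_def algebra_simps exp_diff exp_minus divide_inverse)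
  qed
  hence "(\<lambda>i. complex_of_real (p i) * cinner (f i) (?C (f i))) sums infsum (kms_term A B (of_real t)) UNIV"
    by (intro has_sum_iterated[OF kms_term_has_sum[OF A B]]) auto
  moreover have "(\<lambda>i. complex_of_real (p i) * cinner (f i) (?C (f i))) sums \<omega> (?C \<or>\<^sub>H id)"
    by (intro \<omega>_sums bounded_ops_comp A UAU_bounded B)
  ultimately show ?thesis
    using sums_unique2 by (fastforce simp: \<alpha>_vee B vee_id_comp A UAU_bounded)
qed

text \<open>At z = t + i the extra factor exp(-(l j - l i)) converts p i into p j. Summing over i
  first then produces the trace with the two operators in the opposite order.\<close>

lemma kms_boundary_shifted:
  assumes A: "A \<in> bounded_ops" and B: "B \<in> bounded_ops"
  shows "infsum (kms_term A B (of_real t + \<i>)) UNIV = \<omega> (\<alpha> t (B \<or>\<^sub>H id) \<circ> (A \<or>\<^sub>H id))"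
proof -
  let ?C = "(U t \<circ> B \<circ> U (- t)) \<circ> A"
  have row: "(\<lambda>i. kms_term A B (of_real t + \<i>) (i, j)) sums (complex_of_real (p j) * cinner (f j) (?C (f j)))" for j
  proof -
    have "(\<lambda>i. cinner (f j) (B (f i)) * cinner (f i) (U (- t) (A (f j)))) sums cinner (f j) (B (U (- t) (A (f j))))"
      by (rule matrix_product_sums[OF B])
    hence s: "(\<lambda>i. complex_of_real (p j) * (exp (\<i> * of_real (t * l j)) * (cinner (f j) (B (f i)) *
        (exp (\<i> * of_real (- t * l i)) * cinner (f i) (A (f j)))))) sums
      (complex_of_real (p j) * cinner (f j) (?C (f j)))"
      unfolding comp_apply cinner_U by (intro sums_mult) simp
    have e: "complex_of_real (p i) * exp (\<i> * (of_real t + \<i>) * of_real (l j - l i))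
      = complex_of_real (p j) * exp (\<i> * of_real (t * l j)) * exp (\<i> * of_real (- t * l i))" for i
    proof -
      have *: "complex_of_real (p k) = exp (- of_real (l k)) / of_real Z" for k
        by (simp add: p exp_of_real[symmetric])
      show ?thesis unfolding * by (simp add: algebra_simps flip: exp_add)
    qed
    have "kms_term A B (of_real t + \<i>) (i, j) = complex_of_real (p j) * (exp (\<i> * of_real (t * l j)) *
        (cinner (f j) (B (f i)) * (exp (\<i> * of_real (- t * l i)) * cinner (f i) (A (f j)))))" for i
      unfolding kms_term_def prod.case e by (simp only: mult_ac)
    thus ?thesis using s by simp
  qed
  have swp: "((\<lambda>(j, i). kms_term A B (of_real t + \<i>) (i, j)) has_sum infsum (kms_term A B (of_real t + \<i>)) UNIV) UNIV"
    using kms_term_has_sum[OF A B, of "of_real t + \<i>"]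
      has_sum_swap[where f = "kms_term A B (of_real t + \<i>)" and A = UNIV and B = UNIV] by simp
  have "(\<lambda>j. complex_of_real (p j) * cinner (f j) (?C (f j))) sums infsum (kms_term A B (of_real t + \<i>)) UNIV"
    by (rule has_sum_iterated[OF swp]) (use row in simp)
  moreover have "(\<lambda>j. complex_of_real (p j) * cinner (f j) (?C (f j))) sums \<omega> (?C \<or>\<^sub>H id)"
    by (intro \<omega>_sums bounded_ops_comp A UAU_bounded B)
  ultimately show ?thesis
    using sums_unique2 by (fastforce simp: \<alpha>_vee B vee_id_comp A UAU_bounded)
qed

lemma kms_uniform_limit:
  assumes "A \<in> bounded_ops" "B \<in> bounded_ops"
  shows "uniform_limit {z. 0 \<le> Im z \<and> Im z \<le> 1} (\<lambda>I z. \<Sum>x\<in>I. kms_term A B z x)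
    (\<lambda>z. infsum (kms_term A B z) UNIV) (finite_subsets_at_top UNIV)"
  by (rule Weierstrass_m_test_general[OF _ kms_bound_summable[OF assms]]) (auto intro: kms_term_le)

lemma kms_term_holomorphic: "(\<lambda>z. kms_term A B z x) holomorphic_on S"
  unfolding kms_term_def by (cases x) (auto intro!: holomorphic_intros)

lemma kms_state_\<omega>: "kms_state left_vN_algebra \<alpha> 1 \<omega>"
  unfolding kms_state_def
proof (intro conjI ballI)
  show "von_neumann_algebra (left_vN_algebra :: ('a hs \<Rightarrow> 'a hs) set)" by (rule von_neumann_left_vN_algebra)
  show "automorphism_group left_vN_algebra \<alpha>" by (rule automorphism_group_\<alpha>)
  show "normal_state left_vN_algebra \<omega>"
    using normal_vector_state[OF norm_\<xi>] by (simp add: \<omega>_def[abs_def])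
  fix X Y :: "'a hs \<Rightarrow> 'a hs" assume "X \<in> left_vN_algebra" "Y \<in> left_vN_algebra"
  then obtain A B where A: "A \<in> bounded_ops" "X = A \<or>\<^sub>H id" and B: "B \<in> bounded_ops" "Y = B \<or>\<^sub>H id"
    by (auto simp: left_vN_algebra_def)
  let ?F = "\<lambda>z. infsum (kms_term A B z) UNIV" and ?C = "{z. 0 \<le> Im z \<and> Im z \<le> 1}"
  note ul = kms_uniform_limit[OF A(1) B(1)]
  have strip: "kms_strip 1 = {z. 0 < Im z \<and> Im z < 1}" by (simp add: kms_strip_def)
  have "?F analytic_on kms_strip 1"
    unfolding analytic_on_def
  proof
    fix z assume z: "z \<in> kms_strip 1"
    have "open (kms_strip 1)"
      unfolding strip by (intro open_Collect_conj open_Collect_less continuous_intros)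
    then obtain r where r: "r > 0" "cball z r \<subseteq> kms_strip 1" using z open_contains_cball by blast
    have "?F holomorphic_on ball z r"
    proof (rule holomorphic_uniform_limit)
      show "uniform_limit (cball z r) (\<lambda>I z. \<Sum>x\<in>I. kms_term A B z x) ?F (finite_subsets_at_top UNIV)"
        using r(2) by (intro uniform_limit_on_subset[OF ul]) (auto simp: strip)
      show "\<forall>\<^sub>F I in finite_subsets_at_top UNIV. continuous_on (cball z r) (\<lambda>z. \<Sum>x\<in>I. kms_term A B z x) \<and>
          (\<lambda>z. \<Sum>x\<in>I. kms_term A B z x) holomorphic_on ball z r"
        by (intro always_eventually allI conjI holomorphic_on_imp_continuous_on holomorphic_on_sum
            kms_term_holomorphic)
    qed simp_all
    thus "\<exists>e>0. ?F holomorphic_on ball z e" using r(1) by blast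
  qed
  moreover have "continuous_on (closure (kms_strip 1)) ?F"
  proof (rule continuous_on_subset)
    show "continuous_on ?C ?F"
      by (rule uniform_limit_theorem[OF _ ul])
        (simp_all add: always_eventually holomorphic_on_imp_continuous_on holomorphic_on_sum kms_term_holomorphic)
    have "closed ?C" by (intro closed_Collect_conj closed_Collect_le continuous_intros)
    thus "closure (kms_strip 1) \<subseteq> ?C" by (intro closure_minimal) (auto simp: strip)
  qed
  ultimately show "\<exists>F :: complex \<Rightarrow> complex. F analytic_on kms_strip 1 \<and> continuous_on (closure (kms_strip 1)) F \<and>
        (\<forall>t::real. F (of_real t) = \<omega> (X \<circ> \<alpha> t Y) \<and> F (of_real t + \<i> * of_real 1) = \<omega> (\<alpha> t Y \<circ> X))"
    using kms_boundary_real[OF A(1) B(1)] kms_boundary_shifted[OF A(1) B(1)]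
    by (intro exI[of _ ?F]) (simp add: A(2) B(2))
qed

end

lemma exp_hilbert_schmidt_kms_state:
  fixes h :: "'a::separable_hilbert operator"
  assumes S: "hilbert_schmidt S"
    and fc: "functional_calculus (\<lambda>s. complex_of_real (exp (- s / 2))) h = graph_of S"
  shows "\<exists>\<alpha> \<omega>. (\<forall>t. \<forall>A\<in>bounded_ops. \<alpha> t (A \<or>\<^sub>H id) =
      (op_apply (functional_calculus (\<lambda>s. exp (\<i> * of_real (t * s))) h) \<circ> A \<circ>
       op_apply (functional_calculus (\<lambda>s. exp (- \<i> * of_real (t * s))) h)) \<or>\<^sub>H id) \<and>
    kms_state left_vN_algebra \<alpha> 1 \<omega>"
proof -
  obtain f :: "nat \<Rightarrow> 'a" and l where f: "is_onb f" and h: "h = diag_op f (\<lambda>i. complex_of_real (l i))"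
    and Sf: "\<And>i. S (f i) = complex_of_real (exp (- l i / 2)) *\<^sub>C f i"
    using exp_hilbert_schmidt_diagonal[OF S fc] by metis
  \<comment> \<open>The partition function Tr exp(-h): computing ||S||^2 in the eigenbasis gives the
    sum of exp(-l i).\<close>
  define Z where "Z = (norm (Abs_hs S))\<^sup>2"
  have sq: "(exp (- (l i / 2)))\<^sup>2 = exp (- l i)" for i
    by (simp add: power2_eq_square flip: exp_add)
  have sums: "(\<lambda>i. exp (- l i)) sums Z"
    using hs_norm_onb(1)[OF f, of "Abs_hs S"]
    by (simp add: Abs_hs_op[OF S] Sf norm_scaleC onb_norm[OF f] Z_def sq)
  have Z: "Z > 0"
    using sums suminf_pos[of "\<lambda>i. exp (- l i)"] by (simp add: sums_iff)
  interpret gibbs f l "\<lambda>n. exp (- l n) / Z" Z "complex_of_real (1 / sqrt Z) *\<^sub>C Abs_hs S"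
  proof
    show "summable (\<lambda>n. exp (- l n) / Z)" using sums by (intro summable_divide) (auto simp: sums_iff)
    have "sqrt (exp (- l n)) = exp (- l n / 2)" for n
      by (rule real_sqrt_unique) (simp_all add: sq)
    thus "hs_op (complex_of_real (1 / sqrt Z) *\<^sub>C Abs_hs S) (f n) = complex_of_real (sqrt (exp (- l n) / Z)) *\<^sub>C f n" for n
      by (simp add: Abs_hs_op[OF S] Sf scaleC_scaleC real_sqrt_divide)
    show "norm (complex_of_real (1 / sqrt Z) *\<^sub>C Abs_hs S) = 1"
      using Z by (simp add: norm_scaleC Z_def norm_divide)
  qed (use f Z in auto)
  have U: "op_apply (functional_calculus (\<lambda>s. exp (\<i> * of_real (t * s))) h) = U t" for t
  proof -
    have "(\<lambda>s. exp (\<i> * complex_of_real (t * s))) \<in> borel_measurable borel"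
      by (intro borel_measurable_continuous_onI continuous_intros)
    thus ?thesis unfolding h U_def by (simp only: functional_calculus_diag_op[OF f]
      diag_op_bounded[OF f phase] op_apply_graph_of)
  qed
  have U': "op_apply (functional_calculus (\<lambda>s. exp (- \<i> * of_real (t * s))) h) = U (- t)" for t
    using U[of "- t"] by simp
  show ?thesis
    by (intro exI[of _ \<alpha>] exI[of _ \<omega>] conjI allI ballI kms_state_\<omega>) (simp only: \<alpha>_vee U U')
qed

theorem mainTheorem2:
  shows "(\<forall>(\<Omega> :: 'a::separable_hilbert hs) T h.
      cyclic_vector A_left \<Omega> \<longrightarrow> separating_vector A_left \<Omega> \<longrightarrow> associated_operator \<Omega> T \<longrightarrow>
      h = op_scale (-2) (op_log (op_abs (hs_op T))) \<longrightarrow>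
      (\<exists>(f :: nat \<Rightarrow> 'a) (ev :: nat \<Rightarrow> real). is_onb f \<and>
         (\<forall>i. (f i, complex_of_real (ev i) *\<^sub>C f i) \<in> h) \<and>
         filterlim ev at_top sequentially \<and>
         (\<lambda>i. exp (- ev i)) sums (norm T)\<^sup>2)) \<and>
    (\<forall>h :: 'a operator. self_adjoint h \<longrightarrow>
      (\<exists>S. hilbert_schmidt S \<and>
         functional_calculus (\<lambda>s. complex_of_real (exp (- s / 2))) h = graph_of S) \<longrightarrow>
      (\<exists>\<alpha> \<omega>.
         (\<forall>t. \<forall>A\<in>bounded_ops. \<alpha> t (A \<or>\<^sub>H id) =
            (op_apply (functional_calculus (\<lambda>s. exp (\<i> * of_real (t * s))) h) \<circ> A \<circ>
             op_apply (functional_calculus (\<lambda>s. exp (- \<i> * of_real (t * s))) h)) \<or>\<^sub>H id) \<and>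
         kms_state left_vN_algebra \<alpha> 1 \<omega>))"
proof (intro conjI allI impI)
  fix \<Omega> T :: "'a hs" and h
  assume cyc: "cyclic_vector A_left \<Omega>" and T: "associated_operator \<Omega> T"
    and h: "h = op_scale (-2) (op_log (op_abs (hs_op T)))"
  \<comment> \<open>The associated operator is \<Omega> itself, so cyclicity speaks about T.\<close>
  have "x = 0" if "hs_op T x = 0" for x
    using cyclic_injective[OF cyc, of x] that by (simp add: associated_operator_eq[OF T])
  from op_log_op_abs_spectrum[of T, OF this]
  show "\<exists>(f :: nat \<Rightarrow> 'a) (ev :: nat \<Rightarrow> real). is_onb f \<and>
         (\<forall>i. (f i, complex_of_real (ev i) *\<^sub>C f i) \<in> h) \<and>
         filterlim ev at_top sequentially \<and>
         (\<lambda>i. exp (- ev i)) sums (norm T)\<^sup>2"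
    unfolding h by metis
next
  fix h :: "'a operator"
  assume "\<exists>S. hilbert_schmidt S \<and>
         functional_calculus (\<lambda>s. complex_of_real (exp (- s / 2))) h = graph_of S"
  thus "\<exists>\<alpha> \<omega>.
         (\<forall>t. \<forall>A\<in>bounded_ops. \<alpha> t (A \<or>\<^sub>H id) =
            (op_apply (functional_calculus (\<lambda>s. exp (\<i> * of_real (t * s))) h) \<circ> A \<circ>
             op_apply (functional_calculus (\<lambda>s. exp (- \<i> * of_real (t * s))) h)) \<or>\<^sub>H id) \<and>
         kms_state left_vN_algebra \<alpha> 1 \<omega>"
    using exp_hilbert_schmidt_kms_state by blast
qed

end
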